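(* Let $(R,\mathfrak{m})$ be a commutative noetherian local ring, let $0\to M_1\to M_2\to M_3\to 0$ be an exact sequence of finitely generated $R$-modules, and assume that $M_3$ is locally free on the punctured spectrum, i.e. $(M_3)_{\mathfrak{p}}$ is a free $R_{\mathfrak{p}}$-module for every prime ideal $\mathfrak{p}\neq\mathfrak{m}$. Then $\operatorname{E-Ass}_R(M_2)\subseteq \operatorname{E-Ass}_R(M_1)\cup\operatorname{E-Ass}_R(M_3)$.
   Context: For an $R$-module $M$, $\operatorname{E-Ass}_R(M):=\bigcup_{i\ge 0}\operatorname{Ass}_R(\operatorname{Ext}^i_R(M,R))$. *)

theory Defs
  imports "HOL-Algebra.Module" "HOL-Algebra.Ideal" "HOL-Algebra.Ring_Divisibility"
begin

text \<open>
  Modules are the records of the theory \<open>HOL-Algebra.Module\<close>. These records inherit the fields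
  \<open>mult\<close> and \<open>one\<close> from rings; they play no role for a module, and are mostly left
  \<open>undefined\<close> in the constructions below.
\<close>

section \<open>Module homomorphisms, quotients, free modules\<close>

definition mod_hom ::
    "('r, 'x) ring_scheme \<Rightarrow> ('r, 'm, 'y) module_scheme \<Rightarrow> ('r, 'n, 'z) module_scheme \<Rightarrow> ('m \<Rightarrow> 'n) set"
  where "mod_hom R M N = {f \<in> carrier M \<rightarrow> carrier N.
     (\<forall>x\<in>carrier M. \<forall>y\<in>carrier M. f (x \<oplus>\<^bsub>M\<^esub> y) = f x \<oplus>\<^bsub>N\<^esub> f y) \<and>
     (\<forall>r\<in>carrier R. \<forall>x\<in>carrier M. f (r \<odot>\<^bsub>M\<^esub> x) = r \<odot>\<^bsub>N\<^esub> f x)}"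

definition short_exact ::
    "('r, 'x) ring_scheme \<Rightarrow> ('r, 'a, 'u) module_scheme \<Rightarrow> ('r, 'b, 'v) module_scheme \<Rightarrow>
     ('r, 'c, 'w) module_scheme \<Rightarrow> ('a \<Rightarrow> 'b) \<Rightarrow> ('b \<Rightarrow> 'c) \<Rightarrow> bool"
  where "short_exact R M1 M2 M3 f g \<longleftrightarrow>
     f \<in> mod_hom R M1 M2 \<and> g \<in> mod_hom R M2 M3 \<and>
     inj_on f (carrier M1) \<and> f ` carrier M1 = a_kernel M2 M3 g \<and> g ` carrier M2 = carrier M3"

definition fin_gen_module :: "('r, 'x) ring_scheme \<Rightarrow> ('r, 'm, 'y) module_scheme \<Rightarrow> bool"
  where "fin_gen_module R M \<longleftrightarrow> (\<exists>A. finite A \<and> A \<subseteq> carrier M \<and>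
     carrier M = {\<Oplus>\<^bsub>M\<^esub>a\<in>A. c a \<odot>\<^bsub>M\<^esub> a | c. c \<in> A \<rightarrow> carrier R})"

definition ring_as_module :: "('r, 'x) ring_scheme \<Rightarrow> ('r, 'r) module"
  where "ring_as_module R = \<lparr>carrier = carrier R, monoid.mult = monoid.mult R, one = one R,
     ring.zero = ring.zero R, ring.add = ring.add R, smult = monoid.mult R\<rparr>"

text \<open>The module of linear maps; restricting to \<open>extensional\<close> functions makes equality in
  this module agree with equality on \<open>carrier M\<close>.\<close>

definition hom_module ::
    "('r, 'x) ring_scheme \<Rightarrow> ('r, 'm, 'y) module_scheme \<Rightarrow> ('r, 'n, 'z) module_scheme \<Rightarrow>
     ('r, 'm \<Rightarrow> 'n) module"
  where "hom_module R M N = \<lparr>carrier = mod_hom R M N \<inter> extensional (carrier M),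
     monoid.mult = undefined, one = undefined,
     ring.zero = (\<lambda>x\<in>carrier M. \<zero>\<^bsub>N\<^esub>),
     ring.add = (\<lambda>f g. \<lambda>x\<in>carrier M. f x \<oplus>\<^bsub>N\<^esub> g x),
     smult = (\<lambda>r f. \<lambda>x\<in>carrier M. r \<odot>\<^bsub>N\<^esub> f x)\<rparr>"

definition quot_module :: "('r, 'm, 'y) module_scheme \<Rightarrow> 'm set \<Rightarrow> ('r, 'm set) module"
  where "quot_module M H = \<lparr>carrier = a_rcosets\<^bsub>M\<^esub> H, monoid.mult = undefined, one = undefined,
     ring.zero = H, ring.add = (\<lambda>X Y. X <+>\<^bsub>M\<^esub> Y),
     smult = (\<lambda>r X. \<Union>x\<in>X. H +>\<^bsub>M\<^esub> (r \<odot>\<^bsub>M\<^esub> x))\<rparr>"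

definition fin_coeffs :: "('r, 'x) ring_scheme \<Rightarrow> 'b set \<Rightarrow> ('b \<Rightarrow> 'r) set"
  where "fin_coeffs R B = {a. (\<forall>b\<in>B. a b \<in> carrier R) \<and> (\<forall>b. b \<notin> B \<longrightarrow> a b = \<zero>\<^bsub>R\<^esub>) \<and>
     finite {b. a b \<noteq> \<zero>\<^bsub>R\<^esub>}}"

definition lin_comb ::
    "('r, 'x) ring_scheme \<Rightarrow> ('r, 'm, 'y) module_scheme \<Rightarrow> ('b \<Rightarrow> 'm) \<Rightarrow> ('b \<Rightarrow> 'r) \<Rightarrow> 'm"
  where "lin_comb R M v a = (\<Oplus>\<^bsub>M\<^esub>b\<in>{b. a b \<noteq> \<zero>\<^bsub>R\<^esub>}. a b \<odot>\<^bsub>M\<^esub> v b)"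

text \<open>\<open>B\<close> is a basis if every element is, in a unique way, a finite linear combination of \<open>B\<close>.\<close>

definition module_basis :: "('r, 'x) ring_scheme \<Rightarrow> ('r, 'm, 'y) module_scheme \<Rightarrow> 'm set \<Rightarrow> bool"
  where "module_basis R M B \<longleftrightarrow>
     B \<subseteq> carrier M \<and> bij_betw (lin_comb R M (\<lambda>b. b)) (fin_coeffs R B) (carrier M)"

definition free_module :: "('r, 'x) ring_scheme \<Rightarrow> ('r, 'm, 'y) module_scheme \<Rightarrow> bool"
  where "free_module R M \<longleftrightarrow> module R M \<and> (\<exists>B. module_basis R M B)"


section \<open>Ext and its associated primes\<close>

text \<open>\<open>\<cdots> \<rightarrow> F 2 \<rightarrow> F 1 \<rightarrow> F 0 \<rightarrow> M \<rightarrow> 0\<close> is exact with free \<open>F n\<close>,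
  where \<open>d n\<close> maps \<open>F (n + 1)\<close> to \<open>F n\<close> and \<open>e\<close> is the augmentation.\<close>

definition free_resolution ::
    "('r, 'x) ring_scheme \<Rightarrow> ('r, 'm, 'y) module_scheme \<Rightarrow> (nat \<Rightarrow> ('r, 'p) module) \<Rightarrow>
     (nat \<Rightarrow> 'p \<Rightarrow> 'p) \<Rightarrow> ('p \<Rightarrow> 'm) \<Rightarrow> bool"
  where "free_resolution R M F d e \<longleftrightarrow>
     (\<forall>n. free_module R (F n)) \<and>
     (\<forall>n. d n \<in> mod_hom R (F (Suc n)) (F n)) \<and> e \<in> mod_hom R (F 0) M \<and>
     e ` carrier (F 0) = carrier M \<and>
     d 0 ` carrier (F 1) = a_kernel (F 0) M e \<and>
     (\<forall>n. d (Suc n) ` carrier (F (Suc (Suc n))) = a_kernel (F (Suc n)) (F n) (d n))"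

text \<open>The cohomology in degree \<open>i\<close> of the complex \<open>Hom(F 0, N) \<rightarrow> Hom(F 1, N) \<rightarrow> \<cdots>\<close>.\<close>

definition cocycles ::
    "('r, 'x) ring_scheme \<Rightarrow> (nat \<Rightarrow> ('r, 'p) module) \<Rightarrow> (nat \<Rightarrow> 'p \<Rightarrow> 'p) \<Rightarrow>
     ('r, 'n, 'z) module_scheme \<Rightarrow> nat \<Rightarrow> ('p \<Rightarrow> 'n) set"
  where "cocycles R F d N i =
     a_kernel (hom_module R (F i) N) (hom_module R (F (Suc i)) N)
       (\<lambda>f. compose (carrier (F (Suc i))) f (d i))"

definition coboundaries ::
    "('r, 'x) ring_scheme \<Rightarrow> (nat \<Rightarrow> ('r, 'p) module) \<Rightarrow> (nat \<Rightarrow> 'p \<Rightarrow> 'p) \<Rightarrow>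
     ('r, 'n, 'z) module_scheme \<Rightarrow> nat \<Rightarrow> ('p \<Rightarrow> 'n) set"
  where "coboundaries R F d N i = (case i of
       0 \<Rightarrow> {\<zero>\<^bsub>hom_module R (F 0) N\<^esub>}
     | Suc j \<Rightarrow> (\<lambda>f. compose (carrier (F (Suc j))) f (d j)) ` carrier (hom_module R (F j) N))"

definition ext_of_resolution ::
    "('r, 'x) ring_scheme \<Rightarrow> (nat \<Rightarrow> ('r, 'p) module) \<Rightarrow> (nat \<Rightarrow> 'p \<Rightarrow> 'p) \<Rightarrow>
     ('r, 'n, 'z) module_scheme \<Rightarrow> nat \<Rightarrow> ('r, ('p \<Rightarrow> 'n) set) module"
  where "ext_of_resolution R F d N i =
     quot_module ((hom_module R (F i) N)\<lparr>carrier := cocycles R F d N i\<rparr>) (coboundaries R F d N i)"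

text \<open>
  Ext is computed from a chosen free resolution. The type in which the modules of the resolution
  live has to be fixed in advance, and has to be large enough for every \<open>R\<close>-module \<open>M\<close> with
  elements in \<open>'m\<close> to have a resolution there: generators of the first free module are named by
  elements of \<open>M\<close>, generators of each further one by the formal linear combinations (of
  generators of the preceding one) that they are mapped to. The lemma \<open>free_resolution_exists\<close>
  below shows that this suffices.
\<close>

datatype ('r, 'm) res_gen = Gen 'm | Rel "(('r, 'm) res_gen \<times> 'r) list"

type_synonym ('r, 'm) res_elem = "('r, 'm) res_gen \<Rightarrow> 'r"

definition chosen_resolution ::
    "('r, 'x) ring_scheme \<Rightarrow> ('r, 'm, 'y) module_scheme \<Rightarrow>
     (nat \<Rightarrow> ('r, ('r, 'm) res_elem) module) \<times>
     (nat \<Rightarrow> ('r, 'm) res_elem \<Rightarrow> ('r, 'm) res_elem) \<times> (('r, 'm) res_elem \<Rightarrow> 'm)"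
  where "chosen_resolution R M = (SOME (F, d, e). free_resolution R M F d e)"

text \<open>The free module \<open>R^(B)\<close>, as the finitely supported functions on \<open>B\<close>.\<close>

definition fin_module :: "('r, 'x) ring_scheme \<Rightarrow> 'b set \<Rightarrow> ('r, 'b \<Rightarrow> 'r) module"
  where "fin_module R B = \<lparr>carrier = fin_coeffs R B, monoid.mult = undefined, one = undefined,
     ring.zero = (\<lambda>_. \<zero>\<^bsub>R\<^esub>), ring.add = (\<lambda>a b x. a x \<oplus>\<^bsub>R\<^esub> b x),
     smult = (\<lambda>r a x. r \<otimes>\<^bsub>R\<^esub> a x)\<rparr>"

lemma fin_coeffs_closed: "cring R \<Longrightarrow> a \<in> fin_coeffs R B \<Longrightarrow> a x \<in> carrier R"
  unfolding fin_coeffs_def by (metis (mono_tags, lifting) mem_Collect_eq cring.cring_simprules(2))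

lemma fin_coeffs_add:
  assumes "cring R" "a \<in> fin_coeffs R B" "b \<in> fin_coeffs R B"
  shows "(\<lambda>x. a x \<oplus>\<^bsub>R\<^esub> b x) \<in> fin_coeffs R B"
proof -
  interpret cring R by fact
  have "finite ({x. a x \<noteq> \<zero>\<^bsub>R\<^esub>} \<union> {x. b x \<noteq> \<zero>\<^bsub>R\<^esub>})"
    using assms unfolding fin_coeffs_def by auto
  moreover have "{x. a x \<oplus>\<^bsub>R\<^esub> b x \<noteq> \<zero>\<^bsub>R\<^esub>} \<subseteq> {x. a x \<noteq> \<zero>\<^bsub>R\<^esub>} \<union> {x. b x \<noteq> \<zero>\<^bsub>R\<^esub>}"
    by auto
  ultimately have "finite {x. a x \<oplus>\<^bsub>R\<^esub> b x \<noteq> \<zero>\<^bsub>R\<^esub>}" by (rule rev_finite_subset)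
  then show ?thesis using assms unfolding fin_coeffs_def by auto
qed

lemma fin_coeffs_smult:
  assumes "cring R" "a \<in> fin_coeffs R B" "r \<in> carrier R"
  shows "(\<lambda>x. r \<otimes>\<^bsub>R\<^esub> a x) \<in> fin_coeffs R B"
proof -
  interpret cring R by fact
  have "finite {x. a x \<noteq> \<zero>\<^bsub>R\<^esub>}"
    using assms unfolding fin_coeffs_def by auto
  moreover have "{x. r \<otimes>\<^bsub>R\<^esub> a x \<noteq> \<zero>\<^bsub>R\<^esub>} \<subseteq> {x. a x \<noteq> \<zero>\<^bsub>R\<^esub>}"
    using assms by auto
  ultimately have "finite {x. r \<otimes>\<^bsub>R\<^esub> a x \<noteq> \<zero>\<^bsub>R\<^esub>}" by (rule rev_finite_subset)
  then show ?thesis using assms unfolding fin_coeffs_def by auto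
qed

lemma fin_module_module:
  assumes "cring R" shows "module R (fin_module R B)"
proof -
  interpret cring R by fact
  note cl = fin_coeffs_closed[OF assms] and ad = fin_coeffs_add[OF assms] and sm = fin_coeffs_smult[OF assms]
  show ?thesis
  proof (rule moduleI)
    show "abelian_group (fin_module R B)"
    proof (rule abelian_groupI)
      fix a assume a: "a \<in> carrier (fin_module R B)"
      have "(\<lambda>x. \<ominus>\<^bsub>R\<^esub> \<one>\<^bsub>R\<^esub> \<otimes>\<^bsub>R\<^esub> a x) \<in> fin_coeffs R B"
        using a by (intro sm) (auto simp: fin_module_def)
      moreover have "(\<lambda>x. (\<ominus>\<^bsub>R\<^esub> \<one>\<^bsub>R\<^esub> \<otimes>\<^bsub>R\<^esub> a x) \<oplus>\<^bsub>R\<^esub> a x) = (\<lambda>_. \<zero>\<^bsub>R\<^esub>)"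
        using a by (auto simp: fin_module_def cl l_minus l_neg)
      ultimately show "\<exists>b\<in>carrier (fin_module R B). b \<oplus>\<^bsub>fin_module R B\<^esub> a = \<zero>\<^bsub>fin_module R B\<^esub>"
        by (auto simp: fin_module_def)
    qed (auto simp: fin_module_def ad cl a_ac, auto simp: fin_coeffs_def)
  qed (use assms in \<open>auto simp: fin_module_def sm cl l_distr r_distr m_assoc\<close>)
qed

lemma lin_comb_eq:
  assumes "module R M" "a \<in> fin_coeffs R B" "v \<in> B \<rightarrow> carrier M"
    and "finite T" "T \<subseteq> B" "{b. a b \<noteq> \<zero>\<^bsub>R\<^esub>} \<subseteq> T"
  shows "lin_comb R M v a = (\<Oplus>\<^bsub>M\<^esub>b\<in>T. a b \<odot>\<^bsub>M\<^esub> v b)"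
proof -
  interpret M: module R M by fact
  have v: "v b \<in> carrier M" if "b \<in> T" for b using that assms by blast
  note cl = fin_coeffs_closed[OF M.R.is_cring assms(2)]
  show ?thesis unfolding lin_comb_def
    by (rule M.add.finprod_mono_neutral_cong_left) (use assms(4,6) v cl in auto)
qed

lemma lin_comb_hom:
  assumes "module R M" "v \<in> B \<rightarrow> carrier M"
  shows "lin_comb R M v \<in> mod_hom R (fin_module R B) M"
proof -
  interpret M: module R M by fact
  note cl = fin_coeffs_closed[OF M.R.is_cring]
  have supp: "finite {b. a b \<noteq> \<zero>\<^bsub>R\<^esub>}" "{b. a b \<noteq> \<zero>\<^bsub>R\<^esub>} \<subseteq> B" if "a \<in> fin_coeffs R B" for a
    using that unfolding fin_coeffs_def by auto
  have closed: "lin_comb R M v a \<in> carrier M" if "a \<in> fin_coeffs R B" for a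
    unfolding lin_comb_def using supp[OF that] cl[OF that] assms(2)
    by (intro M.finsum_closed) auto
  have add: "lin_comb R M v (\<lambda>x. a x \<oplus>\<^bsub>R\<^esub> b x) = lin_comb R M v a \<oplus>\<^bsub>M\<^esub> lin_comb R M v b"
    if a: "a \<in> fin_coeffs R B" and b: "b \<in> fin_coeffs R B" for a b
  proof -
    let ?T = "{x. a x \<noteq> \<zero>\<^bsub>R\<^esub>} \<union> {x. b x \<noteq> \<zero>\<^bsub>R\<^esub>}"
    have T: "finite ?T" "?T \<subseteq> B" using supp a b by auto
    have v: "v x \<in> carrier M" if "x \<in> ?T" for x using that T assms(2) by blast
    have "lin_comb R M v (\<lambda>x. a x \<oplus>\<^bsub>R\<^esub> b x) = (\<Oplus>\<^bsub>M\<^esub>x\<in>?T. (a x \<oplus>\<^bsub>R\<^esub> b x) \<odot>\<^bsub>M\<^esub> v x)"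
      by (rule lin_comb_eq[OF assms(1) fin_coeffs_add[OF M.R.is_cring a b] assms(2) T]) auto
    also have "\<dots> = (\<Oplus>\<^bsub>M\<^esub>x\<in>?T. a x \<odot>\<^bsub>M\<^esub> v x \<oplus>\<^bsub>M\<^esub> b x \<odot>\<^bsub>M\<^esub> v x)"
    proof (rule M.finsum_cong')
      fix x assume "x \<in> ?T"
      then show "(a x \<oplus>\<^bsub>R\<^esub> b x) \<odot>\<^bsub>M\<^esub> v x = a x \<odot>\<^bsub>M\<^esub> v x \<oplus>\<^bsub>M\<^esub> b x \<odot>\<^bsub>M\<^esub> v x"
        by (intro M.smult_l_distr v cl[OF a] cl[OF b])
    qed (use v cl[OF a] cl[OF b] in blast)+
    also have "\<dots> = (\<Oplus>\<^bsub>M\<^esub>x\<in>?T. a x \<odot>\<^bsub>M\<^esub> v x) \<oplus>\<^bsub>M\<^esub> (\<Oplus>\<^bsub>M\<^esub>x\<in>?T. b x \<odot>\<^bsub>M\<^esub> v x)"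
      by (rule M.finsum_addf) (use v cl[OF a] cl[OF b] in blast)+
    also have "(\<Oplus>\<^bsub>M\<^esub>x\<in>?T. a x \<odot>\<^bsub>M\<^esub> v x) = lin_comb R M v a"
      by (rule lin_comb_eq[OF assms(1) a assms(2) T, symmetric]) auto
    also have "(\<Oplus>\<^bsub>M\<^esub>x\<in>?T. b x \<odot>\<^bsub>M\<^esub> v x) = lin_comb R M v b"
      by (rule lin_comb_eq[OF assms(1) b assms(2) T, symmetric]) auto
    finally show ?thesis .
  qed
  have smult: "lin_comb R M v (\<lambda>x. r \<otimes>\<^bsub>R\<^esub> a x) = r \<odot>\<^bsub>M\<^esub> lin_comb R M v a"
    if a: "a \<in> fin_coeffs R B" and r: "r \<in> carrier R" for a r
  proof -
    let ?T = "{x. a x \<noteq> \<zero>\<^bsub>R\<^esub>}"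
    have T: "finite ?T" "?T \<subseteq> B" using supp a by auto
    have v: "v x \<in> carrier M" if "x \<in> ?T" for x using that T assms(2) by blast
    have "lin_comb R M v (\<lambda>x. r \<otimes>\<^bsub>R\<^esub> a x) = (\<Oplus>\<^bsub>M\<^esub>x\<in>?T. (r \<otimes>\<^bsub>R\<^esub> a x) \<odot>\<^bsub>M\<^esub> v x)"
      by (rule lin_comb_eq[OF assms(1) fin_coeffs_smult[OF M.R.is_cring a r] assms(2) T]) (use r in auto)
    also have "\<dots> = (\<Oplus>\<^bsub>M\<^esub>x\<in>?T. r \<odot>\<^bsub>M\<^esub> (a x \<odot>\<^bsub>M\<^esub> v x))"
      by (rule M.finsum_cong') (use v cl[OF a] r in \<open>auto simp: M.smult_assoc1\<close>)
    also have "\<dots> = r \<odot>\<^bsub>M\<^esub> lin_comb R M v a"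
      unfolding lin_comb_def
      by (rule M.finsum_smult_ldistr[symmetric]) (use v cl[OF a] r T in auto)
    finally show ?thesis .
  qed
  show ?thesis unfolding mod_hom_def fin_module_def using closed add smult by auto
qed

definition unit_coeff :: "('r, 'x) ring_scheme \<Rightarrow> 'b \<Rightarrow> 'b \<Rightarrow> 'r"
  where "unit_coeff R c = (\<lambda>b. if b = c then \<one>\<^bsub>R\<^esub> else \<zero>\<^bsub>R\<^esub>)"

lemma unit_coeff_in:
  assumes "cring R" "c \<in> B" shows "unit_coeff R c \<in> fin_coeffs R B"
proof -
  interpret cring R by fact
  have "finite {b. unit_coeff R c b \<noteq> \<zero>\<^bsub>R\<^esub>}"
    by (rule finite_subset[of _ "{c}"]) (auto simp: unit_coeff_def)
  then show ?thesis using assms(2) by (auto simp: unit_coeff_def fin_coeffs_def)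
qed

lemma lin_comb_unit:
  assumes "module R M" "v \<in> B \<rightarrow> carrier M" "c \<in> B"
  shows "lin_comb R M v (unit_coeff R c) = v c"
proof -
  interpret M: module R M by fact
  have "lin_comb R M v (unit_coeff R c) = (\<Oplus>\<^bsub>M\<^esub>b\<in>{c}. unit_coeff R c b \<odot>\<^bsub>M\<^esub> v b)"
    by (rule lin_comb_eq[OF assms(1) unit_coeff_in[OF M.R.is_cring assms(3)] assms(2)])
       (use assms in \<open>auto simp: unit_coeff_def\<close>)
  also have "\<dots> = v c" using assms by (auto simp: unit_coeff_def Pi_iff)
  finally show ?thesis .
qed

lemma finsum_fin_module:
  assumes "cring R" "finite T" "w \<in> T \<rightarrow> fin_coeffs R B"
  shows "(\<Oplus>\<^bsub>fin_module R B\<^esub>t\<in>T. w t) x = (\<Oplus>\<^bsub>R\<^esub>t\<in>T. w t x)"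
proof -
  interpret cring R by fact
  interpret F: module R "fin_module R B" by (rule fin_module_module) fact
  show ?thesis using assms(2,3)
  proof (induction T rule: finite_induct)
    case empty
    show ?case unfolding F.finsum_empty finsum_empty by (simp add: fin_module_def)
  next
    case (insert t T)
    have w: "w u x \<in> carrier R" if "u \<in> insert t T" for u
      using insert.prems that by (intro fin_coeffs_closed[OF assms(1), of _ B]) blast
    have "(\<Oplus>\<^bsub>fin_module R B\<^esub>t\<in>insert t T. w t) = w t \<oplus>\<^bsub>fin_module R B\<^esub> (\<Oplus>\<^bsub>fin_module R B\<^esub>t\<in>T. w t)"
      using insert by (intro F.finsum_insert) (auto simp: fin_module_def)
    moreover have "(\<Oplus>\<^bsub>R\<^esub>t\<in>insert t T. w t x) = w t x \<oplus>\<^bsub>R\<^esub> (\<Oplus>\<^bsub>R\<^esub>t\<in>T. w t x)"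
      using insert(1,2) w by (intro finsum_insert) auto
    ultimately show ?case using insert by (simp add: fin_module_def)
  qed
qed

lemma fin_module_free:
  fixes R :: "('r, 'x) ring_scheme" and B :: "'b set"
  assumes "cring R" shows "free_module R (fin_module R B)"
proof -
  interpret cring R by fact
  have F: "module R (fin_module R B)" by (rule fin_module_module) fact
  let ?u = "unit_coeff R :: 'b \<Rightarrow> 'b \<Rightarrow> 'r"
  have "\<exists>C. module_basis R (fin_module R B) C"
  proof (cases "\<one>\<^bsub>R\<^esub> = \<zero>\<^bsub>R\<^esub>")
    case True
    then have "carrier R = {\<zero>\<^bsub>R\<^esub>}" using one_zeroD by auto
    then have fc: "fin_coeffs R C = {\<lambda>_. \<zero>\<^bsub>R\<^esub>}" for C :: "'z set"
      by (auto simp: fin_coeffs_def)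
    interpret F: module R "fin_module R B" by (rule F)
    have "lin_comb R (fin_module R B) (\<lambda>b. b) (\<lambda>_. \<zero>\<^bsub>R\<^esub>) = (\<lambda>_. \<zero>\<^bsub>R\<^esub>)"
      by (simp add: lin_comb_def) (simp add: fin_module_def)
    moreover have "carrier (fin_module R B) = {\<lambda>_. \<zero>\<^bsub>R\<^esub>}"
      using fc by (simp add: fin_module_def)
    ultimately have "module_basis R (fin_module R B) {}"
      unfolding module_basis_def bij_betw_def fc by simp
    then show ?thesis ..
  next
    case False
    have inj: "inj ?u" using False by (metis (mono_tags, lifting) injI unit_coeff_def)
    have id: "(\<lambda>b. b) \<in> ?u ` B \<rightarrow> carrier (fin_module R B)"
      using unit_coeff_in[OF assms] by (auto simp: fin_module_def)
    have u_eq: "?u x = ?u c \<longleftrightarrow> x = c" for x c using inj by (rule inj_eq)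
    have ev: "lin_comb R (fin_module R B) (\<lambda>b. b) a x = a (?u x)"
      if a: "a \<in> fin_coeffs R (?u ` B)" for a x
    proof -
      note cl = fin_coeffs_closed[OF assms a]
      let ?T = "{b. a b \<noteq> \<zero>\<^bsub>R\<^esub>}"
      have T: "finite ?T" "?T \<subseteq> ?u ` B" using a by (auto simp: fin_coeffs_def)
      have sm: "(\<lambda>y. a b \<otimes>\<^bsub>R\<^esub> b y) \<in> fin_coeffs R B" if bT: "b \<in> ?T" for b
      proof (rule fin_coeffs_smult[OF assms _ cl])
        obtain c where "b = ?u c" "c \<in> B" using bT T(2) by blast
        then show "b \<in> fin_coeffs R B" by (simp add: unit_coeff_in[OF assms])
      qed
      have "lin_comb R (fin_module R B) (\<lambda>b. b) a x = (\<Oplus>\<^bsub>R\<^esub>b\<in>?T. (a b \<odot>\<^bsub>fin_module R B\<^esub> b) x)"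
        unfolding lin_comb_def
        by (rule finsum_fin_module[OF assms T(1)]) (use sm in \<open>simp add: fin_module_def\<close>)
      also have "\<dots> = (\<Oplus>\<^bsub>R\<^esub>b\<in>?T. if ?u x = b then a b else \<zero>\<^bsub>R\<^esub>)"
      proof (rule finsum_cong')
        fix b assume "b \<in> ?T"
        then obtain c where c: "b = ?u c" using T(2) by blast
        have "b x = (if ?u x = b then \<one>\<^bsub>R\<^esub> else \<zero>\<^bsub>R\<^esub>)"
          unfolding c u_eq by (simp add: unit_coeff_def)
        then show "(a b \<odot>\<^bsub>fin_module R B\<^esub> b) x = (if ?u x = b then a b else \<zero>\<^bsub>R\<^esub>)"
          using cl by (simp add: fin_module_def)
      qed (use cl in auto)
      also have "\<dots> = a (?u x)"
      proof (cases "?u x \<in> ?T")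
        case True
        show ?thesis by (rule add.finprod_singleton[OF True T(1)]) (use cl in auto)
      next
        case nT: False
        then have "(\<Oplus>\<^bsub>R\<^esub>b\<in>?T. if ?u x = b then a b else \<zero>\<^bsub>R\<^esub>) = (\<Oplus>\<^bsub>R\<^esub>b\<in>?T. \<zero>\<^bsub>R\<^esub>)"
          by (intro finsum_cong') auto
        then show ?thesis using nT by simp
      qed
      finally show ?thesis .
    qed
    define g where "g = (\<lambda>y b. if b \<in> ?u ` B then y (inv_into UNIV ?u b) else \<zero>\<^bsub>R\<^esub>)"
    have gu: "g y (?u c) = (if c \<in> B then y c else \<zero>\<^bsub>R\<^esub>)" for y c
      using inj by (simp add: g_def inj_image_mem_iff)
    have g: "g y \<in> fin_coeffs R (?u ` B)" if y: "y \<in> fin_coeffs R B" for y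
    proof -
      have "{b. g y b \<noteq> \<zero>\<^bsub>R\<^esub>} \<subseteq> ?u ` {c. y c \<noteq> \<zero>\<^bsub>R\<^esub>}"
      proof
        fix b assume b: "b \<in> {b. g y b \<noteq> \<zero>\<^bsub>R\<^esub>}"
        then obtain c where "b = ?u c" by (auto simp: g_def split: if_splits)
        with b show "b \<in> ?u ` {c. y c \<noteq> \<zero>\<^bsub>R\<^esub>}" using gu[of y c] by (auto split: if_splits)
      qed
      moreover have "finite (?u ` {c. y c \<noteq> \<zero>\<^bsub>R\<^esub>})" using y by (auto simp: fin_coeffs_def)
      ultimately have "finite {b. g y b \<noteq> \<zero>\<^bsub>R\<^esub>}" by (rule finite_subset)
      moreover have "g y b \<in> carrier R" for b
        using fin_coeffs_closed[OF assms y] by (simp add: g_def)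
      moreover have "g y b = \<zero>\<^bsub>R\<^esub>" if "b \<notin> ?u ` B" for b using that by (simp add: g_def)
      ultimately show ?thesis by (simp add: fin_coeffs_def)
    qed
    have "bij_betw (lin_comb R (fin_module R B) (\<lambda>b. b)) (fin_coeffs R (?u ` B)) (fin_coeffs R B)"
    proof (rule bij_betwI[where g = g])
      show "lin_comb R (fin_module R B) (\<lambda>b. b) \<in> fin_coeffs R (?u ` B) \<rightarrow> fin_coeffs R B"
        using lin_comb_hom[OF F id] by (auto simp: mod_hom_def fin_module_def)
      show "g \<in> fin_coeffs R B \<rightarrow> fin_coeffs R (?u ` B)" using g by blast
    next
      fix a assume a: "a \<in> fin_coeffs R (?u ` B)"
      show "g (lin_comb R (fin_module R B) (\<lambda>b. b) a) = a"
      proof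
        fix b
        show "g (lin_comb R (fin_module R B) (\<lambda>b. b) a) b = a b"
        proof (cases "b \<in> ?u ` B")
          case True
          then obtain c where "b = ?u c" "c \<in> B" by blast
          then show ?thesis by (simp add: gu ev[OF a])
        next
          case nB: False
          then show ?thesis using a by (simp add: g_def fin_coeffs_def)
        qed
      qed
    next
      fix y assume y: "y \<in> fin_coeffs R B"
      show "lin_comb R (fin_module R B) (\<lambda>b. b) (g y) = y"
        using y by (auto simp: ev[OF g[OF y]] gu fun_eq_iff fin_coeffs_def)
    qed
    then have "module_basis R (fin_module R B) (?u ` B)"
      using unit_coeff_in[OF assms] by (auto simp: module_basis_def fin_module_def)
    then show ?thesis ..
  qed
  with F show ?thesis by (simp add: free_module_def)
qed

lemma a_kernel_submodule:
  assumes "module R M" "module R N" "h \<in> mod_hom R M N"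
  shows "submodule (a_kernel M N h) R M"
proof -
  interpret M: module R M by fact
  interpret N: module R N by fact
  have h0: "h \<zero>\<^bsub>M\<^esub> = \<zero>\<^bsub>N\<^esub>"
  proof -
    have "h (\<zero>\<^bsub>R\<^esub> \<odot>\<^bsub>M\<^esub> \<zero>\<^bsub>M\<^esub>) = \<zero>\<^bsub>R\<^esub> \<odot>\<^bsub>N\<^esub> h \<zero>\<^bsub>M\<^esub>" "h \<zero>\<^bsub>M\<^esub> \<in> carrier N"
      using assms(3) M.R.zero_closed M.M.zero_closed unfolding mod_hom_def by blast+
    then show ?thesis by simp
  qed
  have k: "a_kernel M N h = {x \<in> carrier M. h x = \<zero>\<^bsub>N\<^esub>}"
    by (simp add: a_kernel_def kernel_def)
  show ?thesis
  proof (rule M.submoduleI)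
    fix a assume a: "a \<in> a_kernel M N h"
    have "\<ominus>\<^bsub>M\<^esub> a = (\<ominus>\<^bsub>R\<^esub> \<one>\<^bsub>R\<^esub>) \<odot>\<^bsub>M\<^esub> a" using a by (simp add: k M.smult_l_minus)
    moreover have "h ((\<ominus>\<^bsub>R\<^esub> \<one>\<^bsub>R\<^esub>) \<odot>\<^bsub>M\<^esub> a) = (\<ominus>\<^bsub>R\<^esub> \<one>\<^bsub>R\<^esub>) \<odot>\<^bsub>N\<^esub> h a"
      using a assms(3) by (auto simp: mod_hom_def k)
    ultimately show "\<ominus>\<^bsub>M\<^esub> a \<in> a_kernel M N h" using a by (auto simp: k)
  qed (use h0 assms(3) in \<open>auto simp: k mod_hom_def\<close>)
qed

lemma free_cover:
  assumes "module R N" "submodule K R N" "inj_on name K"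
  shows "lin_comb R N (inv_into K name) \<in> mod_hom R (fin_module R (name ` K)) N"
    and "lin_comb R N (inv_into K name) ` fin_coeffs R (name ` K) = K"
proof -
  interpret N: module R N by fact
  note K = N.submoduleE[OF assms(2)]
  have v: "inv_into K name \<in> name ` K \<rightarrow> carrier N" using K(1) assms(3) by auto
  show "lin_comb R N (inv_into K name) \<in> mod_hom R (fin_module R (name ` K)) N"
    by (rule lin_comb_hom[OF assms(1) v])
  interpret KM: module R "N\<lparr>carrier := K\<rparr>"
    by (rule submodule.submodule_is_module[OF assms(2,1)])
  show "lin_comb R N (inv_into K name) ` fin_coeffs R (name ` K) = K"
  proof
    show "lin_comb R N (inv_into K name) ` fin_coeffs R (name ` K) \<subseteq> K"
    proof (rule image_subsetI)
      fix a assume a: "a \<in> fin_coeffs R (name ` K)"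
      have sum: "(\<Oplus>\<^bsub>N\<^esub>b\<in>T. w b) \<in> K" if "finite T" "w \<in> T \<rightarrow> K" for T :: "'z set" and w
        using that
      proof (induction T rule: finite_induct)
        case empty
        have "\<zero>\<^bsub>N\<lparr>carrier := K\<rparr>\<^esub> \<in> carrier (N\<lparr>carrier := K\<rparr>)" by (rule KM.M.zero_closed)
        then show ?case by simp
      next
        case (insert t T)
        then have "(\<Oplus>\<^bsub>N\<^esub>b\<in>insert t T. w b) = w t \<oplus>\<^bsub>N\<^esub> (\<Oplus>\<^bsub>N\<^esub>b\<in>T. w b)"
          using K(1) by (intro N.finsum_insert) auto
        then show ?case using insert K(5) by auto
      qed
      show "lin_comb R N (inv_into K name) a \<in> K"
        unfolding lin_comb_def
      proof (rule sum)
        show "(\<lambda>b. a b \<odot>\<^bsub>N\<^esub> inv_into K name b) \<in> {b. a b \<noteq> \<zero>\<^bsub>R\<^esub>} \<rightarrow> K"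
        proof
          fix b assume "b \<in> {b. a b \<noteq> \<zero>\<^bsub>R\<^esub>}"
          then have "b \<in> name ` K" using a unfolding fin_coeffs_def by blast
          then show "a b \<odot>\<^bsub>N\<^esub> inv_into K name b \<in> K"
            using K(4) fin_coeffs_closed[OF N.R.is_cring a] inv_into_into[of b name K] by blast
        qed
      qed (use a in \<open>simp add: fin_coeffs_def\<close>)
    qed
    show "K \<subseteq> lin_comb R N (inv_into K name) ` fin_coeffs R (name ` K)"
    proof
      fix k assume k: "k \<in> K"
      then have "lin_comb R N (inv_into K name) (unit_coeff R (name k)) = k"
        by (subst lin_comb_unit[OF assms(1) v]) (use assms(3) in auto)
      moreover have "unit_coeff R (name k) \<in> fin_coeffs R (name ` K)"
        using k by (intro unit_coeff_in N.R.is_cring) auto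
      ultimately show "k \<in> lin_comb R N (inv_into K name) ` fin_coeffs R (name ` K)" by (metis imageI)
    qed
  qed
qed

lemma inj_on_Rel_name:
  "inj_on (\<lambda>k. Rel (SOME l. set l = {(b, k b) | b. k b \<noteq> \<zero>\<^bsub>R\<^esub>})) (fin_coeffs R B)"
proof (rule inj_onI)
  let ?l = "\<lambda>k. SOME l. set l = {(b, k b) | b. k b \<noteq> \<zero>\<^bsub>R\<^esub>}"
  fix k k' assume k: "k \<in> fin_coeffs R B" "k' \<in> fin_coeffs R B" "Rel (?l k) = Rel (?l k')"
  have l: "set (?l a) = {(b, a b) | b. a b \<noteq> \<zero>\<^bsub>R\<^esub>}" if "a \<in> fin_coeffs R B" for a
    by (rule someI_ex, rule finite_list) (use that in \<open>simp add: fin_coeffs_def\<close>)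
  have "?l k = ?l k'" using k(3) by (rule res_gen.inject(2)[THEN iffD1])
  then have "set (?l k) = set (?l k')" by (rule arg_cong)
  then have "{(b, k b) | b. k b \<noteq> \<zero>\<^bsub>R\<^esub>} = {(b, k' b) | b. k' b \<noteq> \<zero>\<^bsub>R\<^esub>}"
    unfolding l[OF k(1)] l[OF k(2)] .
  then have eq: "k b \<noteq> \<zero>\<^bsub>R\<^esub> \<and> c = k b \<longleftrightarrow> k' b \<noteq> \<zero>\<^bsub>R\<^esub> \<and> c = k' b" for b c
    by (auto simp: set_eq_iff)
  show "k = k'"
  proof
    fix b show "k b = k' b" using eq[of b "k b"] eq[of b "k' b"] by metis
  qed
qed

lemma free_resolution_exists:
  fixes R :: "('r, 'x) ring_scheme" and M :: "('r, 'm, 'y) module_scheme"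
  assumes "module R M"
  shows "case chosen_resolution R M of (F, d, e) \<Rightarrow> free_resolution R M F d e"
proof -
  interpret M: module R M by fact
  let ?F = "fin_module R :: ('r, 'm) res_gen set \<Rightarrow> _"
  have mF: "module R (?F B)" for B by (rule fin_module_module[OF M.R.is_cring])
  define name :: "('r, 'm) res_elem \<Rightarrow> ('r, 'm) res_gen"
    where "name = (\<lambda>k. Rel (SOME l. set l = {(b, k b) | b. k b \<noteq> \<zero>\<^bsub>R\<^esub>}))"
  have cF: "carrier (?F B) = fin_coeffs R B" for B by (simp add: fin_module_def)
  obtain B0 e where e: "e \<in> mod_hom R (?F B0) M" "e ` carrier (?F B0) = carrier M"
    using free_cover[OF assms M.carrier_is_submodule, of Gen] unfolding cF by (auto simp: inj_on_def)
  define P where "P = (\<lambda>s :: ('r, 'm) res_gen set \<times> (('r, 'm) res_elem \<Rightarrow> ('r, 'm) res_elem) \<times> ('r, 'm) res_elem set.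
    submodule (snd (snd s)) R (?F (fst s)))"
  define Q where "Q = (\<lambda>(s :: ('r, 'm) res_gen set \<times> (('r, 'm) res_elem \<Rightarrow> ('r, 'm) res_elem) \<times> ('r, 'm) res_elem set)
    (s' :: ('r, 'm) res_gen set \<times> (('r, 'm) res_elem \<Rightarrow> ('r, 'm) res_elem) \<times> ('r, 'm) res_elem set). fst (snd s') \<in> mod_hom R (?F (fst s')) (?F (fst s)) \<and>
    fst (snd s') ` carrier (?F (fst s')) = snd (snd s) \<and>
    snd (snd s') = a_kernel (?F (fst s')) (?F (fst s)) (fst (snd s')))"
  have "\<exists>s. \<forall>n. (P (s n) \<and> (n = 0 \<longrightarrow> s n = (B0, undefined, a_kernel (?F B0) M e))) \<and> Q (s n) (s (Suc n))"
  proof (rule dependent_nat_choice)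
    show "\<exists>s. P s \<and> (0 = 0 \<longrightarrow> s = (B0, undefined, a_kernel (?F B0) M e))"
      unfolding P_def using a_kernel_submodule[OF mF assms e(1)] by auto
  next
    fix s and n :: nat assume "P s \<and> (n = 0 \<longrightarrow> s = (B0, undefined, a_kernel (?F B0) M e))"
    then have K: "submodule (snd (snd s)) R (?F (fst s))" by (simp add: P_def)
    have "snd (snd s) \<subseteq> fin_coeffs R (fst s)"
      using module.submoduleE(1)[OF mF K] by (simp add: cF)
    then have "inj_on name (snd (snd s))"
      unfolding name_def using inj_on_Rel_name by (rule inj_on_subset[rotated])
    from free_cover[OF mF K this]
    have "Q s (name ` snd (snd s), lin_comb R (?F (fst s)) (inv_into (snd (snd s)) name),
       a_kernel (?F (name ` snd (snd s))) (?F (fst s)) (lin_comb R (?F (fst s)) (inv_into (snd (snd s)) name)))"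
      by (simp add: Q_def cF)
    moreover have "P s'" if "Q s s'" for s'
      using that a_kernel_submodule[OF mF mF] by (simp add: P_def Q_def)
    ultimately show "\<exists>s'. (P s' \<and> (Suc n = 0 \<longrightarrow> s' = (B0, undefined, a_kernel (?F B0) M e))) \<and> Q s s'"
      by blast
  qed
  then obtain s where s: "s 0 = (B0, undefined, a_kernel (?F B0) M e)" "\<And>n. Q (s n) (s (Suc n))"
    by blast
  have "free_resolution R M (\<lambda>n. ?F (fst (s n))) (\<lambda>n. fst (snd (s (Suc n)))) e"
    unfolding free_resolution_def
  proof (intro conjI allI)
    show "fst (snd (s (Suc 0))) ` carrier (?F (fst (s 1))) = a_kernel (?F (fst (s 0))) M e"
      using s(2)[of 0] s(1) by (simp add: Q_def)
  next
    fix n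
    show "fst (snd (s (Suc (Suc n)))) ` carrier (?F (fst (s (Suc (Suc n))))) =
         a_kernel (?F (fst (s (Suc n)))) (?F (fst (s n))) (fst (snd (s (Suc n))))"
      using s(2)[of n] s(2)[of "Suc n"] by (simp add: Q_def)
  qed (use s e fin_module_free[OF M.R.is_cring] in \<open>auto simp: Q_def\<close>)
  then have "\<exists>p. (case p of (F, d, e) \<Rightarrow>
      free_resolution R M (F :: nat \<Rightarrow> ('r, ('r, 'm) res_elem) module) d e)"
    by (intro exI[of _ "(\<lambda>n. ?F (fst (s n)), \<lambda>n. fst (snd (s (Suc n))), e)"]) simp
  then show ?thesis unfolding chosen_resolution_def by (rule someI_ex)
qed

definition Ext ::
    "('r, 'x) ring_scheme \<Rightarrow> nat \<Rightarrow> ('r, 'm, 'y) module_scheme \<Rightarrow> ('r, 'n, 'z) module_scheme \<Rightarrow>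
     ('r, (('r, 'm) res_elem \<Rightarrow> 'n) set) module"
  where "Ext R i M N = (case chosen_resolution R M of (F, d, e) \<Rightarrow> ext_of_resolution R F d N i)"

definition Ass :: "('r, 'x) ring_scheme \<Rightarrow> ('r, 'm, 'y) module_scheme \<Rightarrow> 'r set set"
  where "Ass R M = {P. primeideal P R \<and>
     (\<exists>x\<in>carrier M. P = {r \<in> carrier R. r \<odot>\<^bsub>M\<^esub> x = \<zero>\<^bsub>M\<^esub>})}"

definition E_Ass :: "('r, 'x) ring_scheme \<Rightarrow> ('r, 'm, 'y) module_scheme \<Rightarrow> 'r set set"
  where "E_Ass R M = (\<Union>i. Ass R (Ext R i M (ring_as_module R)))"


section \<open>Localization and local rings\<close>

text \<open>Fractions \<open>x / s\<close> are classes of pairs \<open>(x, s)\<close>; here \<open>S\<close> is a multiplicative subset of \<open>R\<close>.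
  The unions in the operations run over all representatives, which all yield the same class.\<close>

definition frac_rel ::
    "'r set \<Rightarrow> ('r, 'm, 'y) module_scheme \<Rightarrow> (('m \<times> 'r) \<times> ('m \<times> 'r)) set"
  where "frac_rel S M = {((x, s), (y, t)). x \<in> carrier M \<and> s \<in> S \<and> y \<in> carrier M \<and> t \<in> S \<and>
     (\<exists>u\<in>S. u \<odot>\<^bsub>M\<^esub> (t \<odot>\<^bsub>M\<^esub> x) = u \<odot>\<^bsub>M\<^esub> (s \<odot>\<^bsub>M\<^esub> y))}"

definition fraction :: "'r set \<Rightarrow> ('r, 'm, 'y) module_scheme \<Rightarrow> 'm \<Rightarrow> 'r \<Rightarrow> ('m \<times> 'r) set"
  where "fraction S M x s = frac_rel S M `` {(x, s)}"

definition loc_ring :: "('r, 'x) ring_scheme \<Rightarrow> 'r set \<Rightarrow> ('r \<times> 'r) set ring"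
  where "loc_ring R S = (let q = fraction S (ring_as_module R) in
    \<lparr>carrier = (carrier R \<times> S) // frac_rel S (ring_as_module R),
     monoid.mult = (\<lambda>X Y. \<Union>(a, s)\<in>X. \<Union>(b, t)\<in>Y. q (a \<otimes>\<^bsub>R\<^esub> b) (s \<otimes>\<^bsub>R\<^esub> t)),
     one = q \<one>\<^bsub>R\<^esub> \<one>\<^bsub>R\<^esub>,
     ring.zero = q \<zero>\<^bsub>R\<^esub> \<one>\<^bsub>R\<^esub>,
     ring.add = (\<lambda>X Y. \<Union>(a, s)\<in>X. \<Union>(b, t)\<in>Y. q (t \<otimes>\<^bsub>R\<^esub> a \<oplus>\<^bsub>R\<^esub> s \<otimes>\<^bsub>R\<^esub> b) (s \<otimes>\<^bsub>R\<^esub> t))\<rparr>)"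

definition loc_module ::
    "('r, 'x) ring_scheme \<Rightarrow> 'r set \<Rightarrow> ('r, 'm, 'y) module_scheme \<Rightarrow>
     (('r \<times> 'r) set, ('m \<times> 'r) set) module"
  where "loc_module R S M = (let q = fraction S M in
    \<lparr>carrier = (carrier M \<times> S) // frac_rel S M, monoid.mult = undefined, one = undefined,
     ring.zero = q \<zero>\<^bsub>M\<^esub> \<one>\<^bsub>R\<^esub>,
     ring.add = (\<lambda>X Y. \<Union>(x, s)\<in>X. \<Union>(y, t)\<in>Y. q (t \<odot>\<^bsub>M\<^esub> x \<oplus>\<^bsub>M\<^esub> s \<odot>\<^bsub>M\<^esub> y) (s \<otimes>\<^bsub>R\<^esub> t)),
     smult = (\<lambda>X Y. \<Union>(a, s)\<in>X. \<Union>(y, t)\<in>Y. q (a \<odot>\<^bsub>M\<^esub> y) (s \<otimes>\<^bsub>R\<^esub> t))\<rparr>)"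

definition local_ring :: "('r, 'x) ring_scheme \<Rightarrow> 'r set \<Rightarrow> bool"
  where "local_ring R m \<longleftrightarrow> cring R \<and> {I. maximalideal I R} = {m}"

definition locally_free_punctured ::
    "('r, 'x) ring_scheme \<Rightarrow> 'r set \<Rightarrow> ('r, 'm, 'y) module_scheme \<Rightarrow> bool"
  where "locally_free_punctured R m M \<longleftrightarrow> (\<forall>P. primeideal P R \<and> P \<noteq> m \<longrightarrow>
     free_module (loc_ring R (carrier R - P)) (loc_module R (carrier R - P) M))"

end

theory Submission
  imports Defs
begin

text \<open>
  Cohomology classes are handled through representing cochains, so that \<open>P\<close> is an associated prime
  of \<open>Ext\<^sup>i(M, R)\<close> iff \<open>P\<close> is prime and of the form \<open>{r. r z is a coboundary}\<close> for a cocycle \<open>z\<close>.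

  Let \<open>P\<close> be the annihilator of a class \<open>x\<close> in \<open>Ext\<^sup>i(M2, R)\<close>. If its image in \<open>Ext\<^sup>i(M1, R)\<close> has annihilator
  \<open>P\<close>, we are done. Otherwise some \<open>r\<close> outside \<open>P\<close> kills that image, so by exactness
  \<open>r x\<close>, whose annihilator is again \<open>P\<close>, comes from a class \<open>w\<close> in \<open>Ext\<^sup>i(M3, R)\<close>, and \<open>ann w\<close> lies in \<open>P\<close>. For \<open>i = 0\<close> the map
  \<open>Hom(M3, R) \<rightarrow> Hom(M2, R)\<close> is injective and \<open>ann w = P\<close>. For \<open>i > 0\<close> and a prime \<open>p \<noteq> m\<close>, freeness of \<open>M3\<close> at \<open>p\<close>
  yields \<open>s\<close> outside \<open>p\<close> such that multiplication by \<open>s\<close> on \<open>M3\<close> factors through a free module;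
  hence \<open>s\<close> kills \<open>Ext\<^sup>i(M3, R)\<close>, so \<open>m\<close> is its only possible associated prime, and it is one because \<open>w \<noteq> 0\<close>
  and \<open>R\<close> is noetherian. As \<open>ann w\<close> lies in \<open>P\<close>, the same \<open>s\<close> excludes \<open>P \<noteq> m\<close>.

  Exactness in the middle is obtained by representing \<open>Ext(M3, R)\<close> through the mapping cone of a lift of
  \<open>M1 \<rightarrow> M2\<close> to the resolutions. The cone need not be shown to consist of free modules: maps are only lifted
  from the chosen free resolutions into it.
\<close>

section \<open>Module homomorphisms\<close>

lemma (in module) minus_zero_module: "\<ominus>\<^bsub>M\<^esub> \<zero>\<^bsub>M\<^esub> = \<zero>\<^bsub>M\<^esub>"
  by (rule M.minus_equality) auto

lemma mod_homI:
  assumes "\<And>x. x \<in> carrier M \<Longrightarrow> h x \<in> carrier N"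
    and "\<And>x y. x \<in> carrier M \<Longrightarrow> y \<in> carrier M \<Longrightarrow> h (x \<oplus>\<^bsub>M\<^esub> y) = h x \<oplus>\<^bsub>N\<^esub> h y"
    and "\<And>r x. r \<in> carrier R \<Longrightarrow> x \<in> carrier M \<Longrightarrow> h (r \<odot>\<^bsub>M\<^esub> x) = r \<odot>\<^bsub>N\<^esub> h x"
  shows "h \<in> mod_hom R M N"
  using assms by (auto simp: mod_hom_def)

lemma mod_hom_closed: "h \<in> mod_hom R M N \<Longrightarrow> x \<in> carrier M \<Longrightarrow> h x \<in> carrier N"
  by (auto simp: mod_hom_def)

lemma mod_hom_add:
  "h \<in> mod_hom R M N \<Longrightarrow> x \<in> carrier M \<Longrightarrow> y \<in> carrier M \<Longrightarrow> h (x \<oplus>\<^bsub>M\<^esub> y) = h x \<oplus>\<^bsub>N\<^esub> h y"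
  by (auto simp: mod_hom_def)

lemma mod_hom_smult:
  "h \<in> mod_hom R M N \<Longrightarrow> r \<in> carrier R \<Longrightarrow> x \<in> carrier M \<Longrightarrow> h (r \<odot>\<^bsub>M\<^esub> x) = r \<odot>\<^bsub>N\<^esub> h x"
  by (auto simp: mod_hom_def)

lemma mod_hom_zero:
  assumes "module R M" "module R N" "h \<in> mod_hom R M N"
  shows "h \<zero>\<^bsub>M\<^esub> = \<zero>\<^bsub>N\<^esub>"
proof -
  interpret M: module R M by fact
  interpret N: module R N by fact
  have "h (\<zero>\<^bsub>R\<^esub> \<odot>\<^bsub>M\<^esub> \<zero>\<^bsub>M\<^esub>) = \<zero>\<^bsub>R\<^esub> \<odot>\<^bsub>N\<^esub> h \<zero>\<^bsub>M\<^esub>"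
    by (rule mod_hom_smult[OF assms(3)]) auto
  then show ?thesis using mod_hom_closed[OF assms(3)] by simp
qed

lemma mod_hom_minus:
  assumes "module R M" "module R N" "h \<in> mod_hom R M N" "x \<in> carrier M"
  shows "h (\<ominus>\<^bsub>M\<^esub> x) = \<ominus>\<^bsub>N\<^esub> h x"
proof -
  interpret M: module R M by fact
  interpret N: module R N by fact
  have "h ((\<ominus>\<^bsub>R\<^esub> \<one>\<^bsub>R\<^esub>) \<odot>\<^bsub>M\<^esub> x) = (\<ominus>\<^bsub>R\<^esub> \<one>\<^bsub>R\<^esub>) \<odot>\<^bsub>N\<^esub> h x"
    by (rule mod_hom_smult[OF assms(3)]) (use assms in auto)
  then show ?thesis
    using mod_hom_closed[OF assms(3)] assms(4) by (simp add: M.smult_l_minus N.smult_l_minus)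
qed

lemma mod_hom_comp:
  "h \<in> mod_hom R M N \<Longrightarrow> k \<in> mod_hom R N L \<Longrightarrow> (\<lambda>x. k (h x)) \<in> mod_hom R M L"
  unfolding mod_hom_def by (simp add: Pi_iff)

lemma mod_hom_const_zero:
  assumes "module R N" shows "(\<lambda>x. \<zero>\<^bsub>N\<^esub>) \<in> mod_hom R M N"
proof -
  interpret N: module R N by fact
  show ?thesis by (auto simp: mod_hom_def)
qed

lemma mod_hom_plus:
  assumes "module R N" "h \<in> mod_hom R M N" "k \<in> mod_hom R M N"
  shows "(\<lambda>x. h x \<oplus>\<^bsub>N\<^esub> k x) \<in> mod_hom R M N"
proof -
  interpret N: module R N by fact
  show ?thesis
    by (rule mod_homI)
       (use mod_hom_closed[OF assms(2)] mod_hom_closed[OF assms(3)]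
        in \<open>auto simp: mod_hom_add[OF assms(2)] mod_hom_add[OF assms(3)] mod_hom_smult[OF assms(2)]
          mod_hom_smult[OF assms(3)] N.smult_r_distr N.a_ac\<close>)
qed

lemma mod_hom_scale:
  assumes "module R N" "h \<in> mod_hom R M N" "r \<in> carrier R"
  shows "(\<lambda>x. r \<odot>\<^bsub>N\<^esub> h x) \<in> mod_hom R M N"
proof -
  interpret N: module R N by fact
  show ?thesis
  proof (rule mod_homI)
    fix s x assume sx: "s \<in> carrier R" "x \<in> carrier M"
    note c = mod_hom_closed[OF assms(2) sx(2)]
    have "r \<odot>\<^bsub>N\<^esub> (s \<odot>\<^bsub>N\<^esub> h x) = (r \<otimes>\<^bsub>R\<^esub> s) \<odot>\<^bsub>N\<^esub> h x" using assms(3) sx c by (simp add: N.smult_assoc1)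
    also have "\<dots> = s \<odot>\<^bsub>N\<^esub> (r \<odot>\<^bsub>N\<^esub> h x)" using assms(3) sx c
      by (simp add: N.smult_assoc1[symmetric] N.R.m_comm)
    finally show "r \<odot>\<^bsub>N\<^esub> h (s \<odot>\<^bsub>M\<^esub> x) = s \<odot>\<^bsub>N\<^esub> (r \<odot>\<^bsub>N\<^esub> h x)" using sx by (simp add: mod_hom_smult[OF assms(2)])
  qed (use assms(3) mod_hom_closed[OF assms(2)] in \<open>auto simp: mod_hom_add[OF assms(2)] N.smult_r_distr\<close>)
qed

lemma mod_hom_neg:
  assumes "module R N" "h \<in> mod_hom R M N"
  shows "(\<lambda>x. \<ominus>\<^bsub>N\<^esub> h x) \<in> mod_hom R M N"
proof -
  interpret N: module R N by fact
  show ?thesis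
    by (rule mod_homI)
       (use mod_hom_closed[OF assms(2)]
        in \<open>auto simp: mod_hom_add[OF assms(2)] mod_hom_smult[OF assms(2)] N.smult_r_minus N.minus_add\<close>)
qed

lemma mod_hom_id: "(\<lambda>x. x) \<in> mod_hom R M M"
  by (auto simp: mod_hom_def)

lemma mod_hom_finsum:
  assumes "module R M" "module R N" "h \<in> mod_hom R M N" "finite T" "w \<in> T \<rightarrow> carrier M"
  shows "h (\<Oplus>\<^bsub>M\<^esub>t\<in>T. w t) = (\<Oplus>\<^bsub>N\<^esub>t\<in>T. h (w t))"
proof -
  interpret M: module R M by fact
  interpret N: module R N by fact
  show ?thesis using assms(4,5)
  proof (induction T rule: finite_induct)
    case empty
    show ?case using mod_hom_zero[OF assms(1-3)] by simp
  next
    case (insert t T)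
    then have "h (\<Oplus>\<^bsub>M\<^esub>t\<in>insert t T. w t) = h (w t) \<oplus>\<^bsub>N\<^esub> h (\<Oplus>\<^bsub>M\<^esub>t\<in>T. w t)"
      using mod_hom_add[OF assms(3)] by (subst M.finsum_insert) auto
    also have "\<dots> = (\<Oplus>\<^bsub>N\<^esub>t\<in>insert t T. h (w t))"
      using insert mod_hom_closed[OF assms(3)] by (subst N.finsum_insert) (auto simp: Pi_iff)
    finally show ?case .
  qed
qed

lemma mod_hom_lin_comb:
  assumes "module R M" "module R N" "h \<in> mod_hom R M N" "a \<in> fin_coeffs R B" "v \<in> B \<rightarrow> carrier M"
  shows "h (lin_comb R M v a) = lin_comb R N (\<lambda>b. h (v b)) a"
proof -
  interpret M: module R M by fact
  interpret N: module R N by fact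
  let ?T = "{b. a b \<noteq> \<zero>\<^bsub>R\<^esub>}"
  have T: "finite ?T" "?T \<subseteq> B" using assms(4) by (auto simp: fin_coeffs_def)
  note cl = fin_coeffs_closed[OF M.R.is_cring assms(4)]
  have v: "v b \<in> carrier M" if "b \<in> ?T" for b using that T assms(5) by blast
  have "h (lin_comb R M v a) = (\<Oplus>\<^bsub>N\<^esub>b\<in>?T. h (a b \<odot>\<^bsub>M\<^esub> v b))"
    unfolding lin_comb_def
    by (rule mod_hom_finsum[OF assms(1-3) T(1)]) (use cl v in auto)
  also have "\<dots> = (\<Oplus>\<^bsub>N\<^esub>b\<in>?T. a b \<odot>\<^bsub>N\<^esub> h (v b))"
    by (rule N.finsum_cong') (use cl v mod_hom_closed[OF assms(3)] mod_hom_smult[OF assms(3)] in auto)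
  finally show ?thesis unfolding lin_comb_def .
qed

text \<open>Applied to the linear combination map of a basis, this makes taking coordinates a linear
  map, both for lifting out of free modules and for a localization that is free.\<close>

lemma mod_hom_inv_into:
  assumes "module R M" "h \<in> mod_hom R M N" "bij_betw h (carrier M) (carrier N)"
  shows "inv_into (carrier M) h \<in> mod_hom R N M"
proof -
  interpret M: module R M by fact
  let ?k = "inv_into (carrier M) h"
  have kc: "?k y \<in> carrier M" and hk: "h (?k y) = y" if "y \<in> carrier N" for y
    using that assms(3) by (auto simp: bij_betw_def inv_into_into f_inv_into_f)
  have inj: "x = x'" if "h x = h x'" "x \<in> carrier M" "x' \<in> carrier M" for x x'
    using that assms(3) by (auto simp: bij_betw_def inj_on_def)
  have kh: "?k (h x) = x" if "x \<in> carrier M" for x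
    using that assms(3) by (auto simp: bij_betw_def)
  show ?thesis
  proof (rule mod_homI)
    fix x y assume x: "x \<in> carrier N" "y \<in> carrier N"
    have "x \<oplus>\<^bsub>N\<^esub> y = h (?k x \<oplus>\<^bsub>M\<^esub> ?k y)" using x kc hk mod_hom_add[OF assms(2)] by simp
    then show "?k (x \<oplus>\<^bsub>N\<^esub> y) = ?k x \<oplus>\<^bsub>M\<^esub> ?k y" using kh kc x by simp
  next
    fix r x assume x: "r \<in> carrier R" "x \<in> carrier N"
    have "r \<odot>\<^bsub>N\<^esub> x = h (r \<odot>\<^bsub>M\<^esub> ?k x)" using x kc hk mod_hom_smult[OF assms(2)] by simp
    then show "?k (r \<odot>\<^bsub>N\<^esub> x) = r \<odot>\<^bsub>M\<^esub> ?k x" using kh kc x by simp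
  qed (rule kc)
qed

lemma mod_hom_sum:
  assumes "module R N" "finite T" "\<And>t. t \<in> T \<Longrightarrow> h t \<in> mod_hom R M N"
  shows "(\<lambda>x. \<Oplus>\<^bsub>N\<^esub>t\<in>T. h t x) \<in> mod_hom R M N"
proof -
  interpret N: module R N by fact
  have c: "(\<lambda>t. h t x) \<in> T \<rightarrow> carrier N" if "x \<in> carrier M" for x
    using mod_hom_closed[OF assms(3)] that by blast
  show ?thesis
  proof (rule mod_homI)
    fix x y assume xy: "x \<in> carrier M" "y \<in> carrier M"
    have "(\<Oplus>\<^bsub>N\<^esub>t\<in>T. h t (x \<oplus>\<^bsub>M\<^esub> y)) = (\<Oplus>\<^bsub>N\<^esub>t\<in>T. h t x \<oplus>\<^bsub>N\<^esub> h t y)"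
      by (rule N.finsum_cong') (use xy c mod_hom_add[OF assms(3)] in auto)
    also have "\<dots> = (\<Oplus>\<^bsub>N\<^esub>t\<in>T. h t x) \<oplus>\<^bsub>N\<^esub> (\<Oplus>\<^bsub>N\<^esub>t\<in>T. h t y)"
      by (rule N.finsum_addf) (use xy c in auto)
    finally show "(\<Oplus>\<^bsub>N\<^esub>t\<in>T. h t (x \<oplus>\<^bsub>M\<^esub> y)) = (\<Oplus>\<^bsub>N\<^esub>t\<in>T. h t x) \<oplus>\<^bsub>N\<^esub> (\<Oplus>\<^bsub>N\<^esub>t\<in>T. h t y)" .
  next
    fix r x assume rx: "r \<in> carrier R" "x \<in> carrier M"
    have "(\<Oplus>\<^bsub>N\<^esub>t\<in>T. h t (r \<odot>\<^bsub>M\<^esub> x)) = (\<Oplus>\<^bsub>N\<^esub>t\<in>T. r \<odot>\<^bsub>N\<^esub> h t x)"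
      by (rule N.finsum_cong') (use rx c mod_hom_smult[OF assms(3)] in auto)
    also have "\<dots> = r \<odot>\<^bsub>N\<^esub> (\<Oplus>\<^bsub>N\<^esub>t\<in>T. h t x)"
      by (rule N.finsum_smult_ldistr[symmetric]) (use rx c assms(2) in auto)
    finally show "(\<Oplus>\<^bsub>N\<^esub>t\<in>T. h t (r \<odot>\<^bsub>M\<^esub> x)) = r \<odot>\<^bsub>N\<^esub> (\<Oplus>\<^bsub>N\<^esub>t\<in>T. h t x)" .
  qed (rule N.finsum_closed[OF c])
qed

lemma a_kernel_eq: "a_kernel M N h = {x \<in> carrier M. h x = \<zero>\<^bsub>N\<^esub>}"
  by (simp add: a_kernel_def kernel_def)

lemma ring_as_module_module: 
  assumes "cring R" shows "module R (ring_as_module R)"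
proof -
  interpret cring R by fact
  show ?thesis
  proof (rule moduleI)
    show "abelian_group (ring_as_module R)"
      by (rule abelian_groupI)
         (auto simp: ring_as_module_def a_ac intro: bexI[of _ "\<ominus>\<^bsub>R\<^esub> _"] l_neg)
  qed (auto simp: ring_as_module_def assms l_distr r_distr m_assoc)
qed

lemma ring_as_module_simps [simp]:
  "carrier (ring_as_module R) = carrier R" "\<zero>\<^bsub>ring_as_module R\<^esub> = \<zero>\<^bsub>R\<^esub>"
  "a \<oplus>\<^bsub>ring_as_module R\<^esub> b = a \<oplus>\<^bsub>R\<^esub> b" "a \<odot>\<^bsub>ring_as_module R\<^esub> b = a \<otimes>\<^bsub>R\<^esub> b"
  by (simp_all add: ring_as_module_def)

section \<open>Modules of homomorphisms\<close>

lemma hom_module_module: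
  assumes "module R M" "module R N" shows "module R (hom_module R M N)"
proof -
  interpret M: module R M by fact
  interpret N: module R N by fact
  have cl: "h x \<in> carrier N" if "h \<in> mod_hom R M N" "x \<in> carrier M" for h x
    using that by (rule mod_hom_closed)
  \<comment> \<open>Elements of \<open>hom_module R M N\<close> are extensional, so a pointwise
    operation stays in the carrier only after its restriction to \<open>carrier M\<close>.\<close>
  have restr: "(\<lambda>x\<in>carrier M. h x) \<in> mod_hom R M N" if "h \<in> mod_hom R M N" for h
    using that by (auto simp: mod_hom_def)
  show ?thesis
  proof (rule moduleI)
    show "abelian_group (hom_module R M N)"
    proof (rule abelian_groupI)
      fix h assume h: "h \<in> carrier (hom_module R M N)"
      then have h': "h \<in> mod_hom R M N" by (simp add: hom_module_def)
      let ?k = "\<lambda>x\<in>carrier M. \<ominus>\<^bsub>N\<^esub> h x"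
      have "?k \<in> carrier (hom_module R M N)"
        using restr[OF mod_hom_neg[OF assms(2) h']] by (simp add: hom_module_def)
      moreover have "?k \<oplus>\<^bsub>hom_module R M N\<^esub> h = \<zero>\<^bsub>hom_module R M N\<^esub>"
        using cl[OF h'] by (auto simp: hom_module_def N.l_neg)
      ultimately show "\<exists>k\<in>carrier (hom_module R M N). k \<oplus>\<^bsub>hom_module R M N\<^esub> h = \<zero>\<^bsub>hom_module R M N\<^esub>"
        by blast
    next
      fix h k assume "h \<in> carrier (hom_module R M N)" "k \<in> carrier (hom_module R M N)"
      then show "h \<oplus>\<^bsub>hom_module R M N\<^esub> k \<in> carrier (hom_module R M N)"
        using restr[OF mod_hom_plus[OF assms(2)]] by (simp add: hom_module_def)
    next
      show "\<zero>\<^bsub>hom_module R M N\<^esub> \<in> carrier (hom_module R M N)"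
        using restr[OF mod_hom_const_zero[OF assms(2)]] by (simp add: hom_module_def)
    qed (auto simp: hom_module_def cl N.a_ac extensional_def fun_eq_iff)
  next
    fix r h assume "r \<in> carrier R" "h \<in> carrier (hom_module R M N)"
    then show "r \<odot>\<^bsub>hom_module R M N\<^esub> h \<in> carrier (hom_module R M N)"
      using restr[OF mod_hom_scale[OF assms(2)]] by (simp add: hom_module_def)
  qed (auto simp: hom_module_def cl M.R.is_cring N.smult_l_distr N.smult_r_distr N.smult_assoc1
      extensional_def fun_eq_iff)
qed

section \<open>Associated primes of Ext in terms of cochains\<close>

text \<open>Unlike \<open>cocycles\<close> and \<open>coboundaries\<close>, these sets do not require \<open>extensional\<close> functions: membership only
  depends on the values on \<open>carrier (F i)\<close>, so cochains can be written as plain lambda terms.\<close>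

definition cocyc :: "('r, 'x) ring_scheme \<Rightarrow> (nat \<Rightarrow> ('r, 'p) module) \<Rightarrow> (nat \<Rightarrow> 'p \<Rightarrow> 'p) \<Rightarrow>
    ('r, 'n, 'z) module_scheme \<Rightarrow> nat \<Rightarrow> ('p \<Rightarrow> 'n) set"
  where "cocyc R F d N i = {z \<in> mod_hom R (F i) N. \<forall>x\<in>carrier (F (Suc i)). z (d i x) = \<zero>\<^bsub>N\<^esub>}"

definition cobd :: "('r, 'x) ring_scheme \<Rightarrow> (nat \<Rightarrow> ('r, 'p) module) \<Rightarrow> (nat \<Rightarrow> 'p \<Rightarrow> 'p) \<Rightarrow>
    ('r, 'n, 'z) module_scheme \<Rightarrow> nat \<Rightarrow> ('p \<Rightarrow> 'n) set"
  where "cobd R F d N i = (case i of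
       0 \<Rightarrow> {z. \<forall>x\<in>carrier (F 0). z x = \<zero>\<^bsub>N\<^esub>}
     | Suc j \<Rightarrow> {z. \<exists>u\<in>mod_hom R (F j) N. \<forall>x\<in>carrier (F (Suc j)). z x = u (d j x)})"

lemma cobd_cong:
  assumes "\<And>x. x \<in> carrier (F i) \<Longrightarrow> z x = z' x"
  shows "z \<in> cobd R F d N i \<longleftrightarrow> z' \<in> cobd R F d N i"
  using assms by (cases i) (auto simp: cobd_def)

lemma cobd_zero:
  assumes "module R N" shows "(\<lambda>x. \<zero>\<^bsub>N\<^esub>) \<in> cobd R F d N i"
  using mod_hom_const_zero[OF assms] by (fastforce simp: cobd_def split: nat.split)

lemma cobd_add:
  assumes "module R N" "z \<in> cobd R F d N i" "z' \<in> cobd R F d N i"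
  shows "(\<lambda>x. z x \<oplus>\<^bsub>N\<^esub> z' x) \<in> cobd R F d N i"
proof -
  interpret N: module R N by fact
  show ?thesis
  proof (cases i)
    case 0
    then show ?thesis using assms by (auto simp: cobd_def)
  next
    case (Suc j)
    then obtain u u' where u: "u \<in> mod_hom R (F j) N" "u' \<in> mod_hom R (F j) N"
      "\<forall>x\<in>carrier (F (Suc j)). z x = u (d j x)" "\<forall>x\<in>carrier (F (Suc j)). z' x = u' (d j x)"
      using assms by (auto simp: cobd_def)
    show ?thesis unfolding Suc cobd_def
      using u(3,4) mod_hom_plus[OF assms(1) u(1,2)] by (auto intro!: bexI)
  qed
qed

lemma cobd_scale:
  assumes "module R N" "z \<in> cobd R F d N i" "r \<in> carrier R"
  shows "(\<lambda>x. r \<odot>\<^bsub>N\<^esub> z x) \<in> cobd R F d N i"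
proof -
  interpret N: module R N by fact
  show ?thesis
  proof (cases i)
    case 0
    then show ?thesis using assms by (auto simp: cobd_def)
  next
    case (Suc j)
    then obtain u where u: "u \<in> mod_hom R (F j) N" "\<forall>x\<in>carrier (F (Suc j)). z x = u (d j x)"
      using assms by (auto simp: cobd_def)
    show ?thesis unfolding Suc cobd_def
      using u(2) mod_hom_scale[OF assms(1) u(1) assms(3)] by (auto intro!: bexI)
  qed
qed

lemma cobd_neg:
  assumes "module R N" "z \<in> cobd R F d N i"
  shows "(\<lambda>x. \<ominus>\<^bsub>N\<^esub> z x) \<in> cobd R F d N i"
proof -
  interpret N: module R N by fact
  show ?thesis
  proof (cases i)
    case 0
    then show ?thesis using assms by (auto simp: cobd_def)
  next
    case (Suc j)
    then obtain u where u: "u \<in> mod_hom R (F j) N" "\<forall>x\<in>carrier (F (Suc j)). z x = u (d j x)"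
      using assms by (auto simp: cobd_def)
    show ?thesis unfolding Suc cobd_def
      using u(2) mod_hom_neg[OF assms(1) u(1)] by (auto intro!: bexI)
  qed
qed

lemma cocyc_scale:
  assumes "module R N" "z \<in> cocyc R F d N i" "r \<in> carrier R"
  shows "(\<lambda>x. r \<odot>\<^bsub>N\<^esub> z x) \<in> cocyc R F d N i"
proof -
  interpret N: module R N by fact
  show ?thesis using assms mod_hom_scale[OF assms(1)] by (auto simp: cocyc_def)
qed

text \<open>The class of a cocycle \<open>z\<close> is its coset modulo the coboundaries, and
  \<open>r\<close> annihilates this coset exactly when \<open>r z\<close> is itself a coboundary.
  The remaining work translates between the extensional cochains in the definition of Ext and the
  plain functions in \<open>cocyc\<close> and \<open>cobd\<close>.\<close>

lemma Ass_ext_of_resolution: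
  assumes F: "\<And>n. module R (F n)" and d: "\<And>n. d n \<in> mod_hom R (F (Suc n)) (F n)" and N: "module R N"
  shows "Ass R (ext_of_resolution R F d N i) = {P. primeideal P R \<and>
    (\<exists>z\<in>cocyc R F d N i. P = {r \<in> carrier R. (\<lambda>x. r \<odot>\<^bsub>N\<^esub> z x) \<in> cobd R F d N i})}"
proof -
  interpret N: module R N by fact
  interpret F: module R "F n" for n by (rule F)
  let ?H = "hom_module R (F i) N"
  interpret H: module R ?H by (rule hom_module_module[OF F N])
  let ?B = "coboundaries R F d N i"
  have B: "z \<in> ?B \<longleftrightarrow> z \<in> carrier ?H \<and> z \<in> cobd R F d N i" for z
  proof (cases i)
    case 0
    have "z \<in> ?B \<longleftrightarrow> z = (\<lambda>x\<in>carrier (F 0). \<zero>\<^bsub>N\<^esub>)" by (simp add: coboundaries_def 0 hom_module_def)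
    moreover have "(\<lambda>x\<in>carrier (F 0). \<zero>\<^bsub>N\<^esub>) \<in> carrier (hom_module R (F 0) N)"
      using H.zero_closed unfolding 0 by (simp add: hom_module_def)
    ultimately show ?thesis
      unfolding 0 cobd_def by (auto simp: hom_module_def intro: extensionalityI[of _ "carrier (F 0)"])
  next
    case (Suc j)
    let ?c = "\<lambda>u. compose (carrier (F (Suc j))) u (d j)"
    have cB: "?B = ?c ` carrier (hom_module R (F j) N)" by (simp add: coboundaries_def Suc)
    have c: "?c u \<in> carrier ?H" if "u \<in> mod_hom R (F j) N" for u
      using mod_hom_comp[OF d that] unfolding Suc by (auto simp: hom_module_def compose_def mod_hom_def)
    show ?thesis
    proof
      assume "z \<in> ?B"
      then obtain u where u: "u \<in> mod_hom R (F j) N" "z = ?c u"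
        unfolding cB by (auto simp: hom_module_def)
      moreover have "z \<in> cobd R F d N i"
        unfolding Suc cobd_def using u by (auto simp: compose_def intro!: bexI[of _ u])
      ultimately show "z \<in> carrier ?H \<and> z \<in> cobd R F d N i" using c by blast
    next
      assume z: "z \<in> carrier ?H \<and> z \<in> cobd R F d N i"
      then obtain u where u: "u \<in> mod_hom R (F j) N" "\<forall>x\<in>carrier (F (Suc j)). z x = u (d j x)"
        by (auto simp: cobd_def Suc)
      \<comment> \<open>Only the values of \<open>u\<close> on \<open>carrier (F j)\<close> matter.
        Restricting it gives an element of the Hom module and leaves the composite with
        \<open>d j\<close> unchanged, since \<open>d j\<close> takes its values in that
        carrier.\<close>
      have "z = ?c (restrict u (carrier (F j)))"
      proof (rule extensionalityI)
        show "z \<in> extensional (carrier (F (Suc j)))" using z by (simp add: hom_module_def Suc)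
      qed (use u mod_hom_closed[OF d] in \<open>auto simp: compose_def\<close>)
      moreover have "restrict u (carrier (F j)) \<in> carrier (hom_module R (F j) N)"
        using u(1) by (auto simp: hom_module_def mod_hom_def)
      ultimately show "z \<in> ?B" unfolding cB by blast
    qed
  qed
  have Bsub: "submodule ?B R ?H"
  proof (rule H.submoduleI)
    have *: "\<ominus>\<^bsub>?H\<^esub> z = (\<lambda>x\<in>carrier (F i). \<ominus>\<^bsub>N\<^esub> z x)" if z: "z \<in> carrier ?H" for z
    proof (rule H.minus_equality)
      have z': "z \<in> mod_hom R (F i) N" using z by (simp add: hom_module_def)
      show "(\<lambda>x\<in>carrier (F i). \<ominus>\<^bsub>N\<^esub> z x) \<in> carrier ?H"
        using mod_hom_neg[OF N z'] by (auto simp: hom_module_def mod_hom_def)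
      show "(\<lambda>x\<in>carrier (F i). \<ominus>\<^bsub>N\<^esub> z x) \<oplus>\<^bsub>?H\<^esub> z = \<zero>\<^bsub>?H\<^esub>"
        using mod_hom_closed[OF z'] by (auto simp: hom_module_def N.l_neg)
    qed (rule z)
    fix z assume z: "z \<in> ?B"
    have "\<ominus>\<^bsub>?H\<^esub> z \<in> carrier ?H" using z B by simp
    moreover have "\<ominus>\<^bsub>?H\<^esub> z \<in> cobd R F d N i"
      using z B by (subst cobd_cong[where z' = "\<lambda>x. \<ominus>\<^bsub>N\<^esub> z x"]) (auto simp: * intro: cobd_neg[OF N])
    ultimately show "\<ominus>\<^bsub>?H\<^esub> z \<in> ?B" by (simp add: B)
  next
    have "\<zero>\<^bsub>?H\<^esub> \<in> cobd R F d N i"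
      by (subst cobd_cong[where z' = "\<lambda>x. \<zero>\<^bsub>N\<^esub>"]) (auto simp: hom_module_def intro: cobd_zero[OF N])
    then show "\<zero>\<^bsub>?H\<^esub> \<in> ?B" by (simp add: B)
  next
    fix z z' assume z: "z \<in> ?B" "z' \<in> ?B"
    have "z \<oplus>\<^bsub>?H\<^esub> z' \<in> cobd R F d N i"
      using z B by (subst cobd_cong[where z' = "\<lambda>x. z x \<oplus>\<^bsub>N\<^esub> z' x"]) (auto simp: hom_module_def intro: cobd_add[OF N])
    then show "z \<oplus>\<^bsub>?H\<^esub> z' \<in> ?B" using z by (simp add: B)
  next
    fix r z assume z: "r \<in> carrier R" "z \<in> ?B"
    have "r \<odot>\<^bsub>?H\<^esub> z \<in> cobd R F d N i"
      using z B by (subst cobd_cong[where z' = "\<lambda>x. r \<odot>\<^bsub>N\<^esub> z x"]) (auto simp: hom_module_def intro: cobd_scale[OF N])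
    then show "r \<odot>\<^bsub>?H\<^esub> z \<in> ?B" using z by (simp add: B)
  qed (use B in auto)
  note BE = H.submoduleE[OF Bsub]
  have Bgr: "subgroup ?B (add_monoid ?H)" using Bsub by (simp add: submodule_def)
  \<comment> \<open>In \<open>ext_of_resolution\<close> the Hom module has its carrier cut down to
    the cocycles. Cosets depend on the addition alone, so those formed in the full Hom module can be
    used instead.\<close>
  have rc: "a_r_coset (?H\<lparr>carrier := K\<rparr>) = a_r_coset ?H" for K
    by (simp add: a_r_coset_def r_coset_def fun_eq_iff)
  define co where "co = cocycles R F d N i"
  have co: "z \<in> co \<longleftrightarrow> z \<in> carrier ?H \<and> z \<in> cocyc R F d N i" for z
    unfolding co_def cocycles_def a_kernel_eq cocyc_def
    by (auto simp: hom_module_def compose_def fun_eq_iff)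
  \<comment> \<open>Scalar multiplication on \<open>quot_module\<close> is a union over all
    representatives. Another representative differs from \<open>z\<close> by a coboundary
    \<open>b\<close>, and \<open>r b\<close> is again a coboundary, so all members of the union
    coincide.\<close>
  have sm: "(\<Union>y\<in>?B +>\<^bsub>?H\<^esub> z. ?B +>\<^bsub>?H\<^esub> (r \<odot>\<^bsub>?H\<^esub> y)) = ?B +>\<^bsub>?H\<^esub> (r \<odot>\<^bsub>?H\<^esub> z)"
    if r: "r \<in> carrier R" and z: "z \<in> carrier ?H" for r z
  proof -
    have "?B +>\<^bsub>?H\<^esub> (r \<odot>\<^bsub>?H\<^esub> y) = ?B +>\<^bsub>?H\<^esub> (r \<odot>\<^bsub>?H\<^esub> z)" if y: "y \<in> ?B +>\<^bsub>?H\<^esub> z" for y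
    proof -
      obtain b where b: "b \<in> ?B" "y = b \<oplus>\<^bsub>?H\<^esub> z" using y unfolding a_r_coset_def' by blast
      have bc: "b \<in> carrier ?H" using b BE(1) by blast
      have "?B +>\<^bsub>?H\<^esub> (r \<odot>\<^bsub>?H\<^esub> y) = ?B +>\<^bsub>?H\<^esub> (r \<odot>\<^bsub>?H\<^esub> b) +>\<^bsub>?H\<^esub> (r \<odot>\<^bsub>?H\<^esub> z)"
        using H.a_coset_add_assoc[OF BE(1)] r z bc by (simp add: b(2) H.smult_r_distr)
      also have "?B +>\<^bsub>?H\<^esub> (r \<odot>\<^bsub>?H\<^esub> b) = ?B"
        using H.a_coset_join2[OF _ Bgr] r bc BE(4)[OF r b(1)] by simp
      finally show ?thesis .
    qed
    moreover have "z \<in> ?B +>\<^bsub>?H\<^esub> z" using H.a_rcosI[OF _ BE(1) z, of "\<zero>\<^bsub>?H\<^esub>"] subgroup.one_closed[OF Bgr] z by simp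
    ultimately show ?thesis by blast
  qed
  have ann: "{r \<in> carrier R. r \<odot>\<^bsub>quot_module (?H\<lparr>carrier := co\<rparr>) ?B\<^esub> (?B +>\<^bsub>?H\<^esub> z) = ?B}
      = {r \<in> carrier R. (\<lambda>x. r \<odot>\<^bsub>N\<^esub> z x) \<in> cobd R F d N i}" if z: "z \<in> carrier ?H" for z
  proof -
    have "r \<odot>\<^bsub>quot_module (?H\<lparr>carrier := co\<rparr>) ?B\<^esub> (?B +>\<^bsub>?H\<^esub> z) = ?B \<longleftrightarrow> (\<lambda>x. r \<odot>\<^bsub>N\<^esub> z x) \<in> cobd R F d N i"
      if r: "r \<in> carrier R" for r
    proof -
      have "r \<odot>\<^bsub>quot_module (?H\<lparr>carrier := co\<rparr>) ?B\<^esub> (?B +>\<^bsub>?H\<^esub> z) = ?B +>\<^bsub>?H\<^esub> (r \<odot>\<^bsub>?H\<^esub> z)"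
        using sm[OF r z] by (simp add: quot_module_def rc)
      also have "\<dots> = ?B \<longleftrightarrow> r \<odot>\<^bsub>?H\<^esub> z \<in> ?B"
        using H.a_coset_join1[OF _ _ Bgr] H.a_coset_join2[OF _ Bgr] r z by blast
      also have "\<dots> \<longleftrightarrow> r \<odot>\<^bsub>?H\<^esub> z \<in> cobd R F d N i" using r z by (simp add: B)
      also have "\<dots> \<longleftrightarrow> (\<lambda>x. r \<odot>\<^bsub>N\<^esub> z x) \<in> cobd R F d N i"
        by (rule cobd_cong) (simp add: hom_module_def)
      finally show ?thesis .
    qed
    then show ?thesis by blast
  qed
  have car: "carrier (quot_module (?H\<lparr>carrier := co\<rparr>) ?B) = (\<lambda>z. ?B +>\<^bsub>?H\<^esub> z) ` co"
    by (auto simp: quot_module_def A_RCOSETS_def RCOSETS_def a_r_coset_def r_coset_def)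
  have zero: "\<zero>\<^bsub>quot_module (?H\<lparr>carrier := co\<rparr>) ?B\<^esub> = ?B" by (simp add: quot_module_def)
  have ex: "(\<exists>z\<in>co. P = {r \<in> carrier R. (\<lambda>x. r \<odot>\<^bsub>N\<^esub> z x) \<in> cobd R F d N i}) \<longleftrightarrow>
    (\<exists>z\<in>cocyc R F d N i. P = {r \<in> carrier R. (\<lambda>x. r \<odot>\<^bsub>N\<^esub> z x) \<in> cobd R F d N i})" for P
  proof
    assume "\<exists>z\<in>cocyc R F d N i. P = {r \<in> carrier R. (\<lambda>x. r \<odot>\<^bsub>N\<^esub> z x) \<in> cobd R F d N i}"
    then obtain z where z: "z \<in> cocyc R F d N i" "P = {r \<in> carrier R. (\<lambda>x. r \<odot>\<^bsub>N\<^esub> z x) \<in> cobd R F d N i}" by blast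
    let ?z = "restrict z (carrier (F i))"
    have "?z \<in> co" using z(1) mod_hom_closed[OF d] unfolding co
      by (auto simp: cocyc_def hom_module_def mod_hom_def)
    moreover have "(\<lambda>x. r \<odot>\<^bsub>N\<^esub> z x) \<in> cobd R F d N i \<longleftrightarrow> (\<lambda>x. r \<odot>\<^bsub>N\<^esub> ?z x) \<in> cobd R F d N i" for r
      by (rule cobd_cong) simp
    ultimately show "\<exists>z\<in>co. P = {r \<in> carrier R. (\<lambda>x. r \<odot>\<^bsub>N\<^esub> z x) \<in> cobd R F d N i}"
      using z(2) by (intro bexI[of _ ?z]) auto
  qed (auto simp: co)
  have Q: "ext_of_resolution R F d N i = quot_module (?H\<lparr>carrier := co\<rparr>) ?B"
    by (simp add: ext_of_resolution_def co_def)
  have "(\<exists>X\<in>carrier (quot_module (?H\<lparr>carrier := co\<rparr>) ?B).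
      P = {r \<in> carrier R. r \<odot>\<^bsub>quot_module (?H\<lparr>carrier := co\<rparr>) ?B\<^esub> X = \<zero>\<^bsub>quot_module (?H\<lparr>carrier := co\<rparr>) ?B\<^esub>}) \<longleftrightarrow>
    (\<exists>z\<in>co. P = {r \<in> carrier R. (\<lambda>x. r \<odot>\<^bsub>N\<^esub> z x) \<in> cobd R F d N i})" for P
    unfolding car zero bex_simps using ann co by (intro bex_cong) auto
  then show ?thesis unfolding Ass_def Q using ex by simp
qed

section \<open>Resolutions and chain maps\<close>

text \<open>Freeness is dropped from \<open>free_resolution\<close> because a lift needs it only in
  its source. The mapping cone below serves as a target and is shown to be exact without being shown
  to be free.\<close>

definition resolution ::
    "('r, 'x) ring_scheme \<Rightarrow> ('r, 'm, 'y) module_scheme \<Rightarrow> (nat \<Rightarrow> ('r, 'p) module) \<Rightarrow>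
     (nat \<Rightarrow> 'p \<Rightarrow> 'p) \<Rightarrow> ('p \<Rightarrow> 'm) \<Rightarrow> bool"
  where "resolution R M F d e \<longleftrightarrow> module R M \<and>
     (\<forall>n. module R (F n)) \<and>
     (\<forall>n. d n \<in> mod_hom R (F (Suc n)) (F n)) \<and> e \<in> mod_hom R (F 0) M \<and>
     e ` carrier (F 0) = carrier M \<and>
     d 0 ` carrier (F 1) = a_kernel (F 0) M e \<and>
     (\<forall>n. d (Suc n) ` carrier (F (Suc (Suc n))) = a_kernel (F (Suc n)) (F n) (d n))"

lemma free_resolution_imp_resolution:
  "module R M \<Longrightarrow> free_resolution R M F d e \<Longrightarrow> resolution R M F d e"
  by (auto simp: free_resolution_def resolution_def free_module_def)

lemma resolutionD:
  assumes "resolution R M F d e"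
  shows "module R M" "module R (F n)" "d n \<in> mod_hom R (F (Suc n)) (F n)" "e \<in> mod_hom R (F 0) M"
    "e ` carrier (F 0) = carrier M"
    "d 0 ` carrier (F (Suc 0)) = {x \<in> carrier (F 0). e x = \<zero>\<^bsub>M\<^esub>}"
    "d (Suc n) ` carrier (F (Suc (Suc n))) = {x \<in> carrier (F (Suc n)). d n x = \<zero>\<^bsub>F n\<^esub>}"
  using assms by (auto simp: resolution_def a_kernel_eq)

lemma resolution_dd:
  assumes "resolution R M F d e"
  shows "x \<in> carrier (F (Suc 0)) \<Longrightarrow> e (d 0 x) = \<zero>\<^bsub>M\<^esub>"
    and "y \<in> carrier (F (Suc (Suc n))) \<Longrightarrow> d n (d (Suc n) y) = \<zero>\<^bsub>F n\<^esub>"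
  using resolutionD(6)[OF assms] resolutionD(7)[OF assms, of n] by blast+

definition chain_map ::
    "('r, 'x) ring_scheme \<Rightarrow> (nat \<Rightarrow> ('r, 'p) module) \<Rightarrow> (nat \<Rightarrow> 'p \<Rightarrow> 'p) \<Rightarrow>
     (nat \<Rightarrow> ('r, 'q) module) \<Rightarrow> (nat \<Rightarrow> 'q \<Rightarrow> 'q) \<Rightarrow> (nat \<Rightarrow> 'p \<Rightarrow> 'q) \<Rightarrow> bool"
  where "chain_map R F d G d' \<phi> \<longleftrightarrow> (\<forall>n. \<phi> n \<in> mod_hom R (F n) (G n)) \<and>
     (\<forall>n. \<forall>x\<in>carrier (F (Suc n)). \<phi> n (d n x) = d' n (\<phi> (Suc n) x))"

lemma chain_mapD:
  assumes "chain_map R F d G d' \<phi>"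
  shows "\<phi> n \<in> mod_hom R (F n) (G n)"
    and "x \<in> carrier (F n) \<Longrightarrow> \<phi> n x \<in> carrier (G n)"
    and "y \<in> carrier (F (Suc n)) \<Longrightarrow> \<phi> n (d n y) = d' n (\<phi> (Suc n) y)"
  using assms by (auto simp: chain_map_def intro: mod_hom_closed)

lemma chain_map_comp:
  assumes "chain_map R F d G d' \<phi>" "chain_map R G d' H d'' \<psi>"
  shows "chain_map R F d H d'' (\<lambda>n x. \<psi> n (\<phi> n x))"
  using chain_mapD(2,3)[OF assms(1)] chain_mapD(3)[OF assms(2)]
    mod_hom_comp[OF chain_mapD(1)[OF assms(1)] chain_mapD(1)[OF assms(2)]]
  by (simp add: chain_map_def)

lemma chain_map_diff:
  assumes "\<And>n. module R (G n)" "\<And>n. d' n \<in> mod_hom R (G (Suc n)) (G n)"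
    and "chain_map R F d G d' \<phi>" "chain_map R F d G d' \<psi>"
  shows "chain_map R F d G d' (\<lambda>n x. \<phi> n x \<oplus>\<^bsub>G n\<^esub> \<ominus>\<^bsub>G n\<^esub> \<psi> n x)"
proof -
  interpret G: module R "G n" for n by fact
  note p = chain_mapD[OF assms(3)] and q = chain_mapD[OF assms(4)]
  show ?thesis unfolding chain_map_def
    using mod_hom_plus[OF assms(1) p(1) mod_hom_neg[OF assms(1) q(1)]]
    by (auto simp: p(3) q(3) mod_hom_add[OF assms(2)] mod_hom_minus[OF assms(1) assms(1) assms(2)]
      p(2) q(2) mod_hom_closed[OF assms(2)])
qed

lemma cocyc_pullback:
  assumes "chain_map R F d G d' \<phi>" "z \<in> cocyc R G d' N i"
  shows "(\<lambda>x. z (\<phi> i x)) \<in> cocyc R F d N i"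
  using chain_mapD[OF assms(1)] assms(2) mod_hom_comp[of "\<phi> i" R "F i" "G i" z N]
  by (auto simp: cocyc_def)

lemma cobd_pullback:
  assumes "chain_map R F d G d' \<phi>" "z \<in> cobd R G d' N i"
  shows "(\<lambda>x. z (\<phi> i x)) \<in> cobd R F d N i"
proof (cases i)
  case 0
  then show ?thesis using assms(2) chain_mapD(2)[OF assms(1)] by (auto simp: cobd_def)
next
  case (Suc j)
  then obtain u where u: "u \<in> mod_hom R (G j) N" "\<forall>x\<in>carrier (G (Suc j)). z x = u (d' j x)"
    using assms(2) by (auto simp: cobd_def)
  have "z (\<phi> (Suc j) x) = u (\<phi> j (d j x))" if "x \<in> carrier (F (Suc j))" for x
    using that u(2) chain_mapD(2,3)[OF assms(1)] by simp
  then show ?thesis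
    unfolding Suc cobd_def using mod_hom_comp[OF chain_mapD(1)[OF assms(1)] u(1)] by (auto intro!: bexI)
qed

subsection \<open>The comparison theorem\<close>

text \<open>Preimages under \<open>p\<close> are chosen on a basis of \<open>P\<close> and extended
  linearly. Only the values of \<open>q\<close> have to lie in the image of \<open>p\<close>, so the
  lemma applies when \<open>p\<close> is a differential onto the cycles and not a
  surjection.\<close>

lemma free_module_lift:
  assumes P: "free_module R P" and A: "module R A" and B: "module R B"
    and p: "p \<in> mod_hom R A B" and q: "q \<in> mod_hom R P B"
    and qp: "\<And>x. x \<in> carrier P \<Longrightarrow> q x \<in> p ` carrier A"
  shows "\<exists>h\<in>mod_hom R P A. \<forall>x\<in>carrier P. p (h x) = q x"
proof -
  have mP: "module R P" using P by (simp add: free_module_def)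
  interpret P: module R P by fact
  interpret B: module R B by fact
  obtain X where X: "X \<subseteq> carrier P" "bij_betw (lin_comb R P (\<lambda>b. b)) (fin_coeffs R X) (carrier P)"
    using P by (auto simp: free_module_def module_basis_def)
  let ?L = "lin_comb R P (\<lambda>b. b)" and ?F = "fin_module R X"
  have mF: "module R ?F" by (rule fin_module_module[OF P.R.is_cring])
  have cF: "carrier ?F = fin_coeffs R X" by (simp add: fin_module_def)
  have id: "(\<lambda>b. b) \<in> X \<rightarrow> carrier P" using X(1) by auto
  have L: "?L \<in> mod_hom R ?F P" by (rule lin_comb_hom[OF mP id])
  let ?k = "inv_into (carrier ?F) ?L"
  have k: "?k \<in> mod_hom R P ?F"
    by (rule mod_hom_inv_into[OF mF L]) (use X(2) cF in simp)
  have "\<exists>a. a \<in> carrier A \<and> p a = q b" if "b \<in> X" for b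
    using qp[OF subsetD[OF X(1) that]] by force
  then obtain v where v: "\<And>b. b \<in> X \<Longrightarrow> v b \<in> carrier A" "\<And>b. b \<in> X \<Longrightarrow> p (v b) = q b" by metis
  have vA: "v \<in> X \<rightarrow> carrier A" using v by blast
  show ?thesis
  proof (intro bexI ballI)
    show "(\<lambda>x. lin_comb R A v (?k x)) \<in> mod_hom R P A"
      by (rule mod_hom_comp[OF k lin_comb_hom[OF A vA]])
    fix x assume x: "x \<in> carrier P"
    have kx: "?k x \<in> fin_coeffs R X" using mod_hom_closed[OF k x] cF by simp
    have "p (lin_comb R A v (?k x)) = lin_comb R B (\<lambda>b. p (v b)) (?k x)"
      by (rule mod_hom_lin_comb[OF A B p kx vA])
    also have "\<dots> = lin_comb R B (\<lambda>b. q b) (?k x)"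
      unfolding lin_comb_def[of R B]
    proof (rule B.finsum_cong'[OF refl])
      have supp: "c \<in> X" if "c \<in> {b. ?k x b \<noteq> \<zero>\<^bsub>R\<^esub>}" for c
        using kx that unfolding fin_coeffs_def by blast
      show "(\<lambda>b. ?k x b \<odot>\<^bsub>B\<^esub> q b) \<in> {b. ?k x b \<noteq> \<zero>\<^bsub>R\<^esub>} \<rightarrow> carrier B"
        by (intro Pi_I B.smult_closed fin_coeffs_closed[OF P.R.is_cring kx] mod_hom_closed[OF q]
          subsetD[OF X(1)] supp)
      show "?k x c \<odot>\<^bsub>B\<^esub> p (v c) = ?k x c \<odot>\<^bsub>B\<^esub> q c" if "c \<in> {b. ?k x b \<noteq> \<zero>\<^bsub>R\<^esub>}" for c
        using supp[OF that] by (simp add: v)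
    qed
    also have "\<dots> = q (?L (?k x))" by (rule mod_hom_lin_comb[OF mP B q kx id, symmetric])
    also have "?L (?k x) = x" using X(2) x cF by (simp add: bij_betw_def f_inv_into_f)
    finally show "p (lin_comb R A v (?k x)) = q x" .
  qed
qed

lemma free_resolution_free: "free_resolution R M F d e \<Longrightarrow> free_module R (F n)"
  by (simp add: free_resolution_def)

text \<open>The lift is built degree by degree. Exactness of \<open>G\<close> turns the cycle
  condition on \<open>\<phi> n (d n x)\<close> into membership in the image of \<open>d' n\<close>,
  and freeness of \<open>F (Suc n)\<close> gives the next map.\<close>

lemma chain_lift:
  assumes M: "module R M" and F: "free_resolution R M F d e" and G: "resolution R N G d' e'" and h: "h \<in> mod_hom R M N"
  shows "\<exists>\<phi>. chain_map R F d G d' \<phi> \<and> (\<forall>x\<in>carrier (F 0). e' (\<phi> 0 x) = h (e x))"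
proof -
  note f = resolutionD[OF free_resolution_imp_resolution[OF M F]] and g = resolutionD[OF G]
  note fdd = resolution_dd[OF free_resolution_imp_resolution[OF M F]]
  note ff = free_resolution_free[OF F]
  \<comment> \<open>The second conjunct says that the next lifting problem is solvable. It is
    carried along because it is proved from the preceding commuting square, which the current map
    alone does not record.\<close>
  define P where "P = (\<lambda>n \<phi>. \<phi> \<in> mod_hom R (F n) (G n) \<and>
    (\<forall>x\<in>carrier (F (Suc n)). \<phi> (d n x) \<in> d' n ` carrier (G (Suc n))) \<and>
    (n = 0 \<longrightarrow> (\<forall>x\<in>carrier (F 0). e' (\<phi> x) = h (e x))))"
  define Q where "Q = (\<lambda>n \<phi> \<psi>. \<forall>x\<in>carrier (F (Suc n)). \<phi> (d n x) = d' n (\<psi> x))"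
  have "\<exists>\<phi>. \<forall>n. P n (\<phi> n) \<and> Q n (\<phi> n) (\<phi> (Suc n))"
  proof (rule dependent_nat_choice)
    have "\<exists>\<phi>\<in>mod_hom R (F 0) (G 0). \<forall>x\<in>carrier (F 0). e' (\<phi> x) = h (e x)"
    proof (rule free_module_lift[OF ff g(2) g(1) g(4) mod_hom_comp[OF f(4) h]])
      fix x assume "x \<in> carrier (F 0)"
      then show "h (e x) \<in> e' ` carrier (G 0)"
        unfolding g(5) by (intro mod_hom_closed[OF h] mod_hom_closed[OF f(4)])
    qed
    then obtain \<phi> where \<phi>: "\<phi> \<in> mod_hom R (F 0) (G 0)" "\<forall>x\<in>carrier (F 0). e' (\<phi> x) = h (e x)" by blast
    have "\<phi> (d 0 x) \<in> d' 0 ` carrier (G (Suc 0))" if x: "x \<in> carrier (F (Suc 0))" for x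
    proof -
      have dx: "d 0 x \<in> carrier (F 0)" by (rule mod_hom_closed[OF f(3) x])
      then have "e' (\<phi> (d 0 x)) = \<zero>\<^bsub>N\<^esub>" using \<phi>(2) fdd(1)[OF x] mod_hom_zero[OF f(1) g(1) h] by simp
      then show ?thesis unfolding g(6) using mod_hom_closed[OF \<phi>(1) dx] by simp
    qed
    with \<phi> have "P 0 \<phi>" by (simp add: P_def)
    then show "\<exists>\<phi>. P 0 \<phi>" by blast
  next
    fix \<phi> n assume P: "P n \<phi>"
    have "\<exists>\<psi>\<in>mod_hom R (F (Suc n)) (G (Suc n)). \<forall>x\<in>carrier (F (Suc n)). d' n (\<psi> x) = \<phi> (d n x)"
      by (rule free_module_lift[OF ff g(2) g(2) g(3) mod_hom_comp[OF f(3)]]) (use P in \<open>auto simp: P_def\<close>)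
    then obtain \<psi> where \<psi>: "\<psi> \<in> mod_hom R (F (Suc n)) (G (Suc n))" "\<forall>x\<in>carrier (F (Suc n)). d' n (\<psi> x) = \<phi> (d n x)"
      by blast
    have "\<psi> (d (Suc n) x) \<in> d' (Suc n) ` carrier (G (Suc (Suc n)))" if x: "x \<in> carrier (F (Suc (Suc n)))" for x
    proof -
      have dx: "d (Suc n) x \<in> carrier (F (Suc n))" by (rule mod_hom_closed[OF f(3) x])
      moreover have "\<phi> \<zero>\<^bsub>F n\<^esub> = \<zero>\<^bsub>G n\<^esub>" using P mod_hom_zero[OF f(2) g(2)] by (auto simp: P_def)
      ultimately have "d' n (\<psi> (d (Suc n) x)) = \<zero>\<^bsub>G n\<^esub>" using \<psi>(2) fdd(2)[OF x] by simp
      then show ?thesis unfolding g(7) using mod_hom_closed[OF \<psi>(1) dx] by simp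
    qed
    with \<psi> have "P (Suc n) \<psi> \<and> Q n \<phi> \<psi>" by (simp add: P_def Q_def)
    then show "\<exists>\<psi>. P (Suc n) \<psi> \<and> Q n \<phi> \<psi>" by blast
  qed
  then obtain \<phi> where \<phi>: "\<And>n. P n (\<phi> n)" "\<And>n. Q n (\<phi> n) (\<phi> (Suc n))" by blast
  have "chain_map R F d G d' \<phi>" unfolding chain_map_def using \<phi> by (simp add: P_def Q_def)
  moreover have "\<forall>x\<in>carrier (F 0). e' (\<phi> 0 x) = h (e x)" using \<phi>(1)[of 0] by (simp add: P_def)
  ultimately show ?thesis by blast
qed

text \<open>Two lifts of the same map differ by a chain map that covers zero. Such a map is
  homotopic to zero: each component \<open>t n\<close> solves a lifting problem through a
  differential of \<open>G\<close>.\<close>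

lemma null_homotopic:
  assumes M: "module R M" and F: "free_resolution R M F d e" and G: "resolution R N G d' e'"
    and \<delta>: "chain_map R F d G d' \<delta>" and \<delta>0: "\<And>x. x \<in> carrier (F 0) \<Longrightarrow> e' (\<delta> 0 x) = \<zero>\<^bsub>N\<^esub>"
  shows "\<exists>t. (\<forall>n. t n \<in> mod_hom R (F n) (G (Suc n))) \<and> (\<forall>x\<in>carrier (F 0). \<delta> 0 x = d' 0 (t 0 x)) \<and>
    (\<forall>n. \<forall>x\<in>carrier (F (Suc n)). \<delta> (Suc n) x = d' (Suc n) (t (Suc n) x) \<oplus>\<^bsub>G (Suc n)\<^esub> t n (d n x))"
proof -
  note f = resolutionD[OF free_resolution_imp_resolution[OF M F]] and g = resolutionD[OF G]
  note fdd = resolution_dd[OF free_resolution_imp_resolution[OF M F]]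
  note ff = free_resolution_free[OF F]
  note de = chain_mapD[OF \<delta>]
  interpret F: module R "F n" for n by (rule f)
  interpret G: module R "G n" for n by (rule g)
  \<comment> \<open>What is left of \<open>\<delta>\<close> after subtracting
    \<open>t \<circ> d\<close>. The next component of the homotopy is a lift of this remainder
    through \<open>d' (Suc n)\<close>.\<close>
  define E where "E = (\<lambda>n t x. \<delta> (Suc n) x \<oplus>\<^bsub>G (Suc n)\<^esub> \<ominus>\<^bsub>G (Suc n)\<^esub> t (d n x))"
  define P where "P = (\<lambda>n t. t \<in> mod_hom R (F n) (G (Suc n)) \<and>
    (\<forall>x\<in>carrier (F (Suc n)). E n t x \<in> d' (Suc n) ` carrier (G (Suc (Suc n)))) \<and>
    (n = 0 \<longrightarrow> (\<forall>x\<in>carrier (F 0). \<delta> 0 x = d' 0 (t x))))"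
  define Q where "Q = (\<lambda>n t t'. \<forall>x\<in>carrier (F (Suc n)). E n t x = d' (Suc n) (t' x))"
  \<comment> \<open>If \<open>d' \<circ> t\<close> agrees with \<open>\<delta>\<close> on
    boundaries, the remainder is a cycle, because \<open>d'\<close> of its first term is
    \<open>\<delta> n (d n x)\<close>. Exactness then makes it a boundary.\<close>
  have Eim: "E n t x \<in> d' (Suc n) ` carrier (G (Suc (Suc n)))"
    if t: "t \<in> mod_hom R (F n) (G (Suc n))" and x: "x \<in> carrier (F (Suc n))"
      and eq: "d' n (t (d n x)) = \<delta> n (d n x)" for n t x
  proof -
    have c: "d n x \<in> carrier (F n)" "t (d n x) \<in> carrier (G (Suc n))" "\<delta> (Suc n) x \<in> carrier (G (Suc n))"
      using mod_hom_closed[OF f(3) x] mod_hom_closed[OF t] de(2) x by auto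
    have "d' n (E n t x) = \<delta> n (d n x) \<oplus>\<^bsub>G n\<^esub> \<ominus>\<^bsub>G n\<^esub> \<delta> n (d n x)"
      unfolding E_def using c
      by (simp add: mod_hom_add[OF g(3)] mod_hom_minus[OF g(2) g(2) g(3)] de(3)[OF x] eq)
    then have "d' n (E n t x) = \<zero>\<^bsub>G n\<^esub>" using de(2)[OF c(1)] by (simp add: G.r_neg)
    then show ?thesis unfolding g(7) E_def using c by simp
  qed
  have "\<exists>t. \<forall>n. P n (t n) \<and> Q n (t n) (t (Suc n))"
  proof (rule dependent_nat_choice)
    have "\<exists>t\<in>mod_hom R (F 0) (G (Suc 0)). \<forall>x\<in>carrier (F 0). d' 0 (t x) = \<delta> 0 x"
    proof (rule free_module_lift[OF ff g(2) g(2) g(3) de(1)])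
      fix x assume "x \<in> carrier (F 0)"
      then show "\<delta> 0 x \<in> d' 0 ` carrier (G (Suc 0))" unfolding g(6) using \<delta>0 de(2) by simp
    qed
    then obtain t where t: "t \<in> mod_hom R (F 0) (G (Suc 0))" "\<forall>x\<in>carrier (F 0). d' 0 (t x) = \<delta> 0 x" by blast
    then have "P 0 t" using Eim[OF t(1)] mod_hom_closed[OF f(3)] by (simp add: P_def)
    then show "\<exists>t. P 0 t" by blast
  next
    fix t n assume P: "P n t"
    then have t: "t \<in> mod_hom R (F n) (G (Suc n))" by (simp add: P_def)
    have "E n t \<in> mod_hom R (F (Suc n)) (G (Suc n))"
      unfolding E_def by (intro mod_hom_plus[OF g(2)] mod_hom_neg[OF g(2)] de(1) mod_hom_comp[OF f(3) t])
    then have "\<exists>t'\<in>mod_hom R (F (Suc n)) (G (Suc (Suc n))). \<forall>x\<in>carrier (F (Suc n)). d' (Suc n) (t' x) = E n t x"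
      by (rule free_module_lift[OF ff g(2) g(2) g(3)]) (use P in \<open>auto simp: P_def\<close>)
    then obtain t' where t': "t' \<in> mod_hom R (F (Suc n)) (G (Suc (Suc n)))"
      "\<forall>x\<in>carrier (F (Suc n)). d' (Suc n) (t' x) = E n t x" by blast
    \<comment> \<open>On a boundary, the term of \<open>E n t\<close> that involves \<open>t\<close>
      vanishes, since two consecutive differentials compose to zero. This gives the hypothesis of
      \<open>Eim\<close> in the next degree.\<close>
    have "d' (Suc n) (t' (d (Suc n) x)) = \<delta> (Suc n) (d (Suc n) x)" if x: "x \<in> carrier (F (Suc (Suc n)))" for x
    proof -
      have dx: "d (Suc n) x \<in> carrier (F (Suc n))" by (rule mod_hom_closed[OF f(3) x])
      then show ?thesis using t'(2) fdd(2)[OF x] mod_hom_zero[OF f(2) g(2) t] de(2)[OF dx] by (simp add: E_def)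
    qed
    with t' have "P (Suc n) t' \<and> Q n t t'" using Eim[OF t'(1)] by (simp add: P_def Q_def)
    then show "\<exists>t'. P (Suc n) t' \<and> Q n t t'" by blast
  qed
  then obtain t where t: "\<And>n. P n (t n)" "\<And>n. Q n (t n) (t (Suc n))" by blast
  have th: "t n \<in> mod_hom R (F n) (G (Suc n))" for n using t(1)[of n] by (simp add: P_def)
  have "\<delta> (Suc n) x = d' (Suc n) (t (Suc n) x) \<oplus>\<^bsub>G (Suc n)\<^esub> t n (d n x)" if x: "x \<in> carrier (F (Suc n))" for n x
  proof -
    have c: "t n (d n x) \<in> carrier (G (Suc n))" "\<delta> (Suc n) x \<in> carrier (G (Suc n))"
      using mod_hom_closed[OF th mod_hom_closed[OF f(3) x]] de(2) x by auto
    have "d' (Suc n) (t (Suc n) x) = \<delta> (Suc n) x \<oplus>\<^bsub>G (Suc n)\<^esub> \<ominus>\<^bsub>G (Suc n)\<^esub> t n (d n x)"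
      using t(2)[of n] x by (simp add: Q_def E_def)
    then show ?thesis using c by (simp add: G.a_assoc G.l_neg)
  qed
  moreover have "\<forall>x\<in>carrier (F 0). \<delta> 0 x = d' 0 (t 0 x)" using t(1)[of 0] by (simp add: P_def)
  ultimately show ?thesis using th by blast
qed

text \<open>By the homotopy, \<open>z \<circ> \<delta>\<close> is the sum of
  \<open>z \<circ> d' \<circ> t\<close>, which vanishes for a cocycle, and the coboundary of
  \<open>z \<circ> t\<close>. In degree \<open>0\<close> the second summand is absent and the
  composite is zero. Thus lifts of the same map act equally on cohomology.\<close>

lemma null_homotopic_cobd:
  assumes M: "module R M" and F: "free_resolution R M F d e" and G: "resolution R N G d' e'"
    and \<delta>: "chain_map R F d G d' \<delta>" and \<delta>0: "\<And>x. x \<in> carrier (F 0) \<Longrightarrow> e' (\<delta> 0 x) = \<zero>\<^bsub>N\<^esub>"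
    and K: "module R K" and z: "z \<in> cocyc R G d' K i"
  shows "(\<lambda>x. z (\<delta> i x)) \<in> cobd R F d K i"
proof -
  obtain t where t: "\<And>n. t n \<in> mod_hom R (F n) (G (Suc n))" "\<And>x. x \<in> carrier (F 0) \<Longrightarrow> \<delta> 0 x = d' 0 (t 0 x)"
    "\<And>n x. x \<in> carrier (F (Suc n)) \<Longrightarrow> \<delta> (Suc n) x = d' (Suc n) (t (Suc n) x) \<oplus>\<^bsub>G (Suc n)\<^esub> t n (d n x)"
    using null_homotopic[OF M F G \<delta> \<delta>0] by blast
  interpret K: module R K by fact
  note f = resolutionD[OF free_resolution_imp_resolution[OF M F]] and g = resolutionD[OF G]
  have zh: "z \<in> mod_hom R (G i) K" and zd: "\<And>y. y \<in> carrier (G (Suc i)) \<Longrightarrow> z (d' i y) = \<zero>\<^bsub>K\<^esub>"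
    using z by (auto simp: cocyc_def)
  show ?thesis
  proof (cases i)
    case 0
    then show ?thesis using t(2) zd mod_hom_closed[OF t(1)] by (auto simp: cobd_def)
  next
    case (Suc j)
    have "z (\<delta> (Suc j) x) = z (t j (d j x))" if x: "x \<in> carrier (F (Suc j))" for x
    proof -
      have c: "t (Suc j) x \<in> carrier (G (Suc (Suc j)))" "t j (d j x) \<in> carrier (G (Suc j))"
        using mod_hom_closed[OF t(1)] mod_hom_closed[OF f(3)] x by auto
      then have "z (\<delta> (Suc j) x) = z (d' (Suc j) (t (Suc j) x)) \<oplus>\<^bsub>K\<^esub> z (t j (d j x))"
        using zh mod_hom_closed[OF g(3)] unfolding t(3)[OF x] Suc by (intro mod_hom_add) auto
      then show ?thesis using zd c mod_hom_closed[OF zh] by (simp add: Suc)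
    qed
    then show ?thesis
      using mod_hom_comp[OF t(1) zh[unfolded Suc]] unfolding Suc cobd_def by (auto intro!: bexI)
  qed
qed

subsection \<open>The mapping cone\<close>

definition dsum_module :: "('r, 'm, 'y) module_scheme \<Rightarrow> ('r, 'n, 'z) module_scheme \<Rightarrow> ('r, 'm \<times> 'n) module"
  where "dsum_module M N = \<lparr>carrier = carrier M \<times> carrier N, monoid.mult = undefined, one = undefined,
     ring.zero = (\<zero>\<^bsub>M\<^esub>, \<zero>\<^bsub>N\<^esub>), ring.add = (\<lambda>p q. (fst p \<oplus>\<^bsub>M\<^esub> fst q, snd p \<oplus>\<^bsub>N\<^esub> snd q)),
     smult = (\<lambda>r p. (r \<odot>\<^bsub>M\<^esub> fst p, r \<odot>\<^bsub>N\<^esub> snd p))\<rparr>"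

lemma dsum_module_simps [simp]:
  "carrier (dsum_module M N) = carrier M \<times> carrier N"
  "\<zero>\<^bsub>dsum_module M N\<^esub> = (\<zero>\<^bsub>M\<^esub>, \<zero>\<^bsub>N\<^esub>)"
  "(a, b) \<oplus>\<^bsub>dsum_module M N\<^esub> (c, d) = (a \<oplus>\<^bsub>M\<^esub> c, b \<oplus>\<^bsub>N\<^esub> d)"
  "r \<odot>\<^bsub>dsum_module M N\<^esub> (a, b) = (r \<odot>\<^bsub>M\<^esub> a, r \<odot>\<^bsub>N\<^esub> b)"
  by (simp_all add: dsum_module_def)

lemma dsum_module_module:
  assumes "module R M" "module R N" shows "module R (dsum_module M N)"
proof -
  interpret M: module R M by fact
  interpret N: module R N by fact
  show ?thesis
  proof (rule moduleI)
    show "abelian_group (dsum_module M N)"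
    proof (rule abelian_groupI)
      fix x assume "x \<in> carrier (dsum_module M N)"
      then show "\<exists>y\<in>carrier (dsum_module M N). y \<oplus>\<^bsub>dsum_module M N\<^esub> x = \<zero>\<^bsub>dsum_module M N\<^esub>"
        by (intro bexI[of _ "(\<ominus>\<^bsub>M\<^esub> fst x, \<ominus>\<^bsub>N\<^esub> snd x)"]) (auto simp: M.l_neg N.l_neg)
    qed (auto simp: M.a_ac N.a_ac)
  qed (auto simp: M.R.is_cring M.smult_l_distr N.smult_l_distr M.smult_r_distr N.smult_r_distr
      M.smult_assoc1 N.smult_assoc1)
qed

text \<open>\<open>shift_module F n\<close> is \<open>F (n - 1)\<close>, with the zero module (carried by the zero of \<open>F 0\<close>) in degree \<open>0\<close>.\<close>

definition shift_module :: "(nat \<Rightarrow> ('r, 'p) module) \<Rightarrow> nat \<Rightarrow> ('r, 'p) module"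
  where "shift_module F n = (case n of 0 \<Rightarrow> (F 0)\<lparr>carrier := {\<zero>\<^bsub>F 0\<^esub>}\<rparr> | Suc j \<Rightarrow> F j)"

definition cone_module :: "(nat \<Rightarrow> ('r, 'p) module) \<Rightarrow> (nat \<Rightarrow> ('r, 'q) module) \<Rightarrow> nat \<Rightarrow> ('r, 'q \<times> 'p) module"
  where "cone_module F G n = dsum_module (G n) (shift_module F n)"

text \<open>The differential of the mapping cone of \<open>\<phi>\<close>. The sign makes
  consecutive differentials compose to zero, as the mixed terms \<open>d' (\<phi> x)\<close> and
  \<open>\<phi> (d x)\<close> then cancel. For \<open>n = 0\<close> the second component lands in
  the zero module of \<open>shift_module\<close>, hence the constant value.\<close>

definition cone_diff :: "(nat \<Rightarrow> ('r, 'p) module) \<Rightarrow> (nat \<Rightarrow> 'p \<Rightarrow> 'p) \<Rightarrow> (nat \<Rightarrow> ('r, 'q) module) \<Rightarrow>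
    (nat \<Rightarrow> 'q \<Rightarrow> 'q) \<Rightarrow> (nat \<Rightarrow> 'p \<Rightarrow> 'q) \<Rightarrow> nat \<Rightarrow> 'q \<times> 'p \<Rightarrow> 'q \<times> 'p"
  where "cone_diff F d G d' \<phi> n = (\<lambda>(y, x). (d' n y \<oplus>\<^bsub>G n\<^esub> \<phi> n x,
     case n of 0 \<Rightarrow> \<zero>\<^bsub>F 0\<^esub> | Suc j \<Rightarrow> \<ominus>\<^bsub>F j\<^esub> d j x))"

lemma shift_module_module:
  assumes "\<And>n. module R (F n)" shows "module R (shift_module F n)"
proof (cases n)
  case 0
  interpret F: module R "F 0" by (rule assms)
  have "submodule {\<zero>\<^bsub>F 0\<^esub>} R (F 0)" by (rule F.submoduleI) auto
  then show ?thesis unfolding 0 shift_module_def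
    using submodule.submodule_is_module[OF _ assms] by auto
next
  case (Suc j)
  then show ?thesis by (simp add: shift_module_def assms)
qed

text \<open>Exactness in degree \<open>0\<close> rests on the kernel of \<open>g\<close> being the
  image of \<open>f\<close>, in degree \<open>1\<close> on the injectivity of \<open>f\<close>, and
  in higher degrees on the exactness of \<open>F\<close>. Each time the component in
  \<open>G\<close> is then solved by the exactness of \<open>G\<close>.\<close>

lemma cone_resolution:
  assumes M1: "module R M1" and M2: "module R M2" and M3: "module R M3"
    and ex: "short_exact R M1 M2 M3 f g"
    and F: "resolution R M1 F d e" and G: "resolution R M2 G d' e'"
    and \<phi>: "chain_map R F d G d' \<phi>" and \<phi>0: "\<And>x. x \<in> carrier (F 0) \<Longrightarrow> e' (\<phi> 0 x) = f (e x)"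
  shows "resolution R M3 (cone_module F G) (cone_diff F d G d' \<phi>) (\<lambda>p. g (e' (fst p)))"
proof -
  note fr = resolutionD[OF F] and gr = resolutionD[OF G]
  note fdd = resolution_dd[OF F] and gdd = resolution_dd[OF G]
  note ph = chain_mapD[OF \<phi>]
  interpret F: module R "F n" for n by (rule fr)
  interpret G: module R "G n" for n by (rule gr)
  interpret M2: module R M2 by fact
  have fh: "f \<in> mod_hom R M1 M2" and gh: "g \<in> mod_hom R M2 M3" and finj: "inj_on f (carrier M1)"
    and fim: "f ` carrier M1 = {y \<in> carrier M2. g y = \<zero>\<^bsub>M3\<^esub>}" and gim: "g ` carrier M2 = carrier M3"
    using ex by (auto simp: short_exact_def a_kernel_eq)
  note fc = mod_hom_closed[OF fr(3)] and gc = mod_hom_closed[OF gr(3)]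
  have C: "module R (cone_module F G n)" for n
    unfolding cone_module_def by (intro dsum_module_module gr(2) shift_module_module fr(2))
  interpret C: module R "cone_module F G n" for n by (rule C)
  have c0: "carrier (cone_module F G 0) = carrier (G 0) \<times> {\<zero>\<^bsub>F 0\<^esub>}"
    and cS: "carrier (cone_module F G (Suc n)) = carrier (G (Suc n)) \<times> carrier (F n)" for n
    by (auto simp: cone_module_def shift_module_def)
  have D: "cone_diff F d G d' \<phi> n \<in> mod_hom R (cone_module F G (Suc n)) (cone_module F G n)" for n
  proof (cases n)
    case 0
    show ?thesis unfolding 0 cone_diff_def
      by (rule mod_homI) (auto simp: cone_module_def shift_module_def gc ph(2) mod_hom_add[OF gr(3)]
        mod_hom_add[OF ph(1)] mod_hom_smult[OF gr(3)] mod_hom_smult[OF ph(1)] G.a_ac G.smult_r_distr)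
  next
    case (Suc j)
    show ?thesis unfolding Suc cone_diff_def
      by (rule mod_homI) (auto simp: cone_module_def shift_module_def gc fc ph(2) mod_hom_add[OF gr(3)]
        mod_hom_add[OF ph(1)] mod_hom_smult[OF gr(3)] mod_hom_smult[OF ph(1)] G.a_ac G.smult_r_distr
        mod_hom_add[OF fr(3)] mod_hom_smult[OF fr(3)] F.minus_add F.smult_r_minus)
  qed
  have E: "(\<lambda>p. g (e' (fst p))) \<in> mod_hom R (cone_module F G 0) M3"
    by (rule mod_homI) (auto simp: cone_module_def shift_module_def mod_hom_closed[OF gr(4)]
        mod_hom_closed[OF gh] mod_hom_add[OF gr(4)] mod_hom_add[OF gh] mod_hom_smult[OF gr(4)] mod_hom_smult[OF gh])
  \<comment> \<open>The equation left over in the component of \<open>G\<close>: if \<open>y\<close>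
    plus \<open>\<phi> n x\<close> is a boundary, then \<open>y\<close> is the first component of
    the cone differential at \<open>(y', -x)\<close>.\<close>
  have lift: "\<exists>y'\<in>carrier (G (Suc n)). y = d' n y' \<oplus>\<^bsub>G n\<^esub> \<phi> n (\<ominus>\<^bsub>F n\<^esub> x)"
    if c: "y \<in> carrier (G n)" "x \<in> carrier (F n)" and im: "y \<oplus>\<^bsub>G n\<^esub> \<phi> n x \<in> d' n ` carrier (G (Suc n))" for y x n
  proof -
    obtain y' where y': "y' \<in> carrier (G (Suc n))" "y \<oplus>\<^bsub>G n\<^esub> \<phi> n x = d' n y'" using im by blast
    have "d' n y' \<oplus>\<^bsub>G n\<^esub> \<phi> n (\<ominus>\<^bsub>F n\<^esub> x) = y"
      unfolding y'(2)[symmetric] using c ph(2)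
      by (simp add: mod_hom_minus[OF fr(2) gr(2) ph(1)] G.a_assoc G.r_neg)
    with y' show ?thesis by blast
  qed
  have exact0: "cone_diff F d G d' \<phi> 0 ` carrier (cone_module F G (Suc 0)) =
      {p \<in> carrier (cone_module F G 0). g (e' (fst p)) = \<zero>\<^bsub>M3\<^esub>}"
  proof
    have "g (e' (d' 0 y \<oplus>\<^bsub>G 0\<^esub> \<phi> 0 x)) = \<zero>\<^bsub>M3\<^esub>" if "y \<in> carrier (G (Suc 0))" "x \<in> carrier (F 0)" for y x
    proof -
      have "e x \<in> carrier M1" by (rule mod_hom_closed[OF fr(4)]) fact
      then have "f (e x) \<in> carrier M2" "g (f (e x)) = \<zero>\<^bsub>M3\<^esub>" using fim by blast+
      then show ?thesis using that gc ph(2) by (simp add: mod_hom_add[OF gr(4)] gdd(1) \<phi>0)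
    qed
    then show "cone_diff F d G d' \<phi> 0 ` carrier (cone_module F G (Suc 0)) \<subseteq>
      {p \<in> carrier (cone_module F G 0). g (e' (fst p)) = \<zero>\<^bsub>M3\<^esub>}"
      unfolding c0 cS using gc ph(2) by (auto simp: cone_diff_def)
    show "{p \<in> carrier (cone_module F G 0). g (e' (fst p)) = \<zero>\<^bsub>M3\<^esub>} \<subseteq>
      cone_diff F d G d' \<phi> 0 ` carrier (cone_module F G (Suc 0))"
    proof
      fix p assume "p \<in> {p \<in> carrier (cone_module F G 0). g (e' (fst p)) = \<zero>\<^bsub>M3\<^esub>}"
      then obtain y where p: "p = (y, \<zero>\<^bsub>F 0\<^esub>)" "y \<in> carrier (G 0)" "g (e' y) = \<zero>\<^bsub>M3\<^esub>" by (auto simp: c0)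
      have e'y: "e' y \<in> carrier M2" by (rule mod_hom_closed[OF gr(4) p(2)])
      then have "e' y \<in> f ` carrier M1" unfolding fim using p(3) by simp
      then have "e' y \<in> f ` e ` carrier (F 0)" unfolding fr(5) .
      then obtain x where x: "x \<in> carrier (F 0)" "e' y = f (e x)" by blast
      have mx: "\<ominus>\<^bsub>F 0\<^esub> x \<in> carrier (F 0)" using x by simp
      have "\<phi> 0 (\<ominus>\<^bsub>F 0\<^esub> x) = \<ominus>\<^bsub>G 0\<^esub> \<phi> 0 x" by (rule mod_hom_minus[OF fr(2) gr(2) ph(1) x(1)])
      moreover have "e' (\<ominus>\<^bsub>G 0\<^esub> \<phi> 0 x) = \<ominus>\<^bsub>M2\<^esub> e' y"
        using x ph(2) by (simp add: mod_hom_minus[OF gr(2) M2 gr(4)] \<phi>0)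
      ultimately have "e' (y \<oplus>\<^bsub>G 0\<^esub> \<phi> 0 (\<ominus>\<^bsub>F 0\<^esub> x)) = \<zero>\<^bsub>M2\<^esub>"
        using p(2) x(1) ph(2) e'y by (simp add: mod_hom_add[OF gr(4)] M2.r_neg)
      then have "y \<oplus>\<^bsub>G 0\<^esub> \<phi> 0 (\<ominus>\<^bsub>F 0\<^esub> x) \<in> d' 0 ` carrier (G (Suc 0))"
        unfolding gr(6) using p(2) mx ph(2) by simp
      \<comment> \<open>Used with the negative of \<open>x\<close>, so that the double sign cancels
        and the preimage has second component \<open>x\<close>.\<close>
      from lift[OF p(2) mx this, unfolded F.minus_minus[OF x(1)]]
      obtain y' where "y' \<in> carrier (G (Suc 0))" "y = d' 0 y' \<oplus>\<^bsub>G 0\<^esub> \<phi> 0 x" by blast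
      then have "p = cone_diff F d G d' \<phi> 0 (y', x)" "(y', x) \<in> carrier (cone_module F G (Suc 0))"
        using x by (auto simp: cone_diff_def p cS)
      then show "p \<in> cone_diff F d G d' \<phi> 0 ` carrier (cone_module F G (Suc 0))" by blast
    qed
  qed
  have exactS: "cone_diff F d G d' \<phi> (Suc n) ` carrier (cone_module F G (Suc (Suc n))) =
      {p \<in> carrier (cone_module F G (Suc n)). cone_diff F d G d' \<phi> n p = \<zero>\<^bsub>cone_module F G n\<^esub>}" for n
  proof
    have "cone_diff F d G d' \<phi> n (cone_diff F d G d' \<phi> (Suc n) (y, x)) = \<zero>\<^bsub>cone_module F G n\<^esub>"
      if c: "y \<in> carrier (G (Suc (Suc n)))" "x \<in> carrier (F (Suc n))" for y x
    proof -
      have dx: "d n x \<in> carrier (F n)" by (rule fc[OF c(2)])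
      have "d' n (d' (Suc n) y \<oplus>\<^bsub>G (Suc n)\<^esub> \<phi> (Suc n) x) \<oplus>\<^bsub>G n\<^esub> \<phi> n (\<ominus>\<^bsub>F n\<^esub> d n x) = \<zero>\<^bsub>G n\<^esub>"
        using c dx gc ph(2) gdd(2)[OF c(1)]
        by (simp add: mod_hom_add[OF gr(3)] mod_hom_minus[OF fr(2) gr(2) ph(1)] ph(3)[symmetric] G.r_neg)
      moreover have "d j (\<ominus>\<^bsub>F (Suc j)\<^esub> d (Suc j) x) = \<zero>\<^bsub>F j\<^esub>" if "n = Suc j" for j
        using c(2) dx fdd(2)[of x j] that by (simp add: mod_hom_minus[OF fr(2) fr(2) fr(3)])
      ultimately show ?thesis
        by (auto simp: cone_diff_def cone_module_def shift_module_def split: nat.split)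
    qed
    then show "cone_diff F d G d' \<phi> (Suc n) ` carrier (cone_module F G (Suc (Suc n))) \<subseteq>
      {p \<in> carrier (cone_module F G (Suc n)). cone_diff F d G d' \<phi> n p = \<zero>\<^bsub>cone_module F G n\<^esub>}"
      using mod_hom_closed[OF D[of "Suc n"]] by (fastforce simp: cS)
    show "{p \<in> carrier (cone_module F G (Suc n)). cone_diff F d G d' \<phi> n p = \<zero>\<^bsub>cone_module F G n\<^esub>} \<subseteq>
      cone_diff F d G d' \<phi> (Suc n) ` carrier (cone_module F G (Suc (Suc n)))"
    proof
      fix p assume "p \<in> {p \<in> carrier (cone_module F G (Suc n)). cone_diff F d G d' \<phi> n p = \<zero>\<^bsub>cone_module F G n\<^esub>}"
      then obtain y x where p: "p = (y, x)" "y \<in> carrier (G (Suc n))" "x \<in> carrier (F n)"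
        and z: "cone_diff F d G d' \<phi> n (y, x) = \<zero>\<^bsub>cone_module F G n\<^esub>" by (auto simp: cS)
      have z1: "d' n y \<oplus>\<^bsub>G n\<^esub> \<phi> n x = \<zero>\<^bsub>G n\<^esub>" using z by (simp add: cone_diff_def cone_module_def)
      \<comment> \<open>For positive \<open>n\<close> the second component of the cone differential
        says that \<open>x\<close> is a cycle. For \<open>n = 0\<close> that component carries no
        information. Instead, \<open>e'\<close> of the first component equals
        \<open>f (e x)\<close>, and injectivity of \<open>f\<close> gives that \<open>e x\<close> is
        zero.\<close>
      have "x \<in> d n ` carrier (F (Suc n))"
      proof (cases n)
        case 0
        have ex: "e x \<in> carrier M1" using mod_hom_closed[OF fr(4)] p(3) 0 by simp
        have "e' (d' 0 y \<oplus>\<^bsub>G 0\<^esub> \<phi> 0 x) = f (e x)"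
          using p(2,3) gc ph(2) mod_hom_closed[OF fh ex] unfolding 0
          by (simp add: mod_hom_add[OF gr(4)] gdd(1) \<phi>0)
        then have "f (e x) = f \<zero>\<^bsub>M1\<^esub>"
          using z1 mod_hom_zero[OF gr(2) M2 gr(4)] mod_hom_zero[OF M1 M2 fh] by (simp add: 0)
        moreover have "\<zero>\<^bsub>M1\<^esub> \<in> carrier M1"
          using M1 by (simp add: module_def abelian_group_def abelian_monoid.zero_closed)
        ultimately have "e x = \<zero>\<^bsub>M1\<^esub>" using finj ex by (auto dest: inj_onD)
        then show ?thesis unfolding 0 fr(6) using p(3) 0 by simp
      next
        case (Suc j)
        have "\<ominus>\<^bsub>F j\<^esub> d j x = \<zero>\<^bsub>F j\<^esub>"
          using z unfolding Suc by (simp add: cone_diff_def cone_module_def shift_module_def)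
        then have "d j x = \<zero>\<^bsub>F j\<^esub>" using fc p(3) unfolding Suc by (metis F.minus_minus F.minus_zero_module)
        then show ?thesis unfolding Suc fr(7) using p(3) Suc by simp
      qed
      then obtain x' where x': "x' \<in> carrier (F (Suc n))" "x = d n x'" by blast
      have mx': "\<ominus>\<^bsub>F (Suc n)\<^esub> x' \<in> carrier (F (Suc n))" using x' by simp
      have "d' n (y \<oplus>\<^bsub>G (Suc n)\<^esub> \<phi> (Suc n) x') = \<zero>\<^bsub>G n\<^esub>"
        using z1 p(2) x' ph(2) by (simp add: mod_hom_add[OF gr(3)] ph(3)[symmetric])
      then have "y \<oplus>\<^bsub>G (Suc n)\<^esub> \<phi> (Suc n) x' \<in> d' (Suc n) ` carrier (G (Suc (Suc n)))"
        unfolding gr(7) using p(2) x'(1) ph(2) by simp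
      from lift[OF p(2) x'(1) this] obtain y' where y': "y' \<in> carrier (G (Suc (Suc n)))"
        "y = d' (Suc n) y' \<oplus>\<^bsub>G (Suc n)\<^esub> \<phi> (Suc n) (\<ominus>\<^bsub>F (Suc n)\<^esub> x')" by blast
      \<comment> \<open>Because of the sign in the cone differential, the second component of the
        preimage is \<open>-x'\<close> and not \<open>x'\<close>.\<close>
      have "p = cone_diff F d G d' \<phi> (Suc n) (y', \<ominus>\<^bsub>F (Suc n)\<^esub> x')"
        using y' x' fc by (simp add: cone_diff_def p(1) mod_hom_minus[OF fr(2) fr(2) fr(3)])
      moreover have "(y', \<ominus>\<^bsub>F (Suc n)\<^esub> x') \<in> carrier (cone_module F G (Suc (Suc n)))" using y' mx' by (simp add: cS)
      ultimately show "p \<in> cone_diff F d G d' \<phi> (Suc n) ` carrier (cone_module F G (Suc (Suc n)))" by blast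
    qed
  qed
  have surj: "(\<lambda>p. g (e' (fst p))) ` carrier (cone_module F G 0) = carrier M3"
    unfolding c0 gim[symmetric] gr(5)[symmetric] by force
  show ?thesis
    unfolding resolution_def a_kernel_eq using M3 C D E surj exact0 exactS by simp
qed

text \<open>A cochain \<open>u\<close> bounding \<open>z \<circ> \<phi>\<close> extends
  \<open>z\<close> to the cocycle \<open>Z (y, x) = z y + u x\<close> on the cone, which resolves
  \<open>M3\<close>. With a lift \<open>\<alpha>\<close> of the identity of \<open>M3\<close> into
  the cone, put \<open>w = Z \<circ> \<alpha>\<close>. Both \<open>\<alpha> \<circ> \<gamma>\<close>
  and the inclusion of \<open>F2\<close> into the cone cover \<open>g\<close>, so
  \<open>w \<circ> \<gamma>\<close> and \<open>z\<close> differ by a coboundary.\<close>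

lemma ext_exact_middle:
  assumes M1: "module R M1" and M2: "module R M2" and M3: "module R M3" and N: "module R N"
    and ex: "short_exact R M1 M2 M3 f g"
    and F1: "free_resolution R M1 F1 d1 e1" and F2: "free_resolution R M2 F2 d2 e2"
    and F3: "free_resolution R M3 F3 d3 e3"
    and \<phi>: "chain_map R F1 d1 F2 d2 \<phi>" and \<phi>0: "\<And>x. x \<in> carrier (F1 0) \<Longrightarrow> e2 (\<phi> 0 x) = f (e1 x)"
    and \<gamma>: "chain_map R F2 d2 F3 d3 \<gamma>" and \<gamma>0: "\<And>x. x \<in> carrier (F2 0) \<Longrightarrow> e3 (\<gamma> 0 x) = g (e2 x)"
    and z: "z \<in> cocyc R F2 d2 N i" and z\<phi>: "(\<lambda>x. z (\<phi> i x)) \<in> cobd R F1 d1 N i"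
  shows "\<exists>w\<in>cocyc R F3 d3 N i. (\<lambda>x. z x \<oplus>\<^bsub>N\<^esub> \<ominus>\<^bsub>N\<^esub> w (\<gamma> i x)) \<in> cobd R F2 d2 N i"
proof -
  note R1 = free_resolution_imp_resolution[OF M1 F1] and R2 = free_resolution_imp_resolution[OF M2 F2]
    and R3 = free_resolution_imp_resolution[OF M3 F3]
  note r1 = resolutionD[OF R1] and r2 = resolutionD[OF R2]
  let ?C = "cone_module F1 F2" and ?D = "cone_diff F1 d1 F2 d2 \<phi>" and ?E = "\<lambda>p. g (e2 (fst p))"
  note C = cone_resolution[OF M1 M2 M3 ex R1 R2 \<phi> \<phi>0]
  note c = resolutionD[OF C]
  interpret F1: module R "F1 n" for n by (rule r1)
  interpret F2: module R "F2 n" for n by (rule r2)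
  interpret N: module R N by fact
  interpret M3: module R M3 by fact
  interpret C: module R "?C n" for n by (rule c)
  have zh: "z \<in> mod_hom R (F2 i) N" and zd: "\<And>y. y \<in> carrier (F2 (Suc i)) \<Longrightarrow> z (d2 i y) = \<zero>\<^bsub>N\<^esub>"
    using z by (auto simp: cocyc_def)
  have "\<exists>Z\<in>cocyc R ?C ?D N i. \<forall>y\<in>carrier (F2 i). Z (y, \<zero>\<^bsub>shift_module F1 i\<^esub>) = z y"
  proof (cases i)
    case 0
    \<comment> \<open>In degree \<open>0\<close> being a coboundary means that
      \<open>z \<circ> \<phi>\<close> is zero, and the second component of the cone is the zero
      module, so no correction term \<open>u\<close> arises.\<close>
    have "(\<lambda>p. z (fst p)) \<in> cocyc R ?C ?D N 0"
      unfolding cocyc_def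
    proof (intro CollectI conjI ballI mod_homI)
      fix p assume "p \<in> carrier (?C (Suc 0))"
      then obtain y x where p: "p = (y, x)" "y \<in> carrier (F2 (Suc 0))" "x \<in> carrier (F1 0)"
        by (auto simp: cone_module_def shift_module_def)
      then show "z (fst (?D 0 p)) = \<zero>\<^bsub>N\<^esub>"
        using z\<phi> zd zh[unfolded 0] chain_mapD(2)[OF \<phi>] mod_hom_closed[OF r2(3)] unfolding 0
        by (simp add: cone_diff_def mod_hom_add[of z] cobd_def)
    qed (use zh[unfolded 0] in \<open>auto simp: cone_module_def shift_module_def mod_hom_def\<close>)
    then show ?thesis unfolding 0 by (intro bexI[of _ "\<lambda>p. z (fst p)"]) auto
  next
    case (Suc j)
    then obtain u where u: "u \<in> mod_hom R (F1 j) N" "\<And>x. x \<in> carrier (F1 (Suc j)) \<Longrightarrow> z (\<phi> (Suc j) x) = u (d1 j x)"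
      using z\<phi> by (auto simp: cobd_def)
    note zh' = zh[unfolded Suc]
    have "(\<lambda>p. z (fst p) \<oplus>\<^bsub>N\<^esub> u (snd p)) \<in> cocyc R ?C ?D N (Suc j)"
      unfolding cocyc_def
    proof (intro CollectI conjI ballI)
      show "(\<lambda>p. z (fst p) \<oplus>\<^bsub>N\<^esub> u (snd p)) \<in> mod_hom R (?C (Suc j)) N"
        by (intro mod_hom_plus[OF N])
          (use zh' u(1) in \<open>auto simp: cone_module_def shift_module_def mod_hom_def\<close>)
      fix p assume "p \<in> carrier (?C (Suc (Suc j)))"
      then obtain y x where p: "p = (y, x)" and y: "y \<in> carrier (F2 (Suc (Suc j)))" and x: "x \<in> carrier (F1 (Suc j))"
        by (auto simp: cone_module_def shift_module_def)
      have dx: "d1 j x \<in> carrier (F1 j)" using mod_hom_closed[OF r1(3)] x by simp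
      have "z (d2 (Suc j) y \<oplus>\<^bsub>F2 (Suc j)\<^esub> \<phi> (Suc j) x) = z (d2 (Suc j) y) \<oplus>\<^bsub>N\<^esub> z (\<phi> (Suc j) x)"
        using mod_hom_closed[OF r2(3)] y chain_mapD(2)[OF \<phi>] x by (intro mod_hom_add[OF zh']) auto
      \<comment> \<open>The cocycle condition removes the first summand and the choice of
        \<open>u\<close> rewrites the second. The result cancels against the value of
        \<open>u\<close> on the negated second component of the cone differential.\<close>
      also have "\<dots> = u (d1 j x)" using zd y u x mod_hom_closed[OF u(1) dx] unfolding Suc by simp
      finally show "z (fst (?D (Suc j) p)) \<oplus>\<^bsub>N\<^esub> u (snd (?D (Suc j) p)) = \<zero>\<^bsub>N\<^esub>"
        using mod_hom_closed[OF u(1) dx] dx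
        by (simp add: p cone_diff_def mod_hom_minus[OF r1(2) N u(1)] N.r_neg)
    qed
    moreover have "z y \<oplus>\<^bsub>N\<^esub> u \<zero>\<^bsub>F1 j\<^esub> = z y" if "y \<in> carrier (F2 (Suc j))" for y
      using that mod_hom_zero[OF r1(2) N u(1)] mod_hom_closed[OF zh'] by simp
    ultimately show ?thesis unfolding Suc
      by (intro bexI[of _ "\<lambda>p. z (fst p) \<oplus>\<^bsub>N\<^esub> u (snd p)"]) (auto simp: shift_module_def)
  qed
  then obtain Z where Z: "Z \<in> cocyc R ?C ?D N i" "\<And>y. y \<in> carrier (F2 i) \<Longrightarrow> Z (y, \<zero>\<^bsub>shift_module F1 i\<^esub>) = z y"
    by blast
  let ?\<iota> = "\<lambda>n y. (y, \<zero>\<^bsub>shift_module F1 n\<^esub>)"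
  interpret S: module R "shift_module F1 n" for n by (rule shift_module_module[OF r1(2)])
  have \<iota>: "chain_map R F2 d2 ?C ?D ?\<iota>"
    unfolding chain_map_def
  proof (intro conjI allI ballI)
    fix n show "?\<iota> n \<in> mod_hom R (F2 n) (?C n)"
      by (rule mod_homI) (auto simp: cone_module_def)
    fix y assume y: "y \<in> carrier (F2 (Suc n))"
    have "\<phi> n \<zero>\<^bsub>F1 n\<^esub> = \<zero>\<^bsub>F2 n\<^esub>" by (rule mod_hom_zero[OF r1(2) r2(2) chain_mapD(1)[OF \<phi>]])
    moreover have "d1 j \<zero>\<^bsub>F1 (Suc j)\<^esub> = \<zero>\<^bsub>F1 j\<^esub>" for j by (rule mod_hom_zero[OF r1(2) r1(2) r1(3)])
    ultimately show "?\<iota> n (d2 n y) = ?D n (?\<iota> (Suc n) y)"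
      using mod_hom_closed[OF r2(3) y] by (auto simp: cone_diff_def shift_module_def F1.minus_zero_module split: nat.split)
  qed
  obtain \<alpha> where \<alpha>: "chain_map R F3 d3 ?C ?D \<alpha>" "\<And>x. x \<in> carrier (F3 0) \<Longrightarrow> ?E (\<alpha> 0 x) = e3 x"
    using chain_lift[OF M3 F3 C mod_hom_id] by blast
  \<comment> \<open>The difference of the two chain maps from \<open>F2\<close> to the cone that
    cover \<open>g\<close>. It covers zero, so cocycles on the cone pull back along it to
    coboundaries.\<close>
  let ?\<delta> = "\<lambda>n x. ?\<iota> n x \<oplus>\<^bsub>?C n\<^esub> \<ominus>\<^bsub>?C n\<^esub> \<alpha> n (\<gamma> n x)"
  have \<delta>: "chain_map R F2 d2 ?C ?D ?\<delta>"
    by (rule chain_map_diff[OF c(2) c(3) \<iota> chain_map_comp[OF \<gamma> \<alpha>(1)]])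
  have Zh: "Z \<in> mod_hom R (?C i) N" using Z by (simp add: cocyc_def)
  have "(\<lambda>x. Z (?\<delta> i x)) \<in> cobd R F2 d2 N i"
  proof (rule null_homotopic_cobd[OF M2 F2 C \<delta> _ N Z(1)])
    fix x assume x: "x \<in> carrier (F2 0)"
    have "\<gamma> 0 x \<in> carrier (F3 0)" "\<alpha> 0 (\<gamma> 0 x) \<in> carrier (?C 0)" "?\<iota> 0 x \<in> carrier (?C 0)"
      using x chain_mapD(2)[OF \<gamma>] chain_mapD(2)[OF \<alpha>(1)] chain_mapD(2)[OF \<iota>] by blast+
    note cl = this
    have "?E (?\<delta> 0 x) = ?E (?\<iota> 0 x) \<oplus>\<^bsub>M3\<^esub> \<ominus>\<^bsub>M3\<^esub> ?E (\<alpha> 0 (\<gamma> 0 x))"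
      using mod_hom_add[OF c(4) cl(3) C.a_inv_closed[OF cl(2)]] mod_hom_minus[OF c(2) M3 c(4) cl(2)] by simp
    also have "\<dots> = g (e2 x) \<oplus>\<^bsub>M3\<^esub> \<ominus>\<^bsub>M3\<^esub> g (e2 x)" using \<alpha>(2)[OF cl(1)] \<gamma>0[OF x] by simp
    also have "\<dots> = \<zero>\<^bsub>M3\<^esub>" using mod_hom_closed[OF c(4) cl(3)] by (simp add: M3.r_neg)
    finally show "?E (?\<delta> 0 x) = \<zero>\<^bsub>M3\<^esub>" .
  qed
  moreover have "Z (?\<delta> i x) = z x \<oplus>\<^bsub>N\<^esub> \<ominus>\<^bsub>N\<^esub> Z (\<alpha> i (\<gamma> i x))" if x: "x \<in> carrier (F2 i)" for x
  proof -
    have "\<gamma> i x \<in> carrier (F3 i)" "\<alpha> i (\<gamma> i x) \<in> carrier (?C i)" "?\<iota> i x \<in> carrier (?C i)"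
      using x chain_mapD(2)[OF \<gamma>] chain_mapD(2)[OF \<alpha>(1)] chain_mapD(2)[OF \<iota>] by blast+
    then show ?thesis
      using mod_hom_add[OF Zh] mod_hom_minus[OF c(2) N Zh] Z(2)[OF x] by simp
  qed
  ultimately have "(\<lambda>x. z x \<oplus>\<^bsub>N\<^esub> \<ominus>\<^bsub>N\<^esub> Z (\<alpha> i (\<gamma> i x))) \<in> cobd R F2 d2 N i"
    by (subst cobd_cong[where z' = "\<lambda>x. Z (?\<delta> i x)"]) auto
  then show ?thesis using cocyc_pullback[OF \<alpha>(1) Z(1)] by (intro bexI[of _ "\<lambda>x. Z (\<alpha> i x)"]) auto
qed

section \<open>Noetherian rings\<close>

lemma ideal_colon:
  assumes "cring R" "ideal J R" "r \<in> carrier R"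
  shows "ideal {a \<in> carrier R. a \<otimes>\<^bsub>R\<^esub> r \<in> J} R"
proof -
  interpret cring R by fact
  interpret J: ideal J R by fact
  show ?thesis
  proof (rule idealI)
    show "subgroup {a \<in> carrier R. a \<otimes>\<^bsub>R\<^esub> r \<in> J} (add_monoid R)"
    proof (rule add.subgroupI)
      fix a assume "a \<in> {a \<in> carrier R. a \<otimes>\<^bsub>R\<^esub> r \<in> J}"
      then show "\<ominus>\<^bsub>R\<^esub> a \<in> {a \<in> carrier R. a \<otimes>\<^bsub>R\<^esub> r \<in> J}"
        using assms(3) by (simp add: l_minus)
    next
      show "{a \<in> carrier R. a \<otimes>\<^bsub>R\<^esub> r \<in> J} \<noteq> {}"
        using assms(3) by (auto intro!: exI[of _ "\<zero>\<^bsub>R\<^esub>"])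
    qed (use assms(3) in \<open>auto simp: l_distr\<close>)
  next
    fix a x assume "a \<in> {a \<in> carrier R. a \<otimes>\<^bsub>R\<^esub> r \<in> J}" "x \<in> carrier R"
    then show "x \<otimes>\<^bsub>R\<^esub> a \<in> {a \<in> carrier R. a \<otimes>\<^bsub>R\<^esub> r \<in> J}"
      using assms(3) J.I_l_closed by (simp add: m_assoc)
    then show "a \<otimes>\<^bsub>R\<^esub> x \<in> {a \<in> carrier R. a \<otimes>\<^bsub>R\<^esub> r \<in> J}"
      using \<open>a \<in> _\<close> \<open>x \<in> _\<close> by (simp add: m_comm)
  qed (rule ring_axioms)
qed

text \<open>Existence of an associated prime of \<open>R / J\<close>: in a noetherian ring some
  colon ideal \<open>(J : r)\<close> with \<open>r\<close> outside \<open>J\<close> is maximal among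
  these, and maximality makes it prime.\<close>

lemma prime_colon_exists:
  assumes "cring R" "noetherian_ring R" "ideal J R" "J \<noteq> carrier R"
  shows "\<exists>r\<in>carrier R - J. primeideal {a \<in> carrier R. a \<otimes>\<^bsub>R\<^esub> r \<in> J} R"
proof -
  interpret cring R by fact
  interpret N: noetherian_ring R by fact
  interpret J: ideal J R by fact
  define colon where "colon = (\<lambda>r. {a \<in> carrier R. a \<otimes>\<^bsub>R\<^esub> r \<in> J})"
  let ?\<A> = "colon ` (carrier R - J)"
  have ideals: "?\<A> \<subseteq> {I. ideal I R}" using ideal_colon[OF assms(1,3)] by (auto simp: colon_def)
  have "?\<A> \<noteq> {}" using assms(4) J.a_subset by blast
  \<comment> \<open>A nonempty chain of ideals in a noetherian ring contains its union, so the union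
    is again a colon ideal and Zorn's lemma applies.\<close>
  moreover have "\<Union>C \<in> ?\<A>" if C: "C \<noteq> {}" "subset.chain ?\<A> C" for C
  proof -
    have "subset.chain {I. ideal I R} C" 
      using C(2) order_trans[OF _ ideals, of C] unfolding subset_chain_def by simp
    then have "\<Union>C \<in> C" by (rule N.ideal_chain_is_trivial[OF C(1)])
    then show ?thesis using C(2) unfolding subset_chain_def by blast
  qed
  ultimately have "\<exists>I\<in>?\<A>. \<forall>K\<in>?\<A>. I \<subseteq> K \<longrightarrow> K = I" by (rule subset_Zorn_nonempty)
  then obtain I where "I \<in> ?\<A>" and I: "\<forall>K\<in>?\<A>. I \<subseteq> K \<longrightarrow> K = I" ..
  then obtain r where r: "r \<in> carrier R - J" and Ir: "I = colon r" by blast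
  have max: "colon q = colon r" if "q \<in> carrier R - J" "colon r \<subseteq> colon q" for q
    using I that unfolding Ir by simp
  have "primeideal (colon r) R"
  proof (rule primeidealI)
    show "ideal (colon r) R" using ideals r by blast
    have "\<one>\<^bsub>R\<^esub> \<notin> colon r" using r by (simp add: colon_def)
    then show "carrier R \<noteq> colon r" by blast
    fix a b assume ab: "a \<in> carrier R" "b \<in> carrier R" "a \<otimes>\<^bsub>R\<^esub> b \<in> colon r"
    show "a \<in> colon r \<or> b \<in> colon r"
    proof (cases "b \<in> colon r")
      case False
      \<comment> \<open>For \<open>b\<close> outside \<open>(J : r)\<close> the multiple
        \<open>b r\<close> is outside \<open>J\<close>, and its colon ideal contains
        \<open>(J : r)\<close>. Maximality makes the two equal, and \<open>a\<close> lies in the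
        larger one.\<close>
      then have br: "b \<otimes>\<^bsub>R\<^esub> r \<in> carrier R - J" using ab r by (simp add: colon_def)
      have "x \<otimes>\<^bsub>R\<^esub> (b \<otimes>\<^bsub>R\<^esub> r) = b \<otimes>\<^bsub>R\<^esub> (x \<otimes>\<^bsub>R\<^esub> r)" if "x \<in> carrier R" for x
        using that ab r by (simp add: m_lcomm)
      then have "colon r \<subseteq> colon (b \<otimes>\<^bsub>R\<^esub> r)" using ab(2) J.I_l_closed by (auto simp: colon_def)
      then have "colon (b \<otimes>\<^bsub>R\<^esub> r) = colon r" by (rule max[OF br])
      moreover have "a \<in> colon (b \<otimes>\<^bsub>R\<^esub> r)" using ab r by (simp add: colon_def m_assoc)
      ultimately show ?thesis by simp
    qed simp
  qed (rule assms(1))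
  then show ?thesis using r unfolding colon_def by blast
qed

text \<open>Finite generation as an induction rule. The generators are obtained before the property
  is given, so denominators and multipliers can first be chosen for the finite set \<open>A\<close>
  and the result then extended to all of \<open>M\<close>.\<close>

lemma fin_gen_module_induct:
  assumes "module R M" "fin_gen_module R M"
  obtains A where "finite A" "A \<subseteq> carrier M"
    "\<And>P x. \<lbrakk>P \<zero>\<^bsub>M\<^esub>; \<And>x y. \<lbrakk>x \<in> carrier M; y \<in> carrier M; P x; P y\<rbrakk> \<Longrightarrow> P (x \<oplus>\<^bsub>M\<^esub> y);
      \<And>r x. \<lbrakk>r \<in> carrier R; x \<in> carrier M; P x\<rbrakk> \<Longrightarrow> P (r \<odot>\<^bsub>M\<^esub> x); \<And>a. a \<in> A \<Longrightarrow> P a; x \<in> carrier M\<rbrakk> \<Longrightarrow> P x"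
proof -
  interpret M: module R M by fact
  obtain A where A: "finite A" "A \<subseteq> carrier M"
    "carrier M = {\<Oplus>\<^bsub>M\<^esub>a\<in>A. c a \<odot>\<^bsub>M\<^esub> a | c. c \<in> A \<rightarrow> carrier R}"
    using assms(2) by (auto simp: fin_gen_module_def)
  show ?thesis
  proof (rule that[OF A(1,2)])
    fix P x
    assume P: "P \<zero>\<^bsub>M\<^esub>" "\<And>x y. \<lbrakk>x \<in> carrier M; y \<in> carrier M; P x; P y\<rbrakk> \<Longrightarrow> P (x \<oplus>\<^bsub>M\<^esub> y)"
      "\<And>r x. \<lbrakk>r \<in> carrier R; x \<in> carrier M; P x\<rbrakk> \<Longrightarrow> P (r \<odot>\<^bsub>M\<^esub> x)" "\<And>a. a \<in> A \<Longrightarrow> P a" and x: "x \<in> carrier M"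
    obtain c where c: "c \<in> A \<rightarrow> carrier R" "x = (\<Oplus>\<^bsub>M\<^esub>a\<in>A. c a \<odot>\<^bsub>M\<^esub> a)" using x A(3) by auto
    have "P (\<Oplus>\<^bsub>M\<^esub>a\<in>T. c a \<odot>\<^bsub>M\<^esub> a)" if T: "finite T" "T \<subseteq> A" for T
      using T
    proof (induction T rule: finite_induct)
      case (insert a T)
      have ca: "c b \<odot>\<^bsub>M\<^esub> b \<in> carrier M" if "b \<in> A" for b using that c(1) A(2) by blast
      then have "(\<Oplus>\<^bsub>M\<^esub>b\<in>insert a T. c b \<odot>\<^bsub>M\<^esub> b) = c a \<odot>\<^bsub>M\<^esub> a \<oplus>\<^bsub>M\<^esub> (\<Oplus>\<^bsub>M\<^esub>b\<in>T. c b \<odot>\<^bsub>M\<^esub> b)"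
        using insert by (intro M.finsum_insert) auto
      moreover have "(\<Oplus>\<^bsub>M\<^esub>b\<in>T. c b \<odot>\<^bsub>M\<^esub> b) \<in> carrier M"
        using ca insert.prems by (intro M.finsum_closed) auto
      moreover have "P (c a \<odot>\<^bsub>M\<^esub> a)" using insert.prems c(1) A(2) P(3,4) by blast
      ultimately show ?case using insert ca P(2) by auto
    qed (simp add: P(1))
    then show "P x" using c(2) A(1) by blast
  qed
qed

section \<open>Localization\<close>

locale mult_set = cring R for R (structure) +
  fixes S :: "'a set"
  assumes S_sub: "S \<subseteq> carrier R" and one_S: "\<one> \<in> S"
    and mult_S: "\<lbrakk>s \<in> S; t \<in> S\<rbrakk> \<Longrightarrow> s \<otimes> t \<in> S"
begin

lemma S_carrier: "s \<in> S \<Longrightarrow> s \<in> carrier R" using S_sub by blast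

text \<open>The product of witnesses for finitely many \<open>x\<close> is a common witness, as the
  property survives further multiplication by \<open>S\<close>. All common denominators below are
  found in this way.\<close>

lemma common_multiplier:
  assumes "finite X" and "\<And>x. x \<in> X \<Longrightarrow> \<exists>s\<in>S. P x s"
    and "\<And>x s t. \<lbrakk>x \<in> X; s \<in> S; t \<in> S; P x s\<rbrakk> \<Longrightarrow> P x (t \<otimes> s)"
  shows "\<exists>s\<in>S. \<forall>x\<in>X. P x s"
  using assms
proof (induction X rule: finite_induct)
  case empty
  then show ?case using one_S by blast
next
  case (insert x X)
  have "\<exists>s\<in>S. \<forall>x\<in>X. P x s"
    by (rule insert.IH) (use insert.prems in simp_all)
  moreover have "\<exists>t\<in>S. P x t" using insert.prems(1) by simp
  ultimately obtain s t where s: "s \<in> S" "\<forall>x\<in>X. P x s" "t \<in> S" "P x t" by blast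
  then have "P x (s \<otimes> t)" "\<forall>x\<in>X. P x (t \<otimes> s)" using insert.prems(2) by blast+
  moreover have "s \<otimes> t = t \<otimes> s" using s S_carrier by (simp add: m_comm)
  ultimately show ?case using mult_S[OF s(1,3)] by auto
qed

text \<open>The elements killed by some member of \<open>S\<close> form an ideal. It has finitely
  many generators, and a common multiplier that kills these kills the whole ideal.\<close>

lemma torsion_annihilator:
  assumes "noetherian_ring R"
  shows "\<exists>u\<in>S. \<forall>r\<in>carrier R. (\<exists>v\<in>S. v \<otimes> r = \<zero>) \<longrightarrow> u \<otimes> r = \<zero>"
proof -
  interpret N: noetherian_ring R by fact
  let ?I = "{r \<in> carrier R. \<exists>v\<in>S. v \<otimes> r = \<zero>}"
  have "ideal ?I R"
  proof (rule idealI)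
    show "subgroup ?I (add_monoid R)"
    proof (rule add.subgroupI)
      show "?I \<noteq> {}" using one_S S_carrier by (auto intro!: exI[of _ \<zero>] bexI[of _ \<one>])
      fix a assume "a \<in> ?I"
      then show "\<ominus> a \<in> ?I" using S_carrier by (auto simp: r_minus)
    next
      fix a b assume "a \<in> ?I" "b \<in> ?I"
      then obtain u v where uv: "u \<in> S" "u \<otimes> a = \<zero>" "v \<in> S" "v \<otimes> b = \<zero>" "a \<in> carrier R" "b \<in> carrier R" by blast
      then have c: "u \<in> carrier R" "v \<in> carrier R" using S_carrier by blast+
      have "(u \<otimes> v) \<otimes> (a \<oplus> b) = v \<otimes> (u \<otimes> a) \<oplus> u \<otimes> (v \<otimes> b)"
        using c uv(5,6) by (simp add: r_distr m_ac)
      then have "(u \<otimes> v) \<otimes> (a \<oplus> b) = \<zero>" using uv c by simp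
      then show "a \<oplus> b \<in> ?I" using mult_S[OF uv(1,3)] uv by blast
    qed auto
  next
    fix a x assume a: "a \<in> ?I" and x: "x \<in> carrier R"
    then obtain u where u: "u \<in> S" "u \<otimes> a = \<zero>" by blast
    have "u \<otimes> (x \<otimes> a) = x \<otimes> (u \<otimes> a)" using a x S_carrier[OF u(1)] by (simp add: m_lcomm)
    then show "x \<otimes> a \<in> ?I" using u a x by auto
    then show "a \<otimes> x \<in> ?I" using a x by (simp add: m_comm)
  qed (rule ring_axioms)
  from N.finetely_gen[OF this] obtain A where A: "A \<subseteq> carrier R" "finite A" "?I = Idl A" by auto
  have AI: "A \<subseteq> ?I" using genideal_self[OF A(1)] A(3) by simp
  have "\<exists>u\<in>S. \<forall>a\<in>A. u \<otimes> a = \<zero>"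
  proof (rule common_multiplier[OF A(2)])
    fix x s t assume "x \<in> A" "s \<in> S" "t \<in> S" "s \<otimes> x = \<zero>"
    then show "(t \<otimes> s) \<otimes> x = \<zero>" using S_carrier A(1) by (auto simp: m_assoc subset_iff)
  qed (use AI in blast)
  then obtain u where u: "u \<in> S" "\<forall>a\<in>A. u \<otimes> a = \<zero>" by blast
  \<comment> \<open>The annihilator of \<open>u\<close>, written as a colon ideal of zero so that
    \<open>ideal_colon\<close> applies. Since it contains \<open>A\<close>, it contains the ideal
    generated by \<open>A\<close>.\<close>
  have "ideal {a \<in> carrier R. a \<otimes> u \<in> {\<zero>}} R" by (rule ideal_colon[OF is_cring zeroideal S_carrier[OF u(1)]])
  moreover have "A \<subseteq> {a \<in> carrier R. a \<otimes> u \<in> {\<zero>}}"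
    using u A(1) S_carrier by (auto simp: m_comm subset_iff)
  ultimately have "?I \<subseteq> {a \<in> carrier R. a \<otimes> u \<in> {\<zero>}}" unfolding A(3) by (rule genideal_minimal)
  then have "\<forall>r\<in>carrier R. (\<exists>v\<in>S. v \<otimes> r = \<zero>) \<longrightarrow> u \<otimes> r = \<zero>"
    using S_carrier[OF u(1)] by (auto simp: m_comm)
  then show ?thesis using u(1) by blast
qed

section \<open>Fractions and their operations\<close>

lemma frac_rel_iff: "((x, s), (y, t)) \<in> frac_rel S M \<longleftrightarrow> x \<in> carrier M \<and> s \<in> S \<and> y \<in> carrier M \<and> t \<in> S \<and>
     (\<exists>u\<in>S. u \<odot>\<^bsub>M\<^esub> (t \<odot>\<^bsub>M\<^esub> x) = u \<odot>\<^bsub>M\<^esub> (s \<odot>\<^bsub>M\<^esub> y))"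
  by (simp add: frac_rel_def)

lemma frac_rel_equiv:
  assumes "module R M" shows "equiv (carrier M \<times> S) (frac_rel S M)"
proof -
  interpret M: module R M by fact
  show ?thesis
  proof (rule equivI)
    show "frac_rel S M \<subseteq> (carrier M \<times> S) \<times> (carrier M \<times> S)" by (auto simp: frac_rel_def)
    show "refl_on (carrier M \<times> S) (frac_rel S M)"
      using one_S by (auto simp: refl_on_def frac_rel_iff)
    show "sym (frac_rel S M)" unfolding sym_def by (auto simp: frac_rel_iff) metis
    show "trans (frac_rel S M)"
    proof (rule transI)
      fix p q r assume pq: "(p, q) \<in> frac_rel S M" "(q, r) \<in> frac_rel S M"
      obtain x s y t z w where p: "p = (x, s)" "q = (y, t)" "r = (z, w)" by (metis surj_pair)
      from pq obtain u v where c: "x \<in> carrier M" "s \<in> S" "y \<in> carrier M" "t \<in> S" "z \<in> carrier M" "w \<in> S" "u \<in> S" "v \<in> S"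
        and eq: "u \<odot>\<^bsub>M\<^esub> (t \<odot>\<^bsub>M\<^esub> x) = u \<odot>\<^bsub>M\<^esub> (s \<odot>\<^bsub>M\<^esub> y)" "v \<odot>\<^bsub>M\<^esub> (w \<odot>\<^bsub>M\<^esub> y) = v \<odot>\<^bsub>M\<^esub> (t \<odot>\<^bsub>M\<^esub> z)"
        unfolding p frac_rel_iff by blast
      have R: "s \<in> carrier R" "t \<in> carrier R" "w \<in> carrier R" "u \<in> carrier R" "v \<in> carrier R" using c S_carrier by blast+
      \<comment> \<open>The middle denominator \<open>t\<close> has to be part of the multiplier: it
        is needed to compare both outer fractions with \<open>y\<close>, and it cannot be cancelled
        afterwards.\<close>
      have "(u \<otimes> v \<otimes> t) \<odot>\<^bsub>M\<^esub> (w \<odot>\<^bsub>M\<^esub> x) = (v \<otimes> w) \<odot>\<^bsub>M\<^esub> (u \<odot>\<^bsub>M\<^esub> (t \<odot>\<^bsub>M\<^esub> x))"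
        using R c by (simp add: M.smult_assoc1[symmetric] m_ac)
      also have "\<dots> = (u \<otimes> s) \<odot>\<^bsub>M\<^esub> (v \<odot>\<^bsub>M\<^esub> (w \<odot>\<^bsub>M\<^esub> y))"
        unfolding eq(1) using R c by (simp add: M.smult_assoc1[symmetric] m_ac)
      also have "\<dots> = (u \<otimes> v \<otimes> t) \<odot>\<^bsub>M\<^esub> (s \<odot>\<^bsub>M\<^esub> z)"
        unfolding eq(2) using R c by (simp add: M.smult_assoc1[symmetric] m_ac)
      finally show "(p, r) \<in> frac_rel S M" unfolding p frac_rel_iff using c mult_S by blast
    qed
  qed
qed

lemma fraction_eq_iff:
  assumes "module R M" "x \<in> carrier M" "y \<in> carrier M" "s \<in> S" "t \<in> S"
  shows "fraction S M x s = fraction S M y t \<longleftrightarrow> (\<exists>u\<in>S. u \<odot>\<^bsub>M\<^esub> (t \<odot>\<^bsub>M\<^esub> x) = u \<odot>\<^bsub>M\<^esub> (s \<odot>\<^bsub>M\<^esub> y))"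
  unfolding fraction_def using assms
  by (subst eq_equiv_class_iff[OF frac_rel_equiv[OF assms(1)]]) (auto simp: frac_rel_iff)

text \<open>Independence of representatives collapses the unions in \<open>loc_module\<close> to
  single fractions. If \<open>u\<close> and \<open>v\<close> witness the equality of the summands,
  then \<open>u \<otimes> v\<close> witnesses that of the sums.\<close>

lemma fraction_add_respects:
  assumes "module R M"
  shows "(\<lambda>(x, s) (y, t). fraction S M (t \<odot>\<^bsub>M\<^esub> x \<oplus>\<^bsub>M\<^esub> s \<odot>\<^bsub>M\<^esub> y) (s \<otimes> t)) respects2 frac_rel S M"
proof -
  interpret M: module R M by fact
  show ?thesis
  proof (rule congruent2I')
    fix p p' q q' assume pq: "(p, p') \<in> frac_rel S M" "(q, q') \<in> frac_rel S M"
    obtain x s x' s' y t y' t' where p: "p = (x, s)" "p' = (x', s')" "q = (y, t)" "q' = (y', t')" by (metis surj_pair)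
    from pq obtain u v where c: "x \<in> carrier M" "s \<in> S" "x' \<in> carrier M" "s' \<in> S" "y \<in> carrier M" "t \<in> S" "y' \<in> carrier M" "t' \<in> S" "u \<in> S" "v \<in> S"
      and eq: "u \<odot>\<^bsub>M\<^esub> (s' \<odot>\<^bsub>M\<^esub> x) = u \<odot>\<^bsub>M\<^esub> (s \<odot>\<^bsub>M\<^esub> x')" "v \<odot>\<^bsub>M\<^esub> (t' \<odot>\<^bsub>M\<^esub> y) = v \<odot>\<^bsub>M\<^esub> (t \<odot>\<^bsub>M\<^esub> y')"
      unfolding p frac_rel_iff by blast
    have R: "s \<in> carrier R" "t \<in> carrier R" "s' \<in> carrier R" "t' \<in> carrier R" "u \<in> carrier R" "v \<in> carrier R"
      using c S_carrier by blast+
    have "(u \<otimes> v) \<odot>\<^bsub>M\<^esub> ((s' \<otimes> t') \<odot>\<^bsub>M\<^esub> (t \<odot>\<^bsub>M\<^esub> x \<oplus>\<^bsub>M\<^esub> s \<odot>\<^bsub>M\<^esub> y)) =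
        (v \<otimes> t' \<otimes> t) \<odot>\<^bsub>M\<^esub> (u \<odot>\<^bsub>M\<^esub> (s' \<odot>\<^bsub>M\<^esub> x)) \<oplus>\<^bsub>M\<^esub> (u \<otimes> s' \<otimes> s) \<odot>\<^bsub>M\<^esub> (v \<odot>\<^bsub>M\<^esub> (t' \<odot>\<^bsub>M\<^esub> y))"
      using R c by (simp add: M.smult_r_distr M.smult_assoc1[symmetric] m_ac)
    also have "\<dots> = (u \<otimes> v) \<odot>\<^bsub>M\<^esub> ((s \<otimes> t) \<odot>\<^bsub>M\<^esub> (t' \<odot>\<^bsub>M\<^esub> x' \<oplus>\<^bsub>M\<^esub> s' \<odot>\<^bsub>M\<^esub> y'))"
      unfolding eq using R c by (simp add: M.smult_r_distr M.smult_assoc1[symmetric] m_ac)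
    finally show "(case p of (x, s) \<Rightarrow> \<lambda>(y, t). fraction S M (t \<odot>\<^bsub>M\<^esub> x \<oplus>\<^bsub>M\<^esub> s \<odot>\<^bsub>M\<^esub> y) (s \<otimes> t)) q =
       (case p' of (x, s) \<Rightarrow> \<lambda>(y, t). fraction S M (t \<odot>\<^bsub>M\<^esub> x \<oplus>\<^bsub>M\<^esub> s \<odot>\<^bsub>M\<^esub> y) (s \<otimes> t)) q'"
      unfolding p prod.case using c R mult_S by (subst fraction_eq_iff[OF assms]) (auto intro: bexI[of _ "u \<otimes> v"])
  qed
qed

lemma fraction_smult_respects:
  assumes "module R M"
  shows "congruent2 (frac_rel S (ring_as_module R)) (frac_rel S M)
    (\<lambda>(a, s) (y, t). fraction S M (a \<odot>\<^bsub>M\<^esub> y) (s \<otimes> t))"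
proof -
  interpret M: module R M by fact
  show ?thesis
  proof (rule congruent2I')
    fix p p' q q' assume pq: "(p, p') \<in> frac_rel S (ring_as_module R)" "(q, q') \<in> frac_rel S M"
    obtain x s x' s' y t y' t' where p: "p = (x, s)" "p' = (x', s')" "q = (y, t)" "q' = (y', t')" by (metis surj_pair)
    from pq obtain u v where c: "x \<in> carrier R" "s \<in> S" "x' \<in> carrier R" "s' \<in> S" "y \<in> carrier M" "t \<in> S" "y' \<in> carrier M" "t' \<in> S" "u \<in> S" "v \<in> S"
      and eq: "u \<otimes> (s' \<otimes> x) = u \<otimes> (s \<otimes> x')" "v \<odot>\<^bsub>M\<^esub> (t' \<odot>\<^bsub>M\<^esub> y) = v \<odot>\<^bsub>M\<^esub> (t \<odot>\<^bsub>M\<^esub> y')"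
      unfolding p frac_rel_iff by (auto simp: ring_as_module_def)
    have R: "s \<in> carrier R" "t \<in> carrier R" "s' \<in> carrier R" "t' \<in> carrier R" "u \<in> carrier R" "v \<in> carrier R"
      using c S_carrier by blast+
    have "(u \<otimes> v) \<odot>\<^bsub>M\<^esub> ((s' \<otimes> t') \<odot>\<^bsub>M\<^esub> (x \<odot>\<^bsub>M\<^esub> y)) = (u \<otimes> (s' \<otimes> x)) \<odot>\<^bsub>M\<^esub> (v \<odot>\<^bsub>M\<^esub> (t' \<odot>\<^bsub>M\<^esub> y))"
      using R c by (simp add: M.smult_assoc1[symmetric] m_ac)
    also have "\<dots> = (u \<otimes> v) \<odot>\<^bsub>M\<^esub> ((s \<otimes> t) \<odot>\<^bsub>M\<^esub> (x' \<odot>\<^bsub>M\<^esub> y'))"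
      unfolding eq using R c by (simp add: M.smult_assoc1[symmetric] m_ac)
    finally show "(case p of (a, s) \<Rightarrow> \<lambda>(y, t). fraction S M (a \<odot>\<^bsub>M\<^esub> y) (s \<otimes> t)) q =
       (case p' of (a, s) \<Rightarrow> \<lambda>(y, t). fraction S M (a \<odot>\<^bsub>M\<^esub> y) (s \<otimes> t)) q'"
      unfolding p prod.case using c R mult_S by (subst fraction_eq_iff[OF assms]) (auto intro: bexI[of _ "u \<otimes> v"])
  qed
qed

lemma loc_module_add:
  assumes "module R M" "x \<in> carrier M" "y \<in> carrier M" "s \<in> S" "t \<in> S"
  shows "fraction S M x s \<oplus>\<^bsub>loc_module R S M\<^esub> fraction S M y t =
    fraction S M (t \<odot>\<^bsub>M\<^esub> x \<oplus>\<^bsub>M\<^esub> s \<odot>\<^bsub>M\<^esub> y) (s \<otimes> t)"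
  using UN_equiv_class2[OF frac_rel_equiv frac_rel_equiv fraction_add_respects, OF assms(1,1,1), of "(x, s)" "(y, t)"] assms
  by (simp add: loc_module_def Let_def fraction_def[of S M x s] fraction_def[of S M y t] case_prod_unfold)

lemma loc_module_smult:
  assumes "module R M" "a \<in> carrier R" "y \<in> carrier M" "s \<in> S" "t \<in> S"
  shows "fraction S (ring_as_module R) a s \<odot>\<^bsub>loc_module R S M\<^esub> fraction S M y t = fraction S M (a \<odot>\<^bsub>M\<^esub> y) (s \<otimes> t)"
  using UN_equiv_class2[OF frac_rel_equiv frac_rel_equiv fraction_smult_respects,
      OF ring_as_module_module[OF is_cring] assms(1,1), of "(a, s)" "(y, t)"] assms
  by (simp add: loc_module_def Let_def fraction_def[of S _ a s] fraction_def[of S M y t] case_prod_unfold)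

text \<open>The addition of \<open>loc_ring\<close> is the same term as that of \<open>R\<close>
  localized as a module over itself, so the rule for modules transfers. Multiplication is treated
  alike, as the scalar multiplication of that module.\<close>

lemma loc_ring_add:
  assumes "a \<in> carrier R" "b \<in> carrier R" "s \<in> S" "t \<in> S"
  shows "fraction S (ring_as_module R) a s \<oplus>\<^bsub>loc_ring R S\<^esub> fraction S (ring_as_module R) b t =
    fraction S (ring_as_module R) (t \<otimes> a \<oplus> s \<otimes> b) (s \<otimes> t)"
proof -
  have "ring.add (loc_ring R S) = ring.add (loc_module R S (ring_as_module R))"
    by (simp add: loc_ring_def loc_module_def Let_def ring_as_module_def)
  then show ?thesis
    using loc_module_add[OF ring_as_module_module[OF is_cring], of a b s t] assms by (simp add: ring_as_module_def)
qed

lemma loc_ring_mult: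
  assumes "a \<in> carrier R" "b \<in> carrier R" "s \<in> S" "t \<in> S"
  shows "fraction S (ring_as_module R) a s \<otimes>\<^bsub>loc_ring R S\<^esub> fraction S (ring_as_module R) b t =
    fraction S (ring_as_module R) (a \<otimes> b) (s \<otimes> t)"
proof -
  have "monoid.mult (loc_ring R S) = smult (loc_module R S (ring_as_module R))"
    by (simp add: loc_ring_def loc_module_def Let_def ring_as_module_def)
  then show ?thesis
    using loc_module_smult[OF ring_as_module_module[OF is_cring], of a b s t] assms by (simp add: ring_as_module_def)
qed


section \<open>The localization map and clearing denominators\<close>

abbreviation to_loc :: "('a, 'm, 'y) module_scheme \<Rightarrow> 'm \<Rightarrow> ('m \<times> 'a) set"
  where "to_loc M x \<equiv> fraction S M x \<one>"

abbreviation to_loc_ring :: "'a \<Rightarrow> ('a \<times> 'a) set"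
  where "to_loc_ring a \<equiv> fraction S (ring_as_module R) a \<one>"

lemma carrier_loc_module: "carrier (loc_module R S M) = {fraction S M x s | x s. x \<in> carrier M \<and> s \<in> S}"
  by (auto simp: loc_module_def Let_def quotient_def fraction_def)

lemma carrier_loc_ring:
  "carrier (loc_ring R S) = {fraction S (ring_as_module R) a s | a s. a \<in> carrier R \<and> s \<in> S}"
  by (auto simp: loc_ring_def Let_def quotient_def fraction_def)

context
  fixes M :: "('a, 'm, 'y) module_scheme"
  assumes M: "module R M"
begin

interpretation M: module R M by (rule M)

lemma to_loc_closed: "x \<in> carrier M \<Longrightarrow> to_loc M x \<in> carrier (loc_module R S M)"
  unfolding carrier_loc_module using one_S by blast

lemma to_loc_add:
  "x \<in> carrier M \<Longrightarrow> y \<in> carrier M \<Longrightarrow> to_loc M (x \<oplus>\<^bsub>M\<^esub> y) = to_loc M x \<oplus>\<^bsub>loc_module R S M\<^esub> to_loc M y"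
  by (simp add: loc_module_add[OF M] one_S)

lemma to_loc_smult:
  "a \<in> carrier R \<Longrightarrow> x \<in> carrier M \<Longrightarrow>
    to_loc M (a \<odot>\<^bsub>M\<^esub> x) = to_loc_ring a \<odot>\<^bsub>loc_module R S M\<^esub> to_loc M x"
  by (simp add: loc_module_smult[OF M] one_S)

lemma to_loc_zero: "to_loc M \<zero>\<^bsub>M\<^esub> = \<zero>\<^bsub>loc_module R S M\<^esub>"
  by (simp add: loc_module_def Let_def)

lemma to_loc_eq_iff:
  "x \<in> carrier M \<Longrightarrow> y \<in> carrier M \<Longrightarrow> to_loc M x = to_loc M y \<longleftrightarrow> (\<exists>u\<in>S. u \<odot>\<^bsub>M\<^esub> x = u \<odot>\<^bsub>M\<^esub> y)"
  by (simp add: fraction_eq_iff[OF M] one_S)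

lemma clear_denominator:
  assumes "X \<in> carrier (loc_module R S M)"
  shows "\<exists>s\<in>S. \<exists>x\<in>carrier M. to_loc_ring s \<odot>\<^bsub>loc_module R S M\<^esub> X = to_loc M x"
proof -
  obtain x s where x: "x \<in> carrier M" "s \<in> S" "X = fraction S M x s"
    using assms unfolding carrier_loc_module by blast
  have "to_loc_ring s \<odot>\<^bsub>loc_module R S M\<^esub> X = fraction S M (s \<odot>\<^bsub>M\<^esub> x) s"
    using x S_carrier one_S by (simp add: loc_module_smult[OF M])
  also have "\<dots> = to_loc M x"
    using x S_carrier one_S by (subst fraction_eq_iff[OF M]) auto
  finally show ?thesis using x by blast
qed

end

lemma to_loc_ring_closed: "a \<in> carrier R \<Longrightarrow> to_loc_ring a \<in> carrier (loc_ring R S)"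
  unfolding carrier_loc_ring using one_S by blast

lemma to_loc_ring_add:
  "a \<in> carrier R \<Longrightarrow> b \<in> carrier R \<Longrightarrow> to_loc_ring (a \<oplus> b) = to_loc_ring a \<oplus>\<^bsub>loc_ring R S\<^esub> to_loc_ring b"
  by (simp add: loc_ring_add one_S)

lemma to_loc_ring_mult:
  "a \<in> carrier R \<Longrightarrow> b \<in> carrier R \<Longrightarrow> to_loc_ring (a \<otimes> b) = to_loc_ring a \<otimes>\<^bsub>loc_ring R S\<^esub> to_loc_ring b"
  by (simp add: loc_ring_mult one_S)

lemma to_loc_ring_zero: "to_loc_ring \<zero> = \<zero>\<^bsub>loc_ring R S\<^esub>"
  by (simp add: loc_ring_def Let_def)

lemma to_loc_ring_eq_iff:
  "a \<in> carrier R \<Longrightarrow> b \<in> carrier R \<Longrightarrow> to_loc_ring a = to_loc_ring b \<longleftrightarrow> (\<exists>u\<in>S. u \<otimes> a = u \<otimes> b)"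
  using to_loc_eq_iff[OF ring_as_module_module[OF is_cring], of a b] by simp

lemma clear_denominator_ring:
  assumes "q \<in> carrier (loc_ring R S)"
  shows "\<exists>s\<in>S. \<exists>a\<in>carrier R. to_loc_ring s \<otimes>\<^bsub>loc_ring R S\<^esub> q = to_loc_ring a"
proof -
  obtain a s where a: "a \<in> carrier R" "s \<in> S" "q = fraction S (ring_as_module R) a s"
    using assms unfolding carrier_loc_ring by blast
  have "to_loc_ring s \<otimes>\<^bsub>loc_ring R S\<^esub> q = fraction S (ring_as_module R) (s \<otimes> a) s"
    using a S_carrier one_S by (simp add: loc_ring_mult)
  also have "\<dots> = to_loc_ring a"
    using a S_carrier one_S by (subst fraction_eq_iff[OF ring_as_module_module[OF is_cring]]) auto
  finally show ?thesis using a by blast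
qed

text \<open>Equality of \<open>a / 1\<close> and \<open>b / 1\<close> is witnessed by a multiplier
  that depends on \<open>a\<close> and \<open>b\<close>. It kills their difference, so
  \<open>torsion_annihilator\<close> provides one multiplier for all pairs.\<close>

lemma to_loc_ring_uniform:
  assumes "noetherian_ring R"
  shows "\<exists>u\<in>S. \<forall>a\<in>carrier R. \<forall>b\<in>carrier R. to_loc_ring a = to_loc_ring b \<longrightarrow> u \<otimes> a = u \<otimes> b"
proof -
  obtain u where u: "u \<in> S" and kill: "\<And>r v. r \<in> carrier R \<Longrightarrow> v \<in> S \<Longrightarrow> v \<otimes> r = \<zero> \<Longrightarrow> u \<otimes> r = \<zero>"
    using torsion_annihilator[OF assms] by blast
  have eq: "w \<otimes> a = w \<otimes> b \<longleftrightarrow> w \<otimes> (a \<ominus> b) = \<zero>"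
    if "w \<in> carrier R" "a \<in> carrier R" "b \<in> carrier R" for w a b
    using that by (simp add: minus_eq r_distr r_minus r_right_minus_eq[unfolded minus_eq])
  have "u \<otimes> a = u \<otimes> b" if ab: "a \<in> carrier R" "b \<in> carrier R" and loc: "to_loc_ring a = to_loc_ring b" for a b
  proof -
    obtain v where v: "v \<in> S" "v \<otimes> a = v \<otimes> b" using loc ab by (auto simp: to_loc_ring_eq_iff)
    have "v \<otimes> (a \<ominus> b) = \<zero>" using v(2) eq[OF S_carrier[OF v(1)] ab] by simp
    then have "u \<otimes> (a \<ominus> b) = \<zero>" using kill[OF minus_closed[OF ab] v(1)] by simp
    then show ?thesis using eq[OF S_carrier[OF u] ab] by simp
  qed
  then show ?thesis using u by blast
qed

lemma to_loc_finsum: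
  assumes M: "module R M" and MS: "abelian_group (loc_module R S M)" and "finite T" "w \<in> T \<rightarrow> carrier M"
  shows "to_loc M (\<Oplus>\<^bsub>M\<^esub>t\<in>T. w t) = (\<Oplus>\<^bsub>loc_module R S M\<^esub>t\<in>T. to_loc M (w t))"
proof -
  interpret M: module R M by fact
  interpret MS: abelian_group "loc_module R S M" by fact
  show ?thesis using assms(3,4)
  proof (induction T rule: finite_induct)
    case empty
    show ?case by (simp add: to_loc_zero[OF M])
  next
    case (insert t T)
    then have "to_loc M (\<Oplus>\<^bsub>M\<^esub>t\<in>insert t T. w t) = to_loc M (w t) \<oplus>\<^bsub>loc_module R S M\<^esub> to_loc M (\<Oplus>\<^bsub>M\<^esub>t\<in>T. w t)"
      by (subst M.finsum_insert) (auto simp: to_loc_add[OF M])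
    also have "\<dots> = (\<Oplus>\<^bsub>loc_module R S M\<^esub>t\<in>insert t T. to_loc M (w t))"
      using insert to_loc_closed[OF M] by (subst MS.finsum_insert) (auto simp: Pi_iff)
    finally show ?case .
  qed
qed

end

section \<open>Splitting a cover of a locally free module up to a denominator\<close>

context mult_set
begin

text \<open>Expand \<open>x / 1\<close> in a basis of the localization. The coordinates of \<open>x\<close> become elements \<open>\<rho> b x\<close> of \<open>R\<close> after
  multiplication by one common denominator \<open>t\<close>, but only up to elements that vanish in the localization. As
  \<open>R\<close> is noetherian, one \<open>u\<close> kills all of these, so that \<open>\<psi> b x = u \<rho> b x\<close> is linear in \<open>x\<close>.\<close>

lemma local_section:
  assumes noeth: "noetherian_ring R" and M: "module R M" and fg: "fin_gen_module R M"
    and free: "free_module (loc_ring R S) (loc_module R S M)"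
    and F: "module R F" and e: "e \<in> mod_hom R F M" and surj: "e ` carrier F = carrier M"
  shows "\<exists>s\<in>S. \<exists>\<sigma>\<in>mod_hom R M F. \<forall>x\<in>carrier M. e (\<sigma> x) = s \<odot>\<^bsub>M\<^esub> x"
proof -
  let ?Q = "loc_ring R S" and ?MS = "loc_module R S M"
  interpret M: module R M by fact
  interpret F: module R F by fact
  have MS: "module ?Q ?MS" using free by (simp add: free_module_def)
  interpret MS: module ?Q ?MS by (rule MS)
  obtain X where X: "X \<subseteq> carrier ?MS" "bij_betw (lin_comb ?Q ?MS (\<lambda>b. b)) (fin_coeffs ?Q X) (carrier ?MS)"
    using free by (auto simp: free_module_def module_basis_def)
  let ?L = "lin_comb ?Q ?MS (\<lambda>b. b)"
  have idX: "(\<lambda>b. b) \<in> X \<rightarrow> carrier ?MS" using X(1) by auto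
  have mF: "module ?Q (fin_module ?Q X)" by (rule fin_module_module[OF MS.R.is_cring])
  have cF: "carrier (fin_module ?Q X) = fin_coeffs ?Q X" by (simp add: fin_module_def)
  define co where "co = inv_into (carrier (fin_module ?Q X)) ?L"
  have co: "co \<in> mod_hom ?Q ?MS (fin_module ?Q X)"
    unfolding co_def by (rule mod_hom_inv_into[OF mF lin_comb_hom[OF MS idX]]) (use X(2) cF in simp)
  have Lco: "?L (co y) = y" if "y \<in> carrier ?MS" for y
    using X(2) that unfolding co_def cF by (simp add: bij_betw_def f_inv_into_f)
  note jc = to_loc_closed[OF M] and jadd = to_loc_add[OF M] and jsm = to_loc_smult[OF M]
  note ic = to_loc_ring_closed
  define c where "c = (\<lambda>x. co (to_loc M x))"
  have cfin: "c x \<in> fin_coeffs ?Q X" if "x \<in> carrier M" for x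
    using mod_hom_closed[OF co jc[OF that]] by (simp add: c_def cF)
  have cc: "c x b \<in> carrier ?Q" if "x \<in> carrier M" for x b
    by (rule fin_coeffs_closed[OF MS.R.is_cring cfin[OF that]])
  have c_add: "c (x \<oplus>\<^bsub>M\<^esub> y) b = c x b \<oplus>\<^bsub>?Q\<^esub> c y b" if "x \<in> carrier M" "y \<in> carrier M" for x y b
    using that jc mod_hom_add[OF co] by (simp add: c_def jadd) (simp add: fin_module_def)
  have c_smult: "c (r \<odot>\<^bsub>M\<^esub> x) b = to_loc_ring r \<otimes>\<^bsub>?Q\<^esub> c x b" if "r \<in> carrier R" "x \<in> carrier M" for r x b
    using that jc ic mod_hom_smult[OF co] by (simp add: c_def jsm) (simp add: fin_module_def)
  have c_zero: "c \<zero>\<^bsub>M\<^esub> b = \<zero>\<^bsub>?Q\<^esub>" for b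
    using mod_hom_zero[OF MS mF co] by (simp add: c_def to_loc_zero[OF M]) (simp add: fin_module_def)
  obtain A where A: "finite A" "A \<subseteq> carrier M"
    and Aind: "\<And>P x. \<lbrakk>P \<zero>\<^bsub>M\<^esub>; \<And>x y. \<lbrakk>x \<in> carrier M; y \<in> carrier M; P x; P y\<rbrakk> \<Longrightarrow> P (x \<oplus>\<^bsub>M\<^esub> y);
      \<And>r x. \<lbrakk>r \<in> carrier R; x \<in> carrier M; P x\<rbrakk> \<Longrightarrow> P (r \<odot>\<^bsub>M\<^esub> x); \<And>a. a \<in> A \<Longrightarrow> P a; x \<in> carrier M\<rbrakk> \<Longrightarrow> P x"
    by (rule fin_gen_module_induct[OF M fg]) blast
  have AM: "a \<in> carrier M" if "a \<in> A" for a using that A(2) by blast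
  \<comment> \<open>The basis elements that occur in the coordinates of some generator. There are
    finitely many, and by linearity no others occur in the coordinates of any \<open>x\<close>, so
    all sums below run over one finite set.\<close>
  define B where "B = (\<Union>a\<in>A. {b. c a b \<noteq> \<zero>\<^bsub>?Q\<^esub>})"
  have B: "finite B" "B \<subseteq> X" using A cfin[OF AM] by (auto simp: B_def fin_coeffs_def)
  have c_out: "c x b = \<zero>\<^bsub>?Q\<^esub>" if "x \<in> carrier M" "b \<notin> B" for x b
    using _ _ _ _ that(1)
  proof (rule Aind)
    fix a assume "a \<in> A" then show "c a b = \<zero>\<^bsub>?Q\<^esub>" using that(2) by (auto simp: B_def)
  qed (simp_all add: c_zero c_add c_smult ic)
  \<comment> \<open>The generators have finitely many coordinates at elements of \<open>B\<close>,
    so one denominator \<open>t\<close> clears them all.\<close>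
  have "\<exists>t\<in>S. \<forall>p\<in>A \<times> B. to_loc_ring t \<otimes>\<^bsub>?Q\<^esub> c (fst p) (snd p) \<in> to_loc_ring ` carrier R"
  proof (rule common_multiplier)
    fix p assume "p \<in> A \<times> B"
    then have "c (fst p) (snd p) \<in> carrier ?Q" using cc AM by auto
    from clear_denominator_ring[OF this]
    show "\<exists>t\<in>S. to_loc_ring t \<otimes>\<^bsub>?Q\<^esub> c (fst p) (snd p) \<in> to_loc_ring ` carrier R" by blast
  next
    fix p s t assume p: "p \<in> A \<times> B" and st: "s \<in> S" "t \<in> S"
      and "to_loc_ring s \<otimes>\<^bsub>?Q\<^esub> c (fst p) (snd p) \<in> to_loc_ring ` carrier R"
    then obtain r where r: "r \<in> carrier R" "to_loc_ring s \<otimes>\<^bsub>?Q\<^esub> c (fst p) (snd p) = to_loc_ring r" by blast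
    have "c (fst p) (snd p) \<in> carrier ?Q" using p cc AM by auto
    then have "to_loc_ring (t \<otimes> s) \<otimes>\<^bsub>?Q\<^esub> c (fst p) (snd p) = to_loc_ring (t \<otimes> r)"
      using r st S_carrier ic by (simp add: to_loc_ring_mult MS.R.m_assoc)
    then show "to_loc_ring (t \<otimes> s) \<otimes>\<^bsub>?Q\<^esub> c (fst p) (snd p) \<in> to_loc_ring ` carrier R"
      using r st S_carrier by blast
  qed (use A B in simp)
  then obtain t where t: "t \<in> S" "\<And>a b. a \<in> A \<Longrightarrow> b \<in> B \<Longrightarrow> to_loc_ring t \<otimes>\<^bsub>?Q\<^esub> c a b \<in> to_loc_ring ` carrier R"
    by auto
  have tR: "t \<in> carrier R" by (rule S_carrier[OF t(1)])
  have t0: "to_loc_ring t \<otimes>\<^bsub>?Q\<^esub> \<zero>\<^bsub>?Q\<^esub> = to_loc_ring \<zero>" using ic[OF tR] by (simp add: to_loc_ring_zero)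
  \<comment> \<open>Linearity carries the clearing by \<open>t\<close> from the generators to all of
    \<open>M\<close>. Coordinates outside \<open>B\<close> are zero.\<close>
  have tall: "\<exists>r\<in>carrier R. to_loc_ring r = to_loc_ring t \<otimes>\<^bsub>?Q\<^esub> c x b" if "x \<in> carrier M" for x b
    using _ _ _ _ that
  proof (rule Aind)
    show "\<exists>r\<in>carrier R. to_loc_ring r = to_loc_ring t \<otimes>\<^bsub>?Q\<^esub> c \<zero>\<^bsub>M\<^esub> b"
      unfolding c_zero t0 by blast
  next
    fix x y assume xy: "x \<in> carrier M" "y \<in> carrier M"
      and 1: "\<exists>r\<in>carrier R. to_loc_ring r = to_loc_ring t \<otimes>\<^bsub>?Q\<^esub> c x b"
      and 2: "\<exists>r\<in>carrier R. to_loc_ring r = to_loc_ring t \<otimes>\<^bsub>?Q\<^esub> c y b"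
    from 1 obtain r where r: "r \<in> carrier R" "to_loc_ring r = to_loc_ring t \<otimes>\<^bsub>?Q\<^esub> c x b" ..
    from 2 obtain r' where r': "r' \<in> carrier R" "to_loc_ring r' = to_loc_ring t \<otimes>\<^bsub>?Q\<^esub> c y b" ..
    have "to_loc_ring (r \<oplus> r') = to_loc_ring t \<otimes>\<^bsub>?Q\<^esub> c (x \<oplus>\<^bsub>M\<^esub> y) b"
      using r r' xy cc ic[OF tR] by (simp add: to_loc_ring_add c_add MS.R.r_distr)
    then show "\<exists>r\<in>carrier R. to_loc_ring r = to_loc_ring t \<otimes>\<^bsub>?Q\<^esub> c (x \<oplus>\<^bsub>M\<^esub> y) b"
      using r(1) r'(1) by (intro bexI[of _ "r \<oplus> r'"]) simp_all
  next
    fix q x assume x: "q \<in> carrier R" "x \<in> carrier M" and 1: "\<exists>r\<in>carrier R. to_loc_ring r = to_loc_ring t \<otimes>\<^bsub>?Q\<^esub> c x b"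
    from 1 obtain r where r: "r \<in> carrier R" "to_loc_ring r = to_loc_ring t \<otimes>\<^bsub>?Q\<^esub> c x b" ..
    have "to_loc_ring (q \<otimes> r) = to_loc_ring t \<otimes>\<^bsub>?Q\<^esub> c (q \<odot>\<^bsub>M\<^esub> x) b"
      using r x(1,2) cc ic[OF tR] ic[OF x(1)] by (simp add: to_loc_ring_mult c_smult MS.R.m_lcomm)
    then show "\<exists>r\<in>carrier R. to_loc_ring r = to_loc_ring t \<otimes>\<^bsub>?Q\<^esub> c (q \<odot>\<^bsub>M\<^esub> x) b"
      using r(1) x(1) by (intro bexI[of _ "q \<otimes> r"]) simp_all
  next
    fix a assume a: "a \<in> A"
    show "\<exists>r\<in>carrier R. to_loc_ring r = to_loc_ring t \<otimes>\<^bsub>?Q\<^esub> c a b"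
    proof (cases "b \<in> B")
      case True
      from t(2)[OF a True] obtain r where "to_loc_ring t \<otimes>\<^bsub>?Q\<^esub> c a b = to_loc_ring r" "r \<in> carrier R" ..
      then show ?thesis by (intro bexI[of _ r]) simp_all
    next
      case False
      then show ?thesis unfolding c_out[OF AM[OF a] False] t0 by blast
    qed
  qed
  define \<rho> where "\<rho> = (\<lambda>b x. SOME r. r \<in> carrier R \<and> to_loc_ring r = to_loc_ring t \<otimes>\<^bsub>?Q\<^esub> c x b)"
  have \<rho>: "\<rho> b x \<in> carrier R" "to_loc_ring (\<rho> b x) = to_loc_ring t \<otimes>\<^bsub>?Q\<^esub> c x b" if "x \<in> carrier M" for b x
    using someI_ex[of "\<lambda>r. r \<in> carrier R \<and> to_loc_ring r = to_loc_ring t \<otimes>\<^bsub>?Q\<^esub> c x b"] tall[OF that]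
    unfolding \<rho>_def by blast+
  obtain u where u: "u \<in> S"
    and uni: "\<And>a b. \<lbrakk>a \<in> carrier R; b \<in> carrier R; to_loc_ring a = to_loc_ring b\<rbrakk> \<Longrightarrow> u \<otimes> a = u \<otimes> b"
    using to_loc_ring_uniform[OF noeth] by blast
  have uR: "u \<in> carrier R" by (rule S_carrier[OF u])
  define \<psi> where "\<psi> = (\<lambda>b x. u \<otimes> \<rho> b x)"
  have \<psi>c: "\<psi> b x \<in> carrier R" if "x \<in> carrier M" for b x using \<rho>(1)[OF that] uR by (simp add: \<psi>_def)
  have \<psi>_add: "\<psi> b (x \<oplus>\<^bsub>M\<^esub> y) = \<psi> b x \<oplus> \<psi> b y" if xy: "x \<in> carrier M" "y \<in> carrier M" for b x y
  proof -
    have "to_loc_ring (\<rho> b (x \<oplus>\<^bsub>M\<^esub> y)) = to_loc_ring (\<rho> b x \<oplus> \<rho> b y)"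
      using xy \<rho> cc ic[OF tR] by (simp add: to_loc_ring_add c_add MS.R.r_distr)
    then have "u \<otimes> \<rho> b (x \<oplus>\<^bsub>M\<^esub> y) = u \<otimes> (\<rho> b x \<oplus> \<rho> b y)" using \<rho>(1) xy by (intro uni) auto
    then show ?thesis using \<rho>(1) xy uR by (simp add: \<psi>_def r_distr)
  qed
  have \<psi>_smult: "\<psi> b (q \<odot>\<^bsub>M\<^esub> x) = q \<otimes> \<psi> b x" if x: "q \<in> carrier R" "x \<in> carrier M" for b q x
  proof -
    have "to_loc_ring (\<rho> b (q \<odot>\<^bsub>M\<^esub> x)) = to_loc_ring (q \<otimes> \<rho> b x)"
      using x \<rho> cc ic[OF tR] ic[OF x(1)] by (simp add: to_loc_ring_mult c_smult MS.R.m_lcomm)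
    then have "u \<otimes> \<rho> b (q \<odot>\<^bsub>M\<^esub> x) = u \<otimes> (q \<otimes> \<rho> b x)" using \<rho>(1) x by (intro uni) auto
    then show ?thesis using \<rho>(1) x uR by (simp add: \<psi>_def m_lcomm)
  qed
  have \<psi>loc: "to_loc_ring (\<psi> b x) = to_loc_ring u \<otimes>\<^bsub>?Q\<^esub> (to_loc_ring t \<otimes>\<^bsub>?Q\<^esub> c x b)" if "x \<in> carrier M" for b x
    using \<rho>[OF that] uR by (simp add: \<psi>_def to_loc_ring_mult)
  \<comment> \<open>The basis elements are themselves fractions. One \<open>T\<close> clears their
    denominators, and since \<open>e\<close> is onto, the resulting elements of \<open>M\<close> are
    images of elements \<open>y b\<close> of \<open>F\<close>.\<close>
  have "\<exists>T\<in>S. \<forall>b\<in>B. to_loc_ring T \<odot>\<^bsub>?MS\<^esub> b \<in> to_loc M ` carrier M"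
  proof (rule common_multiplier[OF B(1)])
    fix b assume "b \<in> B"
    then have "b \<in> carrier ?MS" using B(2) X(1) by blast
    from clear_denominator[OF M this] show "\<exists>T\<in>S. to_loc_ring T \<odot>\<^bsub>?MS\<^esub> b \<in> to_loc M ` carrier M" by blast
  next
    fix b s w assume b: "b \<in> B" and sw: "s \<in> S" "w \<in> S" and "to_loc_ring s \<odot>\<^bsub>?MS\<^esub> b \<in> to_loc M ` carrier M"
    then obtain y where y: "y \<in> carrier M" "to_loc_ring s \<odot>\<^bsub>?MS\<^esub> b = to_loc M y" by blast
    have "b \<in> carrier ?MS" using b B(2) X(1) by blast
    then have "to_loc_ring (w \<otimes> s) \<odot>\<^bsub>?MS\<^esub> b = to_loc M (w \<odot>\<^bsub>M\<^esub> y)"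
      using y sw S_carrier ic by (simp add: to_loc_ring_mult MS.smult_assoc1 jsm)
    then show "to_loc_ring (w \<otimes> s) \<odot>\<^bsub>?MS\<^esub> b \<in> to_loc M ` carrier M" using y sw S_carrier by blast
  qed
  then obtain T where T: "T \<in> S" "\<And>b. b \<in> B \<Longrightarrow> to_loc_ring T \<odot>\<^bsub>?MS\<^esub> b \<in> to_loc M ` e ` carrier F"
    unfolding surj by blast
  have TR: "T \<in> carrier R" by (rule S_carrier[OF T(1)])
  have "\<exists>y. y \<in> carrier F \<and> to_loc M (e y) = to_loc_ring T \<odot>\<^bsub>?MS\<^esub> b" if "b \<in> B" for b
    using T(2)[OF that] by auto
  then obtain y where y: "\<And>b. b \<in> B \<Longrightarrow> y b \<in> carrier F" "\<And>b. b \<in> B \<Longrightarrow> to_loc M (e (y b)) = to_loc_ring T \<odot>\<^bsub>?MS\<^esub> b"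
    by metis
  note eM = mod_hom_closed[OF e]
  define \<sigma> where "\<sigma> = (\<lambda>x. \<Oplus>\<^bsub>F\<^esub>b\<in>B. \<psi> b x \<odot>\<^bsub>F\<^esub> y b)"
  have \<sigma>: "\<sigma> \<in> mod_hom R M F"
    unfolding \<sigma>_def
    by (rule mod_hom_sum[OF F B(1)], rule mod_homI)
      (simp_all add: y(1) \<psi>c \<psi>_add \<psi>_smult F.smult_l_distr F.smult_assoc1)
  \<comment> \<open>The accumulated denominators: \<open>t\<close> clears the coordinates of
    \<open>x\<close>, \<open>u\<close> makes the cleared coordinates linear in \<open>x\<close>, and
    \<open>T\<close> clears the basis elements.\<close>
  let ?k = "u \<otimes> (T \<otimes> t)"
  have kR: "?k \<in> carrier R" using uR TR tR by simp
  have loc: "to_loc M (?k \<odot>\<^bsub>M\<^esub> x) = to_loc M (e (\<sigma> x))" if x: "x \<in> carrier M" for x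
  proof -
    have bMS: "b \<in> carrier ?MS" if "b \<in> B" for b using that B(2) X(1) by blast
    have "to_loc M x = ?L (c x)" using Lco[OF jc[OF x]] by (simp add: c_def)
    also have "\<dots> = (\<Oplus>\<^bsub>?MS\<^esub>b\<in>B. c x b \<odot>\<^bsub>?MS\<^esub> b)"
      by (rule lin_comb_eq[OF MS cfin[OF x] idX B]) (use c_out[OF x] in blast)
    finally have "to_loc M (?k \<odot>\<^bsub>M\<^esub> x) = to_loc_ring ?k \<odot>\<^bsub>?MS\<^esub> (\<Oplus>\<^bsub>?MS\<^esub>b\<in>B. c x b \<odot>\<^bsub>?MS\<^esub> b)"
      using jsm[OF kR x] by simp
    also have "\<dots> = (\<Oplus>\<^bsub>?MS\<^esub>b\<in>B. to_loc_ring ?k \<odot>\<^bsub>?MS\<^esub> (c x b \<odot>\<^bsub>?MS\<^esub> b))"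
      by (rule MS.finsum_smult_ldistr[OF B(1) ic[OF kR]]) (use cc[OF x] bMS in auto)
    also have "\<dots> = (\<Oplus>\<^bsub>?MS\<^esub>b\<in>B. to_loc M (\<psi> b x \<odot>\<^bsub>M\<^esub> e (y b)))"
    proof (rule MS.finsum_cong')
      show "(\<lambda>b. to_loc M (\<psi> b x \<odot>\<^bsub>M\<^esub> e (y b))) \<in> B \<rightarrow> carrier ?MS"
        using jc \<psi>c[OF x] eM y(1) by simp
      fix b assume b: "b \<in> B"
      have i: "to_loc_ring u \<in> carrier ?Q" "to_loc_ring t \<in> carrier ?Q" "to_loc_ring T \<in> carrier ?Q"
        using ic uR tR TR by blast+
      have "to_loc_ring ?k = to_loc_ring u \<otimes>\<^bsub>?Q\<^esub> (to_loc_ring T \<otimes>\<^bsub>?Q\<^esub> to_loc_ring t)"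
        using uR tR TR by (simp add: to_loc_ring_mult)
      then have "to_loc_ring ?k \<odot>\<^bsub>?MS\<^esub> (c x b \<odot>\<^bsub>?MS\<^esub> b) =
        (to_loc_ring u \<otimes>\<^bsub>?Q\<^esub> (to_loc_ring T \<otimes>\<^bsub>?Q\<^esub> to_loc_ring t) \<otimes>\<^bsub>?Q\<^esub> c x b) \<odot>\<^bsub>?MS\<^esub> b"
        using i cc[OF x] bMS[OF b] by (simp add: MS.smult_assoc1)
      \<comment> \<open>Regrouped so that \<open>u\<close>, \<open>t\<close> and the coordinate of
        \<open>x\<close> form \<open>\<psi> b x\<close>, while \<open>T\<close> stays next to
        \<open>b\<close>.\<close>
      also have "to_loc_ring u \<otimes>\<^bsub>?Q\<^esub> (to_loc_ring T \<otimes>\<^bsub>?Q\<^esub> to_loc_ring t) \<otimes>\<^bsub>?Q\<^esub> c x b =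
          to_loc_ring (\<psi> b x) \<otimes>\<^bsub>?Q\<^esub> to_loc_ring T"
        using i cc[OF x] by (simp add: \<psi>loc[OF x] MS.R.m_ac)
      also have "(to_loc_ring (\<psi> b x) \<otimes>\<^bsub>?Q\<^esub> to_loc_ring T) \<odot>\<^bsub>?MS\<^esub> b =
          to_loc_ring (\<psi> b x) \<odot>\<^bsub>?MS\<^esub> to_loc M (e (y b))"
        using i ic[OF \<psi>c[OF x]] bMS[OF b] by (simp add: MS.smult_assoc1 y(2)[OF b])
      finally show "to_loc_ring ?k \<odot>\<^bsub>?MS\<^esub> (c x b \<odot>\<^bsub>?MS\<^esub> b) = to_loc M (\<psi> b x \<odot>\<^bsub>M\<^esub> e (y b))"
        using jsm[OF \<psi>c[OF x] eM[OF y(1)[OF b]]] by simp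
    qed simp
    also have "\<dots> = to_loc M (\<Oplus>\<^bsub>M\<^esub>b\<in>B. \<psi> b x \<odot>\<^bsub>M\<^esub> e (y b))"
      by (rule to_loc_finsum[OF M MS.abelian_group_axioms B(1), symmetric]) (use \<psi>c[OF x] eM y(1) in simp)
    also have "(\<Oplus>\<^bsub>M\<^esub>b\<in>B. \<psi> b x \<odot>\<^bsub>M\<^esub> e (y b)) = (\<Oplus>\<^bsub>M\<^esub>b\<in>B. e (\<psi> b x \<odot>\<^bsub>F\<^esub> y b))"
      by (rule M.finsum_cong') (use \<psi>c[OF x] eM y(1) mod_hom_smult[OF e] in auto)
    also have "\<dots> = e (\<sigma> x)"
      unfolding \<sigma>_def by (rule mod_hom_finsum[OF F M e B(1), symmetric]) (use \<psi>c[OF x] y(1) in simp)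
    finally show ?thesis .
  qed
  have kx: "?k \<odot>\<^bsub>M\<^esub> x \<in> carrier M" and e\<sigma>: "e (\<sigma> x) \<in> carrier M" if "x \<in> carrier M" for x
    using that kR eM mod_hom_closed[OF \<sigma>] by auto
  \<comment> \<open>So far \<open>?k x\<close> and \<open>e (\<sigma> x)\<close> agree only in the
    localization. One \<open>v\<close> makes them equal in \<open>M\<close> on the finitely many
    generators, and linearity of both sides extends this to all \<open>x\<close>.\<close>
  have "\<exists>v\<in>S. \<forall>a\<in>A. v \<odot>\<^bsub>M\<^esub> (?k \<odot>\<^bsub>M\<^esub> a) = v \<odot>\<^bsub>M\<^esub> e (\<sigma> a)"
  proof (rule common_multiplier[OF A(1)])
    fix a assume "a \<in> A"
    then show "\<exists>v\<in>S. v \<odot>\<^bsub>M\<^esub> (?k \<odot>\<^bsub>M\<^esub> a) = v \<odot>\<^bsub>M\<^esub> e (\<sigma> a)"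
      using loc[OF AM] to_loc_eq_iff[OF M kx[OF AM] e\<sigma>[OF AM]] by blast
  next
    fix a s w assume "a \<in> A" "s \<in> S" "w \<in> S" "s \<odot>\<^bsub>M\<^esub> (?k \<odot>\<^bsub>M\<^esub> a) = s \<odot>\<^bsub>M\<^esub> e (\<sigma> a)"
    then show "(w \<otimes> s) \<odot>\<^bsub>M\<^esub> (?k \<odot>\<^bsub>M\<^esub> a) = (w \<otimes> s) \<odot>\<^bsub>M\<^esub> e (\<sigma> a)"
      using S_carrier kx[OF AM] e\<sigma>[OF AM] by (simp add: M.smult_assoc1)
  qed
  then obtain v where v: "v \<in> S" "\<And>a. a \<in> A \<Longrightarrow> v \<odot>\<^bsub>M\<^esub> (?k \<odot>\<^bsub>M\<^esub> a) = v \<odot>\<^bsub>M\<^esub> e (\<sigma> a)" by blast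
  have vR: "v \<in> carrier R" by (rule S_carrier[OF v(1)])
  define h where "h = (\<lambda>x. v \<odot>\<^bsub>M\<^esub> (?k \<odot>\<^bsub>M\<^esub> x))"
  define h' where "h' = (\<lambda>x. v \<odot>\<^bsub>M\<^esub> e (\<sigma> x))"
  have h: "h \<in> mod_hom R M M" unfolding h_def
    by (intro mod_hom_scale[OF M _ vR] mod_hom_scale[OF M mod_hom_id kR])
  have h': "h' \<in> mod_hom R M M" unfolding h'_def
    by (intro mod_hom_scale[OF M _ vR] mod_hom_comp[OF \<sigma> e])
  have hh: "h x = h' x" if "x \<in> carrier M" for x
    using _ _ _ _ that
  proof (rule Aind)
    show "h \<zero>\<^bsub>M\<^esub> = h' \<zero>\<^bsub>M\<^esub>" using mod_hom_zero[OF M M h] mod_hom_zero[OF M M h'] by simp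
  next
    fix a assume "a \<in> A" then show "h a = h' a" using v(2) by (simp add: h_def h'_def)
  qed (simp_all add: mod_hom_add[OF h] mod_hom_add[OF h'] mod_hom_smult[OF h] mod_hom_smult[OF h'])
  show ?thesis
  proof (intro bexI ballI)
    show "v \<otimes> ?k \<in> S" by (intro mult_S v(1) u T(1) t(1))
    show "(\<lambda>x. v \<odot>\<^bsub>F\<^esub> \<sigma> x) \<in> mod_hom R M F" by (rule mod_hom_scale[OF F \<sigma> vR])
    fix x assume x: "x \<in> carrier M"
    have "e (v \<odot>\<^bsub>F\<^esub> \<sigma> x) = h' x" using mod_hom_smult[OF e vR mod_hom_closed[OF \<sigma> x]] by (simp add: h'_def)
    then show "e (v \<odot>\<^bsub>F\<^esub> \<sigma> x) = (v \<otimes> ?k) \<odot>\<^bsub>M\<^esub> x"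
      using hh[OF x] x vR kR by (simp add: h_def M.smult_assoc1)
  qed
qed

end

lemma primeideal_mult_set:
  assumes "primeideal P R" shows "mult_set R (carrier R - P)"
proof -
  interpret primeideal P R by fact
  show ?thesis
  proof
    show "\<one>\<^bsub>R\<^esub> \<in> carrier R - P" using I_notcarr one_imp_carrier by auto
  qed (use I_prime in auto)
qed

section \<open>Annihilators of cohomology classes\<close>

text \<open>For a cocycle \<open>z\<close> this is the annihilator of its cohomology class,
  expressed through the representing cochain.\<close>

definition cobd_ann :: "('r, 'x) ring_scheme \<Rightarrow> (nat \<Rightarrow> ('r, 'p) module) \<Rightarrow> (nat \<Rightarrow> 'p \<Rightarrow> 'p) \<Rightarrow>
    ('r, 'n, 'z) module_scheme \<Rightarrow> nat \<Rightarrow> ('p \<Rightarrow> 'n) \<Rightarrow> 'r set"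
  where "cobd_ann R F d N i z = {r \<in> carrier R. (\<lambda>x. r \<odot>\<^bsub>N\<^esub> z x) \<in> cobd R F d N i}"

lemma cobd_ann_ideal:
  assumes N: "module R N" and z: "z \<in> cocyc R F d N i"
  shows "ideal (cobd_ann R F d N i z) R"
proof -
  interpret N: module R N by fact
  have zc: "z x \<in> carrier N" if "x \<in> carrier (F i)" for x
    using z that by (auto simp: cocyc_def intro: mod_hom_closed)
  have left: "b \<otimes>\<^bsub>R\<^esub> a \<in> cobd_ann R F d N i z" if "a \<in> cobd_ann R F d N i z" "b \<in> carrier R" for a b
  proof -
    have "(\<lambda>x. b \<odot>\<^bsub>N\<^esub> (a \<odot>\<^bsub>N\<^esub> z x)) \<in> cobd R F d N i" 
      by (rule cobd_scale[OF N]) (use that in \<open>simp_all add: cobd_ann_def\<close>)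
    then have "(\<lambda>x. (b \<otimes>\<^bsub>R\<^esub> a) \<odot>\<^bsub>N\<^esub> z x) \<in> cobd R F d N i"
      by (subst cobd_cong[where z' = "\<lambda>x. b \<odot>\<^bsub>N\<^esub> (a \<odot>\<^bsub>N\<^esub> z x)"])
        (use that zc in \<open>auto simp: cobd_ann_def N.smult_assoc1\<close>)
    then show ?thesis using that by (simp add: cobd_ann_def)
  qed
  show ?thesis
  proof (rule idealI)
    show "subgroup (cobd_ann R F d N i z) (add_monoid R)"
    proof (rule N.R.add.subgroupI)
      have "(\<lambda>x. \<zero>\<^bsub>R\<^esub> \<odot>\<^bsub>N\<^esub> z x) \<in> cobd R F d N i"
        by (subst cobd_cong[where z' = "\<lambda>x. \<zero>\<^bsub>N\<^esub>"]) (use zc cobd_zero[OF N] in auto)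
      then show "cobd_ann R F d N i z \<noteq> {}" by (auto simp: cobd_ann_def)
      fix a assume a: "a \<in> cobd_ann R F d N i z"
      then have "(\<ominus>\<^bsub>R\<^esub> \<one>\<^bsub>R\<^esub>) \<otimes>\<^bsub>R\<^esub> a \<in> cobd_ann R F d N i z" by (intro left) auto
      then show "\<ominus>\<^bsub>R\<^esub> a \<in> cobd_ann R F d N i z" using a by (simp add: cobd_ann_def N.R.l_minus)
    next
      fix a b assume ab: "a \<in> cobd_ann R F d N i z" "b \<in> cobd_ann R F d N i z"
      then have "(\<lambda>x. a \<odot>\<^bsub>N\<^esub> z x \<oplus>\<^bsub>N\<^esub> b \<odot>\<^bsub>N\<^esub> z x) \<in> cobd R F d N i"
        by (intro cobd_add[OF N]) (simp_all add: cobd_ann_def)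
      then have "(\<lambda>x. (a \<oplus>\<^bsub>R\<^esub> b) \<odot>\<^bsub>N\<^esub> z x) \<in> cobd R F d N i"
        by (subst cobd_cong[where z' = "\<lambda>x. a \<odot>\<^bsub>N\<^esub> z x \<oplus>\<^bsub>N\<^esub> b \<odot>\<^bsub>N\<^esub> z x"])
          (use ab zc in \<open>auto simp: cobd_ann_def N.smult_l_distr\<close>)
      then show "a \<oplus>\<^bsub>R\<^esub> b \<in> cobd_ann R F d N i z" using ab by (simp add: cobd_ann_def)
    qed (auto simp: cobd_ann_def)
    fix a x assume a: "a \<in> cobd_ann R F d N i z" "x \<in> carrier R"
    then show "x \<otimes>\<^bsub>R\<^esub> a \<in> cobd_ann R F d N i z" by (rule left)
    then show "a \<otimes>\<^bsub>R\<^esub> x \<in> cobd_ann R F d N i z" using a by (simp add: cobd_ann_def N.R.m_comm)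
  qed (rule N.R.ring_axioms)
qed

text \<open>Since \<open>a (r z)\<close> is \<open>(a r) z\<close>, the colon ideals of an
  annihilator are annihilators of multiples of the class. A prime among them is therefore an
  associated prime.\<close>

lemma cobd_ann_scale:
  assumes N: "module R N" and z: "z \<in> cocyc R F d N i" and r: "r \<in> carrier R"
  shows "cobd_ann R F d N i (\<lambda>x. r \<odot>\<^bsub>N\<^esub> z x) = {a \<in> carrier R. a \<otimes>\<^bsub>R\<^esub> r \<in> cobd_ann R F d N i z}"
proof -
  interpret N: module R N by fact
  have zc: "z x \<in> carrier N" if "x \<in> carrier (F i)" for x
    using z that by (auto simp: cocyc_def intro: mod_hom_closed)
  have "(\<lambda>x. a \<odot>\<^bsub>N\<^esub> (r \<odot>\<^bsub>N\<^esub> z x)) \<in> cobd R F d N i \<longleftrightarrow> (\<lambda>x. (a \<otimes>\<^bsub>R\<^esub> r) \<odot>\<^bsub>N\<^esub> z x) \<in> cobd R F d N i"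
    if "a \<in> carrier R" for a
    by (rule cobd_cong) (use that r zc in \<open>auto simp: N.smult_assoc1\<close>)
  then show ?thesis using r by (auto simp: cobd_ann_def)
qed

lemma cobd_ann_pullback:
  assumes "chain_map R F d G d' \<phi>"
  shows "cobd_ann R G d' N i z \<subseteq> cobd_ann R F d N i (\<lambda>x. z (\<phi> i x))"
  using cobd_pullback[OF assms, of "\<lambda>x. _ \<odot>\<^bsub>N\<^esub> z x"] by (auto simp: cobd_ann_def)

text \<open>The resolution is obtained together with the description, since it has to be the one
  chosen inside \<open>Ext\<close>. Associated primes are then read off from annihilators of
  cocycles on it.\<close>

lemma E_Ass_eq:
  fixes R :: "('r, 'x) ring_scheme" and M :: "('r, 'm, 'y) module_scheme"
  assumes M: "module R M"
  obtains F :: "nat \<Rightarrow> ('r, ('r, 'm) res_elem) module" and d e where "free_resolution R M F d e"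
    "E_Ass R M = {P. primeideal P R \<and> (\<exists>i. \<exists>z\<in>cocyc R F d (ring_as_module R) i. P = cobd_ann R F d (ring_as_module R) i z)}"
proof -
  interpret M: module R M by fact
  obtain F d e where ch: "chosen_resolution R M = (F, d, e)" by (metis surj_pair)
  then have F: "free_resolution R M F d e" using free_resolution_exists[OF M] by simp
  note f = resolutionD[OF free_resolution_imp_resolution[OF M F]]
  have "Ass R (Ext R i M (ring_as_module R)) = {P. primeideal P R \<and>
      (\<exists>z\<in>cocyc R F d (ring_as_module R) i. P = cobd_ann R F d (ring_as_module R) i z)}" for i
    unfolding Ext_def ch prod.case cobd_ann_def
    by (rule Ass_ext_of_resolution) (fact f ring_as_module_module[OF M.R.is_cring])+
  then show ?thesis by (intro that[OF F]) (auto simp: E_Ass_def)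
qed

text \<open>Multiplication by \<open>s\<close> on the resolution is homotopic to the chain map that is \<open>\<sigma> \<circ> e\<close> in degree
  \<open>0\<close> and zero in all other degrees.\<close>

lemma ext_annihilated:
  assumes M: "module R M" and F: "free_resolution R M F d e" and N: "module R N"
    and s: "s \<in> carrier R" and \<sigma>: "\<sigma> \<in> mod_hom R M (F 0)" and e\<sigma>: "\<And>x. x \<in> carrier M \<Longrightarrow> e (\<sigma> x) = s \<odot>\<^bsub>M\<^esub> x"
    and z: "z \<in> cocyc R F d N (Suc j)"
  shows "s \<in> cobd_ann R F d N (Suc j) z"
proof -
  note r = free_resolution_imp_resolution[OF M F]
  note f = resolutionD[OF r] and fdd = resolution_dd[OF r]
  interpret M: module R M by fact
  interpret N: module R N by fact
  interpret F: module R "F n" for n by (rule f)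
  define \<psi> where "\<psi> = (\<lambda>n x. case n of 0 \<Rightarrow> \<sigma> (e x) | Suc k \<Rightarrow> \<zero>\<^bsub>F n\<^esub>)"
  have scale: "chain_map R F d F d (\<lambda>n x. s \<odot>\<^bsub>F n\<^esub> x)"
    unfolding chain_map_def
    using mod_hom_scale[OF f(2) mod_hom_id s] mod_hom_smult[OF f(3) s] by simp
  have \<psi>: "chain_map R F d F d \<psi>"
    unfolding chain_map_def
  proof (intro conjI allI ballI)
    fix n show "\<psi> n \<in> mod_hom R (F n) (F n)"
      using mod_hom_comp[OF f(4) \<sigma>] mod_hom_const_zero[OF f(2)] by (cases n) (simp_all add: \<psi>_def)
    fix x assume x: "x \<in> carrier (F (Suc n))"
    have "d n \<zero>\<^bsub>F (Suc n)\<^esub> = \<zero>\<^bsub>F n\<^esub>" by (rule mod_hom_zero[OF f(2) f(2) f(3)])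
    moreover have "\<sigma> (e (d 0 y)) = \<zero>\<^bsub>F 0\<^esub>" if "y \<in> carrier (F (Suc 0))" for y
      using fdd(1)[OF that] mod_hom_zero[OF M f(2) \<sigma>] by simp
    ultimately show "\<psi> n (d n x) = d n (\<psi> (Suc n) x)"
      using x by (auto simp: \<psi>_def split: nat.split)
  qed
  have zh: "z \<in> mod_hom R (F (Suc j)) N" using z by (simp add: cocyc_def)
  \<comment> \<open>Both chain maps cover multiplication by \<open>s\<close> on \<open>M\<close>, as
    \<open>e (s x)\<close>, \<open>s (e x)\<close> and \<open>e (\<sigma> (e x))\<close> coincide.
    Their difference therefore covers zero.\<close>
  have "(\<lambda>x. z (s \<odot>\<^bsub>F (Suc j)\<^esub> x \<oplus>\<^bsub>F (Suc j)\<^esub> \<ominus>\<^bsub>F (Suc j)\<^esub> \<psi> (Suc j) x)) \<in> cobd R F d N (Suc j)"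
  proof (rule null_homotopic_cobd[OF M F r chain_map_diff[OF f(2,3) scale \<psi>] _ N z])
    fix x assume x: "x \<in> carrier (F 0)"
    have ex: "e x \<in> carrier M" "\<sigma> (e x) \<in> carrier (F 0)"
      using x mod_hom_closed[OF f(4)] mod_hom_closed[OF \<sigma>] by blast+
    then show "e (s \<odot>\<^bsub>F 0\<^esub> x \<oplus>\<^bsub>F 0\<^esub> \<ominus>\<^bsub>F 0\<^esub> \<psi> 0 x) = \<zero>\<^bsub>M\<^esub>"
      using x s by (simp add: \<psi>_def mod_hom_add[OF f(4)] mod_hom_minus[OF f(2) M f(4)]
        mod_hom_smult[OF f(4)] e\<sigma> M.r_neg)
  qed
  \<comment> \<open>In positive degree the second chain map is zero, so the difference is
    multiplication by \<open>s\<close> itself. This is where the degree has to be of the form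
    \<open>Suc j\<close>.\<close>
  then have "(\<lambda>x. s \<odot>\<^bsub>N\<^esub> z x) \<in> cobd R F d N (Suc j)"
    by (subst cobd_cong[where z' = "\<lambda>x. z (s \<odot>\<^bsub>F (Suc j)\<^esub> x \<oplus>\<^bsub>F (Suc j)\<^esub> \<ominus>\<^bsub>F (Suc j)\<^esub> \<psi> (Suc j) x)"])
      (use s in \<open>auto simp: \<psi>_def F.minus_zero_module mod_hom_smult[OF zh]\<close>)
  then show ?thesis using s by (simp add: cobd_ann_def)
qed

section \<open>Associated primes of the middle term\<close>

theorem proposition5p5:
  fixes R :: "'r ring" and m :: "'r set"
    and M1 :: "('r, 'a) module" and M2 :: "('r, 'b) module" and M3 :: "('r, 'c) module"
    and f :: "'a \<Rightarrow> 'b" and g :: "'b \<Rightarrow> 'c"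
  assumes "local_ring R m" and "noetherian_ring R"
    and "module R M1" and "module R M2" and "module R M3"
    and "fin_gen_module R M1" and "fin_gen_module R M2" and "fin_gen_module R M3"
    and "short_exact R M1 M2 M3 f g"
    and "locally_free_punctured R m M3"
  shows "E_Ass R M2 \<subseteq> E_Ass R M1 \<union> E_Ass R M3"
proof
  fix P assume P: "P \<in> E_Ass R M2"
  note M1 = assms(3) and M2 = assms(4) and M3 = assms(5) and ex = assms(9)
  interpret M2: module R M2 by fact
  interpret M3: module R M3 by fact
  let ?N = "ring_as_module R"
  have N: "module R ?N" by (rule ring_as_module_module[OF M2.R.is_cring])
  obtain F1 :: "nat \<Rightarrow> ('r, ('r, 'a) res_elem) module" and d1 e1 where F1: "free_resolution R M1 F1 d1 e1" and E1:
    "E_Ass R M1 = {P. primeideal P R \<and> (\<exists>i. \<exists>z\<in>cocyc R F1 d1 ?N i. P = cobd_ann R F1 d1 ?N i z)}"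
    by (rule E_Ass_eq[OF M1])
  obtain F2 :: "nat \<Rightarrow> ('r, ('r, 'b) res_elem) module" and d2 e2 where F2: "free_resolution R M2 F2 d2 e2" and E2:
    "E_Ass R M2 = {P. primeideal P R \<and> (\<exists>i. \<exists>z\<in>cocyc R F2 d2 ?N i. P = cobd_ann R F2 d2 ?N i z)}"
    by (rule E_Ass_eq[OF M2])
  obtain F3 :: "nat \<Rightarrow> ('r, ('r, 'c) res_elem) module" and d3 e3 where F3: "free_resolution R M3 F3 d3 e3" and E3:
    "E_Ass R M3 = {P. primeideal P R \<and> (\<exists>i. \<exists>z\<in>cocyc R F3 d3 ?N i. P = cobd_ann R F3 d3 ?N i z)}"
    by (rule E_Ass_eq[OF M3])
  note r1 = free_resolution_imp_resolution[OF M1 F1] and r2 = free_resolution_imp_resolution[OF M2 F2]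
    and r3 = free_resolution_imp_resolution[OF M3 F3]
  note f3 = resolutionD[OF r3]
  have fh: "f \<in> mod_hom R M1 M2" and gh: "g \<in> mod_hom R M2 M3" and gim: "g ` carrier M2 = carrier M3"
    using ex by (auto simp: short_exact_def)
  obtain \<phi> where \<phi>: "chain_map R F1 d1 F2 d2 \<phi>" "\<And>x. x \<in> carrier (F1 0) \<Longrightarrow> e2 (\<phi> 0 x) = f (e1 x)"
    using chain_lift[OF M1 F1 r2 fh] by blast
  obtain \<gamma> where \<gamma>: "chain_map R F2 d2 F3 d3 \<gamma>" "\<And>x. x \<in> carrier (F2 0) \<Longrightarrow> e3 (\<gamma> 0 x) = g (e2 x)"
    using chain_lift[OF M2 F2 r3 gh] by blast
  \<comment> \<open>A single \<open>s\<close> outside \<open>p\<close> serves all cocycles in all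
    positive degrees. The fact is used twice: for \<open>P\<close>, and for an associated prime of
    the Ext of \<open>M3\<close> found below.\<close>
  have kill: "\<exists>s\<in>carrier R - p. \<forall>j. \<forall>z\<in>cocyc R F3 d3 ?N (Suc j). s \<in> cobd_ann R F3 d3 ?N (Suc j) z"
    if p: "primeideal p R" "p \<noteq> m" for p
  proof -
    interpret S: mult_set R "carrier R - p" by (rule primeideal_mult_set[OF p(1)])
    have "free_module (loc_ring R (carrier R - p)) (loc_module R (carrier R - p) M3)"
      using assms(10) p by (simp add: locally_free_punctured_def)
    from S.local_section[OF assms(2) M3 assms(8) this f3(2,4,5)]
    obtain s \<sigma> where "s \<in> carrier R - p" "\<sigma> \<in> mod_hom R M3 (F3 0)" "\<And>x. x \<in> carrier M3 \<Longrightarrow> e3 (\<sigma> x) = s \<odot>\<^bsub>M3\<^esub> x"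
      by blast
    then show ?thesis using ext_annihilated[OF M3 F3 N] by (intro bexI[of _ s]) auto
  qed
  obtain i x where Pprime: "primeideal P R" and x: "x \<in> cocyc R F2 d2 ?N i" and Px: "P = cobd_ann R F2 d2 ?N i x"
    using P unfolding E2 by blast
  interpret P: primeideal P R by (rule Pprime)
  let ?y = "\<lambda>a. x (\<phi> i a)"
  have y: "?y \<in> cocyc R F1 d1 ?N i" by (rule cocyc_pullback[OF \<phi>(1) x])
  have Py: "P \<subseteq> cobd_ann R F1 d1 ?N i ?y" unfolding Px by (rule cobd_ann_pullback[OF \<phi>(1)])
  show "P \<in> E_Ass R M1 \<union> E_Ass R M3"
  proof (cases "cobd_ann R F1 d1 ?N i ?y \<subseteq> P")
    case True
    then have "P = cobd_ann R F1 d1 ?N i ?y" using Py by blast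
    then show ?thesis using Pprime y unfolding E1 by blast
  next
    case False
    \<comment> \<open>The annihilator of the image of the class is not contained in
      \<open>P\<close>. Any element of it outside \<open>P\<close> multiplies the class into the
      kernel of the map to the Ext of \<open>M1\<close>.\<close>
    then obtain r where r: "r \<in> carrier R" "r \<notin> P" "(\<lambda>a. r \<odot>\<^bsub>?N\<^esub> ?y a) \<in> cobd R F1 d1 ?N i"
      by (auto simp: cobd_ann_def)
    let ?z = "\<lambda>a. r \<odot>\<^bsub>?N\<^esub> x a"
    have z: "?z \<in> cocyc R F2 d2 ?N i" by (rule cocyc_scale[OF N x r(1)])
    have "\<exists>w\<in>cocyc R F3 d3 ?N i. (\<lambda>a. ?z a \<oplus>\<^bsub>?N\<^esub> \<ominus>\<^bsub>?N\<^esub> w (\<gamma> i a)) \<in> cobd R F2 d2 ?N i"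
      by (rule ext_exact_middle[OF M1 M2 M3 N ex F1 F2 F3]) (fact \<phi> \<gamma> z r)+
    then obtain w where w: "w \<in> cocyc R F3 d3 ?N i"
      and zw: "(\<lambda>a. ?z a \<oplus>\<^bsub>?N\<^esub> \<ominus>\<^bsub>?N\<^esub> w (\<gamma> i a)) \<in> cobd R F2 d2 ?N i" by blast
    let ?W = "cobd_ann R F3 d3 ?N i w"
    have zc: "?z a \<in> carrier ?N" and wc: "w (\<gamma> i a) \<in> carrier ?N" if "a \<in> carrier (F2 i)" for a
      using z w that chain_mapD(2)[OF \<gamma>(1)] mod_hom_closed[of ?z R "F2 i" ?N] mod_hom_closed[of w R "F3 i" ?N]
      by (auto simp: cocyc_def)
    interpret N: module R ?N by (rule N)
    \<comment> \<open>Primality of \<open>P\<close>: if \<open>a r\<close> lies in \<open>P\<close>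
      and \<open>r\<close> does not, then \<open>a\<close> lies in \<open>P\<close>.\<close>
    have annz: "cobd_ann R F2 d2 ?N i ?z \<subseteq> P"
      unfolding cobd_ann_scale[OF N x r(1)] Px[symmetric] using P.I_prime r(1,2) by blast
    have WP: "?W \<subseteq> P"
    proof
      fix a assume a: "a \<in> ?W"
      then have aR: "a \<in> carrier R" by (simp add: cobd_ann_def)
      have "(\<lambda>b. a \<odot>\<^bsub>?N\<^esub> w (\<gamma> i b)) \<in> cobd R F2 d2 ?N i"
        using a cobd_ann_pullback[OF \<gamma>(1), of ?N i w] by (auto simp: cobd_ann_def)
      \<comment> \<open>Up to a coboundary, \<open>?z\<close> is the pullback of \<open>w\<close>.
        An \<open>a\<close> that kills the class of \<open>w\<close> therefore kills that of
        \<open>?z\<close>.\<close>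
      from cobd_add[OF N cobd_scale[OF N zw aR] this]
      have "(\<lambda>b. a \<odot>\<^bsub>?N\<^esub> ?z b) \<in> cobd R F2 d2 ?N i"
      proof (subst cobd_cong)
        fix b assume b: "b \<in> carrier (F2 i)"
        show "a \<odot>\<^bsub>?N\<^esub> ?z b = a \<odot>\<^bsub>?N\<^esub> (?z b \<oplus>\<^bsub>?N\<^esub> \<ominus>\<^bsub>?N\<^esub> w (\<gamma> i b)) \<oplus>\<^bsub>?N\<^esub> a \<odot>\<^bsub>?N\<^esub> w (\<gamma> i b)"
          using zc[OF b] wc[OF b] aR N.smult_r_distr N.smult_r_minus N.a_assoc N.l_neg by (simp del: ring_as_module_simps)
      qed
      then show "a \<in> P" using annz aR by (auto simp: cobd_ann_def)
    qed
    show ?thesis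
    proof (cases i)
      case 0
      \<comment> \<open>In degree \<open>0\<close> coboundaries are zero, so \<open>?z\<close>
        equals the pullback of \<open>w\<close>. As \<open>g\<close> and \<open>e2\<close> are onto,
        every \<open>c\<close> in \<open>F3 0\<close> agrees with some \<open>\<gamma> 0 b\<close>
        up to a boundary, and \<open>w\<close> vanishes on boundaries. Hence what kills
        \<open>?z\<close> kills \<open>w\<close>.\<close>
      have "P \<subseteq> ?W"
      proof
        fix a assume a: "a \<in> P"
        then have aR: "a \<in> carrier R" by (rule P.a_Hcarr)
        have "a \<otimes>\<^bsub>R\<^esub> r \<in> P" using a r(1) by (rule P.I_r_closed)
        then have "a \<in> cobd_ann R F2 d2 ?N i ?z" unfolding cobd_ann_scale[OF N x r(1)] Px[symmetric] using aR by simp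
        then have az: "a \<odot>\<^bsub>?N\<^esub> ?z b = \<zero>\<^bsub>?N\<^esub>" if "b \<in> carrier (F2 0)" for b
          using that by (simp add: cobd_ann_def cobd_def 0)
        have zw0: "?z b = w (\<gamma> 0 b)" if b: "b \<in> carrier (F2 0)" for b
        proof -
          have "?z b \<oplus>\<^bsub>?N\<^esub> \<ominus>\<^bsub>?N\<^esub> w (\<gamma> 0 b) = \<zero>\<^bsub>?N\<^esub>" using zw b by (simp add: cobd_def 0)
          then have "\<ominus>\<^bsub>?N\<^esub> (\<ominus>\<^bsub>?N\<^esub> w (\<gamma> 0 b)) = ?z b"
            using zc wc b unfolding 0 by (intro N.minus_equality N.a_inv_closed) auto
          then show ?thesis using N.minus_minus wc b unfolding 0 by simp
        qed
        have "a \<odot>\<^bsub>?N\<^esub> w c = \<zero>\<^bsub>?N\<^esub>" if c: "c \<in> carrier (F3 0)" for c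
        proof -
          interpret F3: module R "F3 n" for n by (rule f3)
          have wh: "w \<in> mod_hom R (F3 0) ?N" using w by (simp add: cocyc_def 0)
          have "e3 c \<in> g ` e2 ` carrier (F2 0)"
            unfolding resolutionD(5)[OF r2] gim using mod_hom_closed[OF f3(4) c] .
          then obtain b where b: "b \<in> carrier (F2 0)" "e3 c = g (e2 b)" by blast
          have gb: "\<gamma> 0 b \<in> carrier (F3 0)" using chain_mapD(2)[OF \<gamma>(1) b(1)] .
          have "e3 (c \<oplus>\<^bsub>F3 0\<^esub> \<ominus>\<^bsub>F3 0\<^esub> \<gamma> 0 b) = \<zero>\<^bsub>M3\<^esub>"
            using b c gb \<gamma>(2)[OF b(1)] mod_hom_closed[OF f3(4) c]
            by (simp add: mod_hom_add[OF f3(4)] mod_hom_minus[OF f3(2) M3 f3(4)] M3.r_neg)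
          then have "c \<oplus>\<^bsub>F3 0\<^esub> \<ominus>\<^bsub>F3 0\<^esub> \<gamma> 0 b \<in> d3 0 ` carrier (F3 (Suc 0))"
            unfolding f3(6) using c gb by simp
          then have w0: "w (c \<oplus>\<^bsub>F3 0\<^esub> \<ominus>\<^bsub>F3 0\<^esub> \<gamma> 0 b) = \<zero>\<^bsub>?N\<^esub>"
            using w by (auto simp: cocyc_def 0 simp del: ring_as_module_simps)
          have "c = (c \<oplus>\<^bsub>F3 0\<^esub> \<ominus>\<^bsub>F3 0\<^esub> \<gamma> 0 b) \<oplus>\<^bsub>F3 0\<^esub> \<gamma> 0 b" using c gb by (simp add: F3.a_assoc F3.l_neg)
          then have "w c = w (c \<oplus>\<^bsub>F3 0\<^esub> \<ominus>\<^bsub>F3 0\<^esub> \<gamma> 0 b) \<oplus>\<^bsub>?N\<^esub> w (\<gamma> 0 b)"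
            using mod_hom_add[OF wh, of "c \<oplus>\<^bsub>F3 0\<^esub> \<ominus>\<^bsub>F3 0\<^esub> \<gamma> 0 b" "\<gamma> 0 b"] c gb by (metis F3.a_inv_closed F3.a_closed)
          also have "\<dots> = w (\<gamma> 0 b)" unfolding w0 by (rule N.M.l_zero[OF mod_hom_closed[OF wh gb]])
          finally show ?thesis using az[OF b(1)] unfolding zw0[OF b(1)] by simp
        qed
        then show "a \<in> ?W" using aR by (simp add: cobd_ann_def cobd_def 0)
      qed
      then have "P = ?W" using WP by blast
      then show ?thesis using Pprime w unfolding E3 by blast
    next
      case (Suc j)
      \<comment> \<open>As \<open>?W\<close> lies in the proper ideal \<open>P\<close>, the class of
        \<open>w\<close> is nonzero. The noetherian hypothesis then gives a multiple of it, by
        \<open>r'\<close>, whose annihilator is prime.\<close>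
      have "?W \<noteq> carrier R" using WP P.I_notcarr P.a_subset by blast
      from prime_colon_exists[OF M2.R.is_cring assms(2) cobd_ann_ideal[OF N w] this]
      obtain r' where r': "r' \<in> carrier R" and W: "primeideal {a \<in> carrier R. a \<otimes>\<^bsub>R\<^esub> r' \<in> ?W} R" by blast
      from W have q: "primeideal (cobd_ann R F3 d3 ?N i (\<lambda>a. r' \<odot>\<^bsub>?N\<^esub> w a)) R" (is "primeideal ?q R")
        unfolding cobd_ann_scale[OF N w r'] .
      have w': "(\<lambda>a. r' \<odot>\<^bsub>?N\<^esub> w a) \<in> cocyc R F3 d3 ?N i" by (rule cocyc_scale[OF N w r'])
      \<comment> \<open>Otherwise \<open>kill\<close> yields an element outside \<open>?q\<close>
        that annihilates the class of \<open>r' w\<close>, which means that it lies in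
        \<open>?q\<close>.\<close>
      have "?q = m"
      proof (rule ccontr)
        assume "?q \<noteq> m"
        from kill[OF q this] show False using w' unfolding Suc by blast
      qed
      \<comment> \<open>Otherwise the element outside \<open>P\<close> given by \<open>kill\<close>
        annihilates the class of \<open>w\<close> and so lies in \<open>?W\<close>, which is
        contained in \<open>P\<close>. Thus \<open>P\<close> and \<open>?q\<close> coincide by both
        being equal to \<open>m\<close>.\<close>
      moreover have "P = m"
      proof (rule ccontr)
        assume "P \<noteq> m"
        from kill[OF Pprime this] show False using w WP unfolding Suc by blast
      qed
      ultimately have "P = ?q" by simp
      then show ?thesis using Pprime w' unfolding E3 by blast
    qed
  qed
qed

end
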